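(* The pair $(UK,E)$ is an algebraic weak factorisation system on $\mathbf{Top}$, where $UK$ is the comonad on $\mathbf{Top}^{\mathbf 2}$ induced by the adjunction $U\dashv K$ between $\mathbf{CellCx}$ and $\mathbf{Top}^{\mathbf 2}$, and $E$ is the monad on $\mathbf{Top}^{\mathbf 2}$ given by the codomain part of the counit of this adjunction (with unit and multiplication as described in the context).
   Context: Algebraic weak factorisation systems. For a category $\mathcal{C}$, $\mathcal{C}^{\mathbf 2}$ is its arrow category; morphisms are commutative squares $(a,b)$ with domain component $a$ and codomain component $b$. An awfs $(L,R)$ on $\mathcal{C}$ consists of a comonad $(L,\vec\epsilon,\vec\delta)$ and a monad $(R,\vec\eta,\vec\mu)$ on $\mathcal{C}^{\mathbf 2}$ whose underlying copointed and pointed endofunctors form a functorial factorisation: each $f\colon A\to B$ factors as $A\xrightarrow{Lf}Mf\xrightarrow{Rf}B$ with $\vec\epsilon_f=(1_A,Rf)$, $\vec\eta_f=(Lf,1_B)$, where $M=\mathrm{cod}\circ L=\mathrm{dom}\circ R$. Then $\vec\delta_f=(1,\delta_f)$, $\vec\mu_f=(\mu_f,1)$ with $\delta_f\colon Mf\to MLf$, $\mu_f\colon MRf\to Mf$; it is required (distributivity axiom) that the transformation $LR\to RL$ with components $(\delta_f,\mu_f)$ be a distributive law of the comonad over the monad, i.e. compatible with unit, counit, multiplication and comultiplication. Cell complexes. $\mathcal{J}$ is the set of inclusions $S^{n-1}\hookrightarrow D^n$, $n\ge 0$ (with $S^{-1}=\emptyset$, $S^0$ the endpoints of $D^1$); $\kappa\in\mathcal{J}$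 is written $\partial\kappa\to\overline\kappa$. A stratum $(X,S)$ is a space $X$ (its boundary), a set $S$ of cells, and for each $s\in S$ an element $\kappa_s\in\mathcal{J}$ and a continuous map $b_s\colon\partial\kappa_s\to X$. Its body $\overline{(X,S)}$ is the pushout of $\coprod_s\overline{\kappa_s}\leftarrow\coprod_s\partial\kappa_s\to X$, and $U(X,S)$ is the map $X\to\overline{(X,S)}$. A morphism $(f,p)\colon(X,S)\to(Y,T)$ of strata is a continuous $f\colon X\to Y$ and a function $p\colon S\to T$ with $\kappa_s=\kappa_{p(s)}$ and $f\circ b_s=b_{p(s)}$; it induces $\overline{(f,p)}$ on bodies. A relative cell complex is a sequence of strata $(X_n,S_n)_{n\ge0}$ which is connected ($X_{n+1}=\overline{(X_n,S_n)}$) and proper (for no $s\in S_n$ does $b_s$ factor through $X_m\to X_n$ for some $m<n$). Its boundary $\partial A$ is $X_0$, its body $\overline A$ is the colimit of $X_0\to X_1\to\cdots$, and $UA$ is the transfinite composite $\partial A\to\overline A$. A morphism $\phi$ is a sequence of strata morphisms $(f_n,p_n)$ with $f_{n+1}=\overline{(f_n,p_n)}$; $U\phi=(\partial\phi,\overline\phi)$ with $\partial\phi=f_0$ and $\overline\phi$ the induced map on bodies. This defines $\mathbf{CellCx}$ and $U\colon\mathbf{CellCx}\to\mathbf{Top}^{\mathbf 2}$. Composition. Let $A=(X_n,S_n)_n$ be a cell complex and $(Y,T)$ a stratum with $Y=\overline A$. For $t\in T$ there is a smallest $n_t$ such that $b_t$ factors through $X_{n_t}\to Y$; put $T_n=\{t: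 n_t=n\}$. The composite $(Y,T)*A$ is $(Z_n,U_n)_n$ with $Z_0=X_0$, $Z_{n+1}=\overline{(Z_n,U_n)}$, $U_n=S_n\sqcup T_n$ and the evident attaching maps; its underlying map is $U(Y,T)\circ UA$, and there is a canonical morphism $A\to(Y,T)*A$ over $(1,U(Y,T))$. For cell complexes $A,B$ with $\overline A=\partial B$, composing the strata of $B$ onto $A$ one by one gives a sequence $A=A_0\to A_1\to\cdots$, and $B*A$ is its colimit; $U(B*A)=UB\circ UA$ (up to the canonical identification of colimits). The functors $K$ and $E$. $U$ has a right adjoint $K$, chosen as follows: for $f\colon A\to B$, $Kf=(A_n,S_n)_n$ where $A_0=A$, $E_0f=f$, $A_{n+1}=\overline{(A_n,S_n)}$, $S_n$ is the set of morphisms $j\to E_nf$ in $\mathbf{Top}^{\mathbf 2}$ with $j\in\mathcal{J}$ whose domain component $\partial j\to A_n$ does not factor through $A_{n-1}$ (no condition if $n=0$), this domain component being the attaching map and $j$ the cell shape, and $E_{n+1}f\colon A_{n+1}\to B$ is induced by $E_nf$ and the codomain components of the elements of $S_n$. $Ef\colon\overline{Kf}\to B$ is the map induced by all $E_nf$; the counit of the adjunction at $f$ is $(1_A,Ef)\colon UKf\to f$. For a square $(a,b)\colon f\to g$, $E(a,b)=(\overline{K(a,b)},b)$. The unit of the monad $E$ is $(UKf,1_B)\colon f\to Ef$. Its multiplication is $(\mu_f,1_B)\colon EEf\to Ef$, where $\mu_f=\overline\phi$ and $\phi\colon KEf*Kf\to Kf$ is the cell complex morphism corresponding under $U\dashv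 K$ to $(1_A,EEf)\colon U(KEf*Kf)\to f$. *)

theory Defs
  imports "HOL-Analysis.Analysis"
begin

section \<open>Categories, monads and comonads\<close>

record ('o, 'm) cat =
  Obj :: "'o set"
  Mor :: "'m set"
  Dom :: "'m \<Rightarrow> 'o"
  Cod :: "'m \<Rightarrow> 'o"
  Idm :: "'o \<Rightarrow> 'm"
  Cmp :: "'m \<Rightarrow> 'm \<Rightarrow> 'm"  \<comment> \<open>\<open>Cmp C g f\<close> is \<open>g\<close> after \<open>f\<close>\<close>

definition hom :: "('o, 'm) cat \<Rightarrow> 'o \<Rightarrow> 'o \<Rightarrow> 'm set" where
  "hom C a b = {f \<in> Mor C. Dom C f = a \<and> Cod C f = b}"

locale category =
  fixes C :: "('o, 'm) cat"
  assumes dom_obj: "f \<in> Mor C \<Longrightarrow> Dom C f \<in> Obj C"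
    and cod_obj: "f \<in> Mor C \<Longrightarrow> Cod C f \<in> Obj C"
    and id_hom: "a \<in> Obj C \<Longrightarrow> Idm C a \<in> hom C a a"
    and cmp_hom: "f \<in> hom C a b \<Longrightarrow> g \<in> hom C b c \<Longrightarrow> Cmp C g f \<in> hom C a c"
    and cmp_id_right: "f \<in> hom C a b \<Longrightarrow> Cmp C f (Idm C a) = f"
    and cmp_id_left: "f \<in> hom C a b \<Longrightarrow> Cmp C (Idm C b) f = f"
    and cmp_assoc: "f \<in> hom C a b \<Longrightarrow> g \<in> hom C b c \<Longrightarrow> h \<in> hom C c d \<Longrightarrow>
      Cmp C h (Cmp C g f) = Cmp C (Cmp C h g) f"

record ('o, 'm, 'p, 'n) functr =
  Fob :: "'o \<Rightarrow> 'p"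
  Fmo :: "'m \<Rightarrow> 'n"

definition id_functr :: "('o, 'm, 'o, 'm) functr" where
  "id_functr = \<lparr>Fob = id, Fmo = id\<rparr>"

definition cmp_functr ::
  "('p, 'n, 'q, 'l) functr \<Rightarrow> ('o, 'm, 'p, 'n) functr \<Rightarrow> ('o, 'm, 'q, 'l) functr" where
  "cmp_functr G F = \<lparr>Fob = Fob G \<circ> Fob F, Fmo = Fmo G \<circ> Fmo F\<rparr>"

locale cat_functor = dom: category C + cod: category D
  for C :: "('o, 'm) cat" and D :: "('p, 'n) cat" +
  fixes F :: "('o, 'm, 'p, 'n) functr"
  assumes functor_ob: "a \<in> Obj C \<Longrightarrow> Fob F a \<in> Obj D"
    and functor_hom: "f \<in> hom C a b \<Longrightarrow> Fmo F f \<in> hom D (Fob F a) (Fob F b)"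
    and functor_id: "a \<in> Obj C \<Longrightarrow> Fmo F (Idm C a) = Idm D (Fob F a)"
    and functor_cmp: "f \<in> hom C a b \<Longrightarrow> g \<in> hom C b c \<Longrightarrow>
      Fmo F (Cmp C g f) = Cmp D (Fmo F g) (Fmo F f)"

locale nat_transf = source: cat_functor C D F + target: cat_functor C D G
  for C :: "('o, 'm) cat" and D :: "('p, 'n) cat"
    and F :: "('o, 'm, 'p, 'n) functr" and G :: "('o, 'm, 'p, 'n) functr" +
  fixes \<tau> :: "'o \<Rightarrow> 'n"
  assumes component_hom: "a \<in> Obj C \<Longrightarrow> \<tau> a \<in> hom D (Fob F a) (Fob G a)"
    and naturality: "f \<in> hom C a b \<Longrightarrow> Cmp D (\<tau> b) (Fmo F f) = Cmp D (Fmo G f) (\<tau> a)"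

locale monad = unit: nat_transf C C id_functr R \<eta> + mult: nat_transf C C "cmp_functr R R" R \<mu>
  for C :: "('o, 'm) cat" and R :: "('o, 'm, 'o, 'm) functr"
    and \<eta> :: "'o \<Rightarrow> 'm" and \<mu> :: "'o \<Rightarrow> 'm" +
  assumes monad_unit_left: "a \<in> Obj C \<Longrightarrow> Cmp C (\<mu> a) (\<eta> (Fob R a)) = Idm C (Fob R a)"
    and monad_unit_right: "a \<in> Obj C \<Longrightarrow> Cmp C (\<mu> a) (Fmo R (\<eta> a)) = Idm C (Fob R a)"
    and monad_assoc: "a \<in> Obj C \<Longrightarrow>
      Cmp C (\<mu> a) (\<mu> (Fob R a)) = Cmp C (\<mu> a) (Fmo R (\<mu> a))"

locale comonad = counit: nat_transf C C L id_functr \<epsilon> + comult: nat_transf C C L "cmp_functr L L" \<delta>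
  for C :: "('o, 'm) cat" and L :: "('o, 'm, 'o, 'm) functr"
    and \<epsilon> :: "'o \<Rightarrow> 'm" and \<delta> :: "'o \<Rightarrow> 'm" +
  assumes comonad_counit_left: "a \<in> Obj C \<Longrightarrow> Cmp C (\<epsilon> (Fob L a)) (\<delta> a) = Idm C (Fob L a)"
    and comonad_counit_right: "a \<in> Obj C \<Longrightarrow> Cmp C (Fmo L (\<epsilon> a)) (\<delta> a) = Idm C (Fob L a)"
    and comonad_coassoc: "a \<in> Obj C \<Longrightarrow>
      Cmp C (\<delta> (Fob L a)) (\<delta> a) = Cmp C (Fmo L (\<delta> a)) (\<delta> a)"

locale distributive_law =
  comonad C L \<epsilon> \<delta> + monad C R \<eta> \<mu> + law: nat_transf C C "cmp_functr L R" "cmp_functr R L" \<Delta>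
  for C :: "('o, 'm) cat"
    and L :: "('o, 'm, 'o, 'm) functr" and \<epsilon> :: "'o \<Rightarrow> 'm" and \<delta> :: "'o \<Rightarrow> 'm"
    and R :: "('o, 'm, 'o, 'm) functr" and \<eta> :: "'o \<Rightarrow> 'm" and \<mu> :: "'o \<Rightarrow> 'm"
    and \<Delta> :: "'o \<Rightarrow> 'm" +
  assumes law_unit: "a \<in> Obj C \<Longrightarrow> Cmp C (\<Delta> a) (Fmo L (\<eta> a)) = \<eta> (Fob L a)"
    and law_counit: "a \<in> Obj C \<Longrightarrow> Cmp C (Fmo R (\<epsilon> a)) (\<Delta> a) = \<epsilon> (Fob R a)"
    and law_mult: "a \<in> Obj C \<Longrightarrow>
      Cmp C (\<Delta> a) (Fmo L (\<mu> a)) = Cmp C (\<mu> (Fob L a)) (Cmp C (Fmo R (\<Delta> a)) (\<Delta> (Fob R a)))"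
    and law_comult: "a \<in> Obj C \<Longrightarrow>
      Cmp C (Fmo R (\<delta> a)) (\<Delta> a) = Cmp C (\<Delta> (Fob L a)) (Cmp C (Fmo L (\<Delta> a)) (\<delta> (Fob R a)))"


section \<open>Arrow categories and algebraic weak factorisation systems\<close>

text \<open>\<open>Sq f a b g\<close> is the commutative square \<open>(a, b) : f \<rightarrow> g\<close>, that is \<open>g \<circ> a = b \<circ> f\<close>.\<close>

datatype 'm square = Sq (sq_src: 'm) (sq_top: 'm) (sq_bot: 'm) (sq_tgt: 'm)

definition arrow_cat :: "('o, 'm) cat \<Rightarrow> ('m, 'm square) cat" where
  "arrow_cat C = \<lparr>
     Obj = Mor C,
     Mor = {Sq f a b g | f a b g. f \<in> Mor C \<and> g \<in> Mor C \<and>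
       a \<in> hom C (Dom C f) (Dom C g) \<and> b \<in> hom C (Cod C f) (Cod C g) \<and> Cmp C g a = Cmp C b f},
     Dom = sq_src,
     Cod = sq_tgt,
     Idm = (\<lambda>f. Sq f (Idm C (Dom C f)) (Idm C (Cod C f)) f),
     Cmp = (\<lambda>\<tau> \<sigma>. Sq (sq_src \<sigma>) (Cmp C (sq_top \<tau>) (sq_top \<sigma>)) (Cmp C (sq_bot \<tau>) (sq_bot \<sigma>)) (sq_tgt \<tau>))\<rparr>"

text \<open>The component at \<open>f\<close> of the transformation \<open>LR \<rightarrow> RL\<close>: the square \<open>(\<delta>\<^sub>f, \<mu>\<^sub>f)\<close> from \<open>LRf\<close> to
  \<open>RLf\<close>, where \<open>\<delta>\<^sub>f\<close> is the codomain part of the comultiplication of \<open>L\<close> and \<open>\<mu>\<^sub>f\<close> the domain part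
  of the multiplication of \<open>R\<close>.\<close>

definition awfs_law ::
  "('m, 'm square, 'm, 'm square) functr \<Rightarrow> ('m \<Rightarrow> 'm square) \<Rightarrow>
   ('m, 'm square, 'm, 'm square) functr \<Rightarrow> ('m \<Rightarrow> 'm square) \<Rightarrow> 'm \<Rightarrow> 'm square" where
  "awfs_law L \<delta> R \<mu> f = Sq (Fob L (Fob R f)) (sq_bot (\<delta> f)) (sq_top (\<mu> f)) (Fob R (Fob L f))"

locale awfs =
  category C + distributive_law "arrow_cat C" L \<epsilon> \<delta> R \<eta> \<mu> "awfs_law L \<delta> R \<mu>"
  for C :: "('o, 'm) cat"
    and L :: "('m, 'm square, 'm, 'm square) functr"
    and \<epsilon> :: "'m \<Rightarrow> 'm square" and \<delta> :: "'m \<Rightarrow> 'm square"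
    and R :: "('m, 'm square, 'm, 'm square) functr"
    and \<eta> :: "'m \<Rightarrow> 'm square" and \<mu> :: "'m \<Rightarrow> 'm square" +
  assumes factor_ends: "f \<in> Mor C \<Longrightarrow> Dom C (Fob L f) = Dom C f \<and> Cod C (Fob R f) = Cod C f"
    and factor_middle: "f \<in> Mor C \<Longrightarrow> Cod C (Fob L f) = Dom C (Fob R f)"
    and factor_middle_functorial: "\<sigma> \<in> Mor (arrow_cat C) \<Longrightarrow> sq_bot (Fmo L \<sigma>) = sq_top (Fmo R \<sigma>)"
    and factorisation: "f \<in> Mor C \<Longrightarrow> Cmp C (Fob R f) (Fob L f) = f"
    and counit_form: "f \<in> Mor C \<Longrightarrow> \<epsilon> f = Sq (Fob L f) (Idm C (Dom C f)) (Fob R f) f"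
    and unit_form: "f \<in> Mor C \<Longrightarrow> \<eta> f = Sq f (Fob L f) (Idm C (Cod C f)) (Fob R f)"


section \<open>Right adjoints given by universal arrows\<close>

text \<open>Here \<open>U : C \<rightarrow> D\<close>, the function \<open>K\<close> is the object part of a right adjoint and \<open>\<epsilon>\<close> its counit.
  A morphism \<open>g : U c \<rightarrow> d\<close> corresponds to the unique \<open>h : c \<rightarrow> K d\<close> with \<open>\<epsilon> d \<circ> U h = g\<close>.\<close>

definition transpose ::
  "('o, 'm) cat \<Rightarrow> ('p, 'n) cat \<Rightarrow> ('o, 'm, 'p, 'n) functr \<Rightarrow> ('p \<Rightarrow> 'o) \<Rightarrow> ('p \<Rightarrow> 'n) \<Rightarrow>
   'o \<Rightarrow> 'p \<Rightarrow> 'n \<Rightarrow> 'm" where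
  "transpose C D U K \<epsilon> c d g = (THE h. h \<in> hom C c (K d) \<and> Cmp D (\<epsilon> d) (Fmo U h) = g)"

definition right_adjoint ::
  "('o, 'm) cat \<Rightarrow> ('p, 'n) cat \<Rightarrow> ('o, 'm, 'p, 'n) functr \<Rightarrow> ('p \<Rightarrow> 'o) \<Rightarrow> ('p \<Rightarrow> 'n) \<Rightarrow>
   ('p, 'n, 'o, 'm) functr" where
  "right_adjoint C D U K \<epsilon> = \<lparr>
     Fob = K,
     Fmo = (\<lambda>\<sigma>. transpose C D U K \<epsilon> (K (Dom D \<sigma>)) (Cod D \<sigma>) (Cmp D \<sigma> (\<epsilon> (Dom D \<sigma>))))\<rparr>"

text \<open>The comultiplication \<open>U \<eta> K\<close> of the induced comonad; the unit \<open>\<eta>\<close> of the adjunction at \<open>c\<close>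
  corresponds to the identity of \<open>U c\<close>.\<close>

definition adjunction_comult ::
  "('o, 'm) cat \<Rightarrow> ('p, 'n) cat \<Rightarrow> ('o, 'm, 'p, 'n) functr \<Rightarrow> ('p \<Rightarrow> 'o) \<Rightarrow> ('p \<Rightarrow> 'n) \<Rightarrow> 'p \<Rightarrow> 'n" where
  "adjunction_comult C D U K \<epsilon> d =
     Fmo U (transpose C D U K \<epsilon> (K d) (Fob U (K d)) (Idm D (Fob U (K d))))"

definition is_seq_colimit ::
  "('o, 'm) cat \<Rightarrow> (nat \<Rightarrow> 'o) \<Rightarrow> (nat \<Rightarrow> 'm) \<Rightarrow> 'o \<Rightarrow> (nat \<Rightarrow> 'm) \<Rightarrow> bool" where
  "is_seq_colimit C F c Q \<iota> \<longleftrightarrow>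
     Q \<in> Obj C \<and> (\<forall>k. \<iota> k \<in> hom C (F k) Q \<and> Cmp C (\<iota> (Suc k)) (c k) = \<iota> k) \<and>
     (\<forall>Q' \<kappa>. Q' \<in> Obj C \<and> (\<forall>k. \<kappa> k \<in> hom C (F k) Q' \<and> Cmp C (\<kappa> (Suc k)) (c k) = \<kappa> k) \<longrightarrow>
       (\<exists>!h. h \<in> hom C Q Q' \<and> (\<forall>k. Cmp C h (\<iota> k) = \<kappa> k)))"


section \<open>Universes of points\<close>

text \<open>HOL has no type of all topological spaces. Spaces are topologies on subsets of a type \<open>'u\<close>
  which, like the points available in a Grothendieck universe, is closed under the operations used
  to build cell complexes: the points of a body are coded by \<open>Old_pt\<close>, \<open>Cell_pt\<close> and \<open>Stage_pt\<close>,
  and the cells of \<open>K f\<close> and of a composite by \<open>Square_cell\<close>, \<open>Inl_cell\<close> and \<open>Inr_cell\<close>.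
  The discs live in \<open>Euclidean_space n\<close>, whose points have type \<open>nat \<Rightarrow> real\<close>.\<close>

datatype 'a code =
    Old_pt 'a
  | Cell_pt 'a "nat \<Rightarrow> real"
  | Stage_pt nat 'a
  | Square_cell nat "(nat \<Rightarrow> real) \<Rightarrow> 'a" "(nat \<Rightarrow> real) \<Rightarrow> 'a"
  | Inl_cell 'a
  | Inr_cell 'a

class universe =
  fixes enc :: "'a code \<Rightarrow> 'a"
  assumes inj_enc: "inj enc"

text \<open>Every type embeds in a universe, by \<open>Atom\<close>.\<close>

datatype 'a univ = Atom 'a | Enc "'a univ code"

instantiation univ :: (type) universe
begin

definition enc_univ :: "'a univ code \<Rightarrow> 'a univ" where
  "enc_univ = Enc"

instance
  by standard (simp add: enc_univ_def inj_def)

end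

definition dec :: "'u::universe \<Rightarrow> 'u code" where
  "dec = inv enc"

lemma dec_enc [simp]: "dec (enc c) = c"
  by (simp add: dec_def inj_enc)

lemma enc_eq_iff [simp]: "enc c = enc c' \<longleftrightarrow> c = c'"
  using inj_enc by (auto dest: injD)


section \<open>The category of topological spaces\<close>

datatype 'u cmap = Cmap (cdom: "'u topology") (cfun: "'u \<Rightarrow> 'u") (ccod: "'u topology")

definition TOP :: "('u topology, 'u cmap) cat" where
  "TOP = \<lparr>
     Obj = UNIV,
     Mor = {Cmap X f Y | X f Y. continuous_map X Y f \<and> f \<in> extensional (topspace X)},
     Dom = cdom,
     Cod = ccod,
     Idm = (\<lambda>X. Cmap X (\<lambda>x\<in>topspace X. x) X),
     Cmp = (\<lambda>g f. Cmap (cdom f) (compose (topspace (cdom f)) (cfun g) (cfun f)) (ccod g))\<rparr>"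

abbreviation TOP2 :: "('u cmap, 'u cmap square) cat" where
  "TOP2 \<equiv> arrow_cat TOP"


section \<open>Strata\<close>

definition disc :: "nat \<Rightarrow> (nat \<Rightarrow> real) topology" where
  "disc n = subtopology (Euclidean_space n) {x. (\<Sum>i<n. (x i)\<^sup>2) \<le> 1}"

text \<open>\<open>bsphere n\<close> is the boundary sphere of \<open>disc n\<close>, of dimension \<open>n - 1\<close>. As \<open>disc 0\<close> is a
  point, at which the sum is \<open>0\<close>, \<open>bsphere 0\<close> is empty. The inclusions \<open>bsphere n \<rightarrow> disc n\<close> are
  represented by the numbers \<open>n\<close>.\<close>

definition bsphere :: "nat \<Rightarrow> (nat \<Rightarrow> real) topology" where
  "bsphere n = subtopology (Euclidean_space n) {x. (\<Sum>i<n. (x i)\<^sup>2) = 1}"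

lemma bsphere_0: "topspace (bsphere 0) = {}"
  by (simp add: bsphere_def)

lemma bsphere_Suc: "bsphere (Suc n) = nsphere n"
  by (simp add: bsphere_def nsphere_def lessThan_Suc_atMost)

lemma bsphere_subset_disc: "topspace (bsphere n) \<subseteq> topspace (disc n)"
  by (auto simp: bsphere_def disc_def)

record 'u stratum =
  sbd :: "'u topology"
  cells :: "'u set"
  cdim :: "'u \<Rightarrow> nat"
  att :: "'u \<Rightarrow> (nat \<Rightarrow> real) \<Rightarrow> 'u"

text \<open>The functions involved are extensional so that equality of strata and of morphisms is the
  intended one.\<close>

definition is_stratum :: "'u stratum \<Rightarrow> bool" where
  "is_stratum \<sigma> \<longleftrightarrow> cdim \<sigma> \<in> extensional (cells \<sigma>) \<and> att \<sigma> \<in> extensional (cells \<sigma>) \<and>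
     (\<forall>s \<in> cells \<sigma>. continuous_map (bsphere (cdim \<sigma> s)) (sbd \<sigma>) (att \<sigma> s) \<and>
       att \<sigma> s \<in> extensional (topspace (bsphere (cdim \<sigma> s))))"

definition old :: "'u::universe \<Rightarrow> 'u" where
  "old x = enc (Old_pt x)"

definition char_map :: "'u::universe stratum \<Rightarrow> 'u \<Rightarrow> (nat \<Rightarrow> real) \<Rightarrow> 'u" where
  "char_map \<sigma> s d = (if d \<in> topspace (bsphere (cdim \<sigma> s)) then old (att \<sigma> s d) else enc (Cell_pt s d))"

definition body_points :: "'u::universe stratum \<Rightarrow> 'u set" where
  "body_points \<sigma> = old ` topspace (sbd \<sigma>) \<union>
     {enc (Cell_pt s d) | s d. s \<in> cells \<sigma> \<and> d \<in> topspace (disc (cdim \<sigma> s)) - topspace (bsphere (cdim \<sigma> s))}"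

text \<open>The pushout, with the final topology for \<open>old\<close> and the characteristic maps; its universal
  property is \<open>body_pushout\<close> below.\<close>

definition body_open :: "'u::universe stratum \<Rightarrow> 'u set \<Rightarrow> bool" where
  "body_open \<sigma> V \<longleftrightarrow> V \<subseteq> body_points \<sigma> \<and> openin (sbd \<sigma>) {x \<in> topspace (sbd \<sigma>). old x \<in> V} \<and>
     (\<forall>s \<in> cells \<sigma>. openin (disc (cdim \<sigma> s)) {d \<in> topspace (disc (cdim \<sigma> s)). char_map \<sigma> s d \<in> V})"

definition body :: "'u::universe stratum \<Rightarrow> 'u topology" where
  "body \<sigma> = topology (body_open \<sigma>)"

lemma istopology_body_open: "istopology (body_open \<sigma>)"
proof -
  have i: "{x \<in> A. f x \<in> S \<inter> T} = {x \<in> A. f x \<in> S} \<inter> {x \<in> A. f x \<in> T}" for A :: "'b set" and f and S T :: "'a set"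
    by auto
  have u: "{x \<in> A. f x \<in> \<Union>F} = (\<Union>S\<in>F. {x \<in> A. f x \<in> S})" for A :: "'b set" and f and F :: "'a set set"
    by auto
  show ?thesis
    unfolding istopology_def body_open_def i u by (intro conjI allI impI ballI) (auto intro!: openin_Union)
qed

lemma openin_body: "openin (body \<sigma>) = body_open \<sigma>"
  by (simp add: body_def istopology_body_open)

lemma char_map_in_body_points:
  assumes "is_stratum \<sigma>" "s \<in> cells \<sigma>" "d \<in> topspace (disc (cdim \<sigma> s))"
  shows "char_map \<sigma> s d \<in> body_points \<sigma>"
  using assms by (auto simp: body_points_def char_map_def is_stratum_def continuous_map_def)

lemma topspace_body:
  assumes "is_stratum \<sigma>"
  shows "topspace (body \<sigma>) = body_points \<sigma>"
proof -
  have "old x \<in> body_points \<sigma>" if "x \<in> topspace (sbd \<sigma>)" for x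
    using that by (simp add: body_points_def)
  moreover have "char_map \<sigma> s d \<in> body_points \<sigma>" if "s \<in> cells \<sigma>" "d \<in> topspace (disc (cdim \<sigma> s))" for s d
    using char_map_in_body_points[OF assms that] .
  ultimately have "body_open \<sigma> (body_points \<sigma>)"
    unfolding body_open_def by (simp cong: conj_cong)
  moreover have "V \<subseteq> body_points \<sigma>" if "body_open \<sigma> V" for V
    using that by (simp add: body_open_def)
  ultimately show ?thesis
    unfolding topspace_def[of "body \<sigma>"] openin_body by blast
qed

text \<open>The map out of a body induced by \<open>g\<close> on the boundary and \<open>h s\<close> on the cell \<open>s\<close>.\<close>

definition body_induced :: "('u::universe \<Rightarrow> 'z) \<Rightarrow> ('u \<Rightarrow> (nat \<Rightarrow> real) \<Rightarrow> 'z) \<Rightarrow> 'u \<Rightarrow> 'z" where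
  "body_induced g h z = (case dec z of Old_pt x \<Rightarrow> g x | Cell_pt s d \<Rightarrow> h s d)"

lemma body_pushout:
  fixes Z :: "'z topology"
  assumes "is_stratum \<sigma>"
  shows "continuous_map (sbd \<sigma>) (body \<sigma>) old"
    and "s \<in> cells \<sigma> \<Longrightarrow> continuous_map (disc (cdim \<sigma> s)) (body \<sigma>) (char_map \<sigma> s)"
    and "x \<in> topspace (bsphere (cdim \<sigma> s)) \<Longrightarrow> char_map \<sigma> s x = old (att \<sigma> s x)"
    and "\<lbrakk>continuous_map (sbd \<sigma>) Z g; \<And>s. s \<in> cells \<sigma> \<Longrightarrow> continuous_map (disc (cdim \<sigma> s)) Z (h s);
          \<And>s x. s \<in> cells \<sigma> \<Longrightarrow> x \<in> topspace (bsphere (cdim \<sigma> s)) \<Longrightarrow> g (att \<sigma> s x) = h s x\<rbrakk> \<Longrightarrow>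
        continuous_map (body \<sigma>) Z (body_induced g h) \<and>
        (\<forall>x. body_induced g h (old x) = g x) \<and>
        (\<forall>s \<in> cells \<sigma>. \<forall>d. body_induced g h (char_map \<sigma> s d) = h s d)"
    and "\<lbrakk>\<And>x. x \<in> topspace (sbd \<sigma>) \<Longrightarrow> k (old x) = l (old x);
          \<And>s d. s \<in> cells \<sigma> \<Longrightarrow> d \<in> topspace (disc (cdim \<sigma> s)) \<Longrightarrow> k (char_map \<sigma> s d) = l (char_map \<sigma> s d);
          z \<in> topspace (body \<sigma>)\<rbrakk> \<Longrightarrow> k z = l z"
proof -
  show old: "continuous_map (sbd \<sigma>) (body \<sigma>) old"
    by (auto simp: continuous_map_def topspace_body[OF assms] openin_body body_open_def body_points_def)
  show char: "continuous_map (disc (cdim \<sigma> s)) (body \<sigma>) (char_map \<sigma> s)" if "s \<in> cells \<sigma>" for s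
    unfolding continuous_map_def topspace_body[OF assms] openin_body
    using that char_map_in_body_points[OF assms] by (simp add: body_open_def)
  show "char_map \<sigma> s x = old (att \<sigma> s x)" if "x \<in> topspace (bsphere (cdim \<sigma> s))"
    using that by (simp add: char_map_def)
  show "continuous_map (body \<sigma>) Z (body_induced g h) \<and>
        (\<forall>x. body_induced g h (old x) = g x) \<and>
        (\<forall>s \<in> cells \<sigma>. \<forall>d. body_induced g h (char_map \<sigma> s d) = h s d)"
    if g: "continuous_map (sbd \<sigma>) Z g"
      and h: "\<And>s. s \<in> cells \<sigma> \<Longrightarrow> continuous_map (disc (cdim \<sigma> s)) Z (h s)"
      and gh: "\<And>s x. s \<in> cells \<sigma> \<Longrightarrow> x \<in> topspace (bsphere (cdim \<sigma> s)) \<Longrightarrow> g (att \<sigma> s x) = h s x"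
  proof (intro conjI allI ballI)
    show o: "body_induced g h (old x) = g x" for x
      by (simp add: body_induced_def old_def)
    show c: "body_induced g h (char_map \<sigma> s d) = h s d" if "s \<in> cells \<sigma>" for s d
      using gh[OF that] by (simp add: char_map_def o) (simp add: body_induced_def)
    have im: "body_induced g h z \<in> topspace Z" if z: "z \<in> body_points \<sigma>" for z
    proof -
      consider x where "x \<in> topspace (sbd \<sigma>)" "z = old x"
        | s d where "s \<in> cells \<sigma>" "d \<in> topspace (disc (cdim \<sigma> s))" "z = enc (Cell_pt s d)"
        using z by (auto simp: body_points_def)
      then show ?thesis
      proof cases
        case 1
        then show ?thesis
          using continuous_map_funspace[OF g] by (auto simp: o)
      next
        case 2
        then show ?thesis
          using continuous_map_funspace[OF h[of s]] by (auto simp: body_induced_def)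
      qed
    qed
    have "body_open \<sigma> {z \<in> body_points \<sigma>. body_induced g h z \<in> V}" if V: "openin Z V" for V
    proof -
      have 1: "{x \<in> topspace (sbd \<sigma>). old x \<in> {z \<in> body_points \<sigma>. body_induced g h z \<in> V}} =
          {x \<in> topspace (sbd \<sigma>). g x \<in> V}"
        by (auto simp: o body_points_def)
      have 2: "{d \<in> topspace (disc (cdim \<sigma> s)). char_map \<sigma> s d \<in> {z \<in> body_points \<sigma>. body_induced g h z \<in> V}} =
          {d \<in> topspace (disc (cdim \<sigma> s)). h s d \<in> V}" if "s \<in> cells \<sigma>" for s
        using c[OF that] continuous_map_funspace[OF char[OF that]] by (auto simp: topspace_body[OF assms])
      show ?thesis
        unfolding body_open_def 1 using V g h by (auto simp: 2 continuous_map_def simp del: mem_Collect_eq)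
    qed
    with im show "continuous_map (body \<sigma>) Z (body_induced g h)"
      by (auto simp: continuous_map_def topspace_body[OF assms] openin_body)
  qed
  show "k z = l z"
    if 1: "\<And>x. x \<in> topspace (sbd \<sigma>) \<Longrightarrow> k (old x) = l (old x)"
      and 2: "\<And>s d. s \<in> cells \<sigma> \<Longrightarrow> d \<in> topspace (disc (cdim \<sigma> s)) \<Longrightarrow> k (char_map \<sigma> s d) = l (char_map \<sigma> s d)"
      and 3: "z \<in> topspace (body \<sigma>)"
  proof -
    consider x where "x \<in> topspace (sbd \<sigma>)" "z = old x"
      | s d where "s \<in> cells \<sigma>" "d \<in> topspace (disc (cdim \<sigma> s))" "z = char_map \<sigma> s d"
      using 3 by (fastforce simp: topspace_body[OF assms] body_points_def char_map_def)
    then show ?thesis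
      using 1 2 by cases auto
  qed
qed

definition stratum_mor ::
  "'u stratum \<Rightarrow> 'u stratum \<Rightarrow> ('u \<Rightarrow> 'u) \<Rightarrow> ('u \<Rightarrow> 'u) \<Rightarrow> bool" where
  "stratum_mor \<sigma> \<tau> f p \<longleftrightarrow>
     continuous_map (sbd \<sigma>) (sbd \<tau>) f \<and> f \<in> extensional (topspace (sbd \<sigma>)) \<and>
     p \<in> cells \<sigma> \<rightarrow>\<^sub>E cells \<tau> \<and>
     (\<forall>s \<in> cells \<sigma>. cdim \<tau> (p s) = cdim \<sigma> s \<and>
       (\<forall>x \<in> topspace (bsphere (cdim \<sigma> s)). f (att \<sigma> s x) = att \<tau> (p s) x))"

definition body_map :: "'u::universe stratum \<Rightarrow> ('u \<Rightarrow> 'u) \<Rightarrow> ('u \<Rightarrow> 'u) \<Rightarrow> 'u \<Rightarrow> 'u" where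
  "body_map \<sigma> f p =
     restrict (body_induced (old \<circ> f) (\<lambda>s d. enc (Cell_pt (p s) d))) (topspace (body \<sigma>))"

text \<open>\<open>b : bsphere n \<rightarrow> Y\<close> factors through \<open>i : X \<rightarrow> Y\<close>.\<close>

definition factors_through ::
  "('u \<Rightarrow> 'u) \<Rightarrow> 'u topology \<Rightarrow> nat \<Rightarrow> ((nat \<Rightarrow> real) \<Rightarrow> 'u) \<Rightarrow> bool" where
  "factors_through i X n b \<longleftrightarrow>
     (\<exists>c. continuous_map (bsphere n) X c \<and> (\<forall>x \<in> topspace (bsphere n). b x = i (c x)))"


section \<open>Relative cell complexes\<close>

type_synonym 'u cellcx = "nat \<Rightarrow> 'u stratum"

text \<open>The map \<open>X\<^sub>m \<rightarrow> X\<^sub>n\<close> for \<open>m \<le> n\<close> is \<open>old ^^ (n - m)\<close>.\<close>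

definition is_cellcx :: "'u::universe cellcx \<Rightarrow> bool" where
  "is_cellcx A \<longleftrightarrow> (\<forall>n. is_stratum (A n)) \<and>
     (\<forall>n. sbd (A (Suc n)) = body (A n)) \<and>
     (\<forall>n. \<forall>s \<in> cells (A n). \<forall>m < n.
        \<not> factors_through (old ^^ (n - m)) (sbd (A m)) (cdim (A n) s) (att (A n) s))"

text \<open>In the colimit of \<open>X\<^sub>0 \<rightarrow> X\<^sub>1 \<rightarrow> \<dots>\<close>, a point is represented by \<open>Stage_pt n x\<close> where \<open>n\<close> is
  the first stage at which it occurs and \<open>x \<in> X\<^sub>n\<close>; \<open>stage_incl n : X\<^sub>n \<rightarrow> colim X\<close> is the coprojection. The
  colimit has the final topology for these; its universal property is \<open>cx_body_colimit\<close> below.\<close>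

primrec stage_incl :: "nat \<Rightarrow> 'u::universe \<Rightarrow> 'u" where
  "stage_incl 0 x = enc (Stage_pt 0 x)"
| "stage_incl (Suc n) x = (if x \<in> range old then stage_incl n (inv old x) else enc (Stage_pt (Suc n) x))"

definition cx_open :: "'u::universe cellcx \<Rightarrow> 'u set \<Rightarrow> bool" where
  "cx_open A V \<longleftrightarrow> V \<subseteq> (\<Union>n. stage_incl n ` topspace (sbd (A n))) \<and>
     (\<forall>n. openin (sbd (A n)) {x \<in> topspace (sbd (A n)). stage_incl n x \<in> V})"

definition cx_body :: "'u::universe cellcx \<Rightarrow> 'u topology" where
  "cx_body A = topology (cx_open A)"

definition cx_induced :: "(nat \<Rightarrow> 'u::universe \<Rightarrow> 'z) \<Rightarrow> 'u \<Rightarrow> 'z" where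
  "cx_induced g z = (case dec z of Stage_pt n x \<Rightarrow> g n x)"

lemma istopology_cx_open: "istopology (cx_open A)"
proof -
  have i: "{x \<in> X. f x \<in> S \<inter> T} = {x \<in> X. f x \<in> S} \<inter> {x \<in> X. f x \<in> T}" for X :: "'b set" and f and S T :: "'a set"
    by auto
  have u: "{x \<in> X. f x \<in> \<Union>F} = (\<Union>S\<in>F. {x \<in> X. f x \<in> S})" for X :: "'b set" and f and F :: "'a set set"
    by auto
  show ?thesis
    unfolding istopology_def cx_open_def i u
    by (intro conjI allI impI ballI) (auto intro!: openin_Union)
qed

lemma openin_cx_body: "openin (cx_body A) = cx_open A"
  by (simp add: cx_body_def istopology_cx_open)

lemma topspace_cx_body: "topspace (cx_body A) = (\<Union>n. stage_incl n ` topspace (sbd (A n)))"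
proof -
  have "{x \<in> topspace (sbd (A n)). stage_incl n x \<in> (\<Union>n. stage_incl n ` topspace (sbd (A n)))} =
      topspace (sbd (A n))" for n
    by auto
  then have "cx_open A (\<Union>n. stage_incl n ` topspace (sbd (A n)))"
    unfolding cx_open_def by simp
  moreover have "V \<subseteq> (\<Union>n. stage_incl n ` topspace (sbd (A n)))" if "cx_open A V" for V
    using that by (simp add: cx_open_def)
  ultimately show ?thesis
    unfolding topspace_def[of "cx_body A"] openin_cx_body by blast
qed

lemma stage_incl_old:
  fixes x :: "'u::universe"
  shows "stage_incl (Suc n) (old x) = stage_incl n x"
proof -
  have "inj (old :: 'u \<Rightarrow> 'u)"
    by (simp add: inj_def old_def)
  then show ?thesis
    by (simp add: inv_f_f)
qed

lemma cx_body_colimit: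
  fixes Z :: "'z topology"
  assumes A: "is_cellcx A"
  shows "continuous_map (sbd (A n)) (cx_body A) (stage_incl n)"
    and "stage_incl (Suc n) (old x) = stage_incl n x"
    and "\<lbrakk>\<And>n. continuous_map (sbd (A n)) Z (g n);
          \<And>n x. x \<in> topspace (sbd (A n)) \<Longrightarrow> g (Suc n) (old x) = g n x\<rbrakk> \<Longrightarrow>
        continuous_map (cx_body A) Z (cx_induced g) \<and>
        (\<forall>n. \<forall>x \<in> topspace (sbd (A n)). cx_induced g (stage_incl n x) = g n x)"
    and "\<lbrakk>\<And>n x. x \<in> topspace (sbd (A n)) \<Longrightarrow> k (stage_incl n x) = l (stage_incl n x);
          z \<in> topspace (cx_body A)\<rbrakk> \<Longrightarrow> k z = l z"
proof -
  show "continuous_map (sbd (A n)) (cx_body A) (stage_incl n)"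
    by (auto simp: continuous_map_def topspace_cx_body openin_cx_body cx_open_def)
  show "stage_incl (Suc n) (old x) = stage_incl n x"
    by (rule stage_incl_old)
  show "continuous_map (cx_body A) Z (cx_induced g) \<and>
        (\<forall>n. \<forall>x \<in> topspace (sbd (A n)). cx_induced g (stage_incl n x) = g n x)"
    if g: "\<And>n. continuous_map (sbd (A n)) Z (g n)"
      and gg: "\<And>n x. x \<in> topspace (sbd (A n)) \<Longrightarrow> g (Suc n) (old x) = g n x"
  proof
    have c: "cx_induced g (stage_incl n x) = g n x" if "x \<in> topspace (sbd (A n))" for n x
      using that
    proof (induction n arbitrary: x)
      case 0
      then show ?case
        by (simp add: cx_induced_def)
    next
      case (Suc n)
      show ?case
      proof (cases "x \<in> range old")
        case True
        then obtain y where y: "x = old y"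
          by auto
        have "is_stratum (A n)" "sbd (A (Suc n)) = body (A n)"
          using A by (auto simp: is_cellcx_def)
        with Suc.prems y have "y \<in> topspace (sbd (A n))"
          by (auto simp: topspace_body body_points_def old_def)
        then show ?thesis
          using Suc.IH gg y stage_incl_old by metis
      next
        case False
        then show ?thesis
          by (simp add: cx_induced_def)
      qed
    qed
    then show "\<forall>n. \<forall>x \<in> topspace (sbd (A n)). cx_induced g (stage_incl n x) = g n x"
      by blast
    have "cx_open A {z \<in> topspace (cx_body A). cx_induced g z \<in> V}" if V: "openin Z V" for V
    proof -
      have "{x \<in> topspace (sbd (A n)). stage_incl n x \<in> {z \<in> topspace (cx_body A). cx_induced g z \<in> V}} =
          {x \<in> topspace (sbd (A n)). g n x \<in> V}" for n
        by (rule Collect_cong, unfold topspace_cx_body) (use c[of _ n] in fastforce)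
      then show ?thesis
        unfolding cx_open_def using V g by (auto simp: continuous_map_def topspace_cx_body simp del: mem_Collect_eq)
    qed
    moreover have "cx_induced g z \<in> topspace Z" if "z \<in> topspace (cx_body A)" for z
      using that c continuous_map_funspace[OF g] by (fastforce simp: topspace_cx_body)
    ultimately show "continuous_map (cx_body A) Z (cx_induced g)"
      by (auto simp: continuous_map_def openin_cx_body)
  qed
  show "k z = l z"
    if "\<And>n x. x \<in> topspace (sbd (A n)) \<Longrightarrow> k (stage_incl n x) = l (stage_incl n x)"
      "z \<in> topspace (cx_body A)"
    using that by (auto simp: topspace_cx_body)
qed

text \<open>A morphism consists of its source, the maps \<open>f\<^sub>n\<close> of boundaries, the maps \<open>p\<^sub>n\<close> of cells, and
  its target.\<close>

datatype 'u cellmor =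
  Cellmor (cm_src: "'u cellcx") (cm_map: "nat \<Rightarrow> 'u \<Rightarrow> 'u") (cm_cells: "nat \<Rightarrow> 'u \<Rightarrow> 'u") (cm_tgt: "'u cellcx")

definition is_cellmor :: "'u::universe cellmor \<Rightarrow> bool" where
  "is_cellmor \<phi> \<longleftrightarrow> is_cellcx (cm_src \<phi>) \<and> is_cellcx (cm_tgt \<phi>) \<and>
     (\<forall>n. stratum_mor (cm_src \<phi> n) (cm_tgt \<phi> n) (cm_map \<phi> n) (cm_cells \<phi> n)) \<and>
     (\<forall>n. cm_map \<phi> (Suc n) = body_map (cm_src \<phi> n) (cm_map \<phi> n) (cm_cells \<phi> n))"

definition CELLCX :: "('u::universe cellcx, 'u cellmor) cat" where
  "CELLCX = \<lparr>
     Obj = Collect is_cellcx,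
     Mor = Collect is_cellmor,
     Dom = cm_src,
     Cod = cm_tgt,
     Idm = (\<lambda>A. Cellmor A (\<lambda>n. \<lambda>x\<in>topspace (sbd (A n)). x) (\<lambda>n. \<lambda>s\<in>cells (A n). s) A),
     Cmp = (\<lambda>\<psi> \<phi>. Cellmor (cm_src \<phi>)
       (\<lambda>n. compose (topspace (sbd (cm_src \<phi> n))) (cm_map \<psi> n) (cm_map \<phi> n))
       (\<lambda>n. compose (cells (cm_src \<phi> n)) (cm_cells \<psi> n) (cm_cells \<phi> n))
       (cm_tgt \<psi>))\<rparr>"

definition cx_map :: "'u::universe cellmor \<Rightarrow> 'u \<Rightarrow> 'u" where
  "cx_map \<phi> =
     restrict (cx_induced (\<lambda>n x. stage_incl n (cm_map \<phi> n x))) (topspace (cx_body (cm_src \<phi>)))"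

definition U_ob :: "'u::universe cellcx \<Rightarrow> 'u cmap" where
  "U_ob A = Cmap (sbd (A 0)) (restrict (stage_incl 0) (topspace (sbd (A 0)))) (cx_body A)"

definition U_functr :: "('u::universe cellcx, 'u cellmor, 'u cmap, 'u cmap square) functr" where
  "U_functr = \<lparr>
     Fob = U_ob,
     Fmo = (\<lambda>\<phi>. Sq (U_ob (cm_src \<phi>))
       (Cmap (sbd (cm_src \<phi> 0)) (cm_map \<phi> 0) (sbd (cm_tgt \<phi> 0)))
       (Cmap (cx_body (cm_src \<phi>)) (cx_map \<phi>) (cx_body (cm_tgt \<phi>)))
       (U_ob (cm_tgt \<phi>)))\<rparr>"


section \<open>Composition of cell complexes\<close>

text \<open>Throughout, \<open>\<tau>\<close> is a stratum with \<open>sbd \<tau> = cx_body A\<close>.\<close>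

definition level :: "'u::universe cellcx \<Rightarrow> 'u stratum \<Rightarrow> 'u \<Rightarrow> nat" where
  "level A \<tau> t = (LEAST n. factors_through (stage_incl n) (sbd (A n)) (cdim \<tau> t) (att \<tau> t))"

text \<open>The \<open>n\<close>-th stratum of \<open>\<tau> * A\<close>, given its boundary \<open>Z\<close> and the map \<open>j\<close> from the boundary of
  \<open>A n\<close> to \<open>Z\<close>. The attaching map of a new cell \<open>t\<close> is the factorisation of \<open>att \<tau> t\<close> through the
  (injective) \<open>stage_incl n\<close>, followed by \<open>j\<close>.\<close>

definition stack_stratum ::
  "'u::universe cellcx \<Rightarrow> 'u stratum \<Rightarrow> nat \<Rightarrow> 'u topology \<Rightarrow> ('u \<Rightarrow> 'u) \<Rightarrow> 'u stratum" where
  "stack_stratum A \<tau> n Z j =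
     (let S = (\<lambda>s. enc (Inl_cell s)) ` cells (A n) \<union>
              (\<lambda>t. enc (Inr_cell t)) ` {t \<in> cells \<tau>. level A \<tau> t = n}
      in \<lparr>sbd = Z,
          cells = S,
          cdim = (\<lambda>u\<in>S. case dec u of Inl_cell s \<Rightarrow> cdim (A n) s | Inr_cell t \<Rightarrow> cdim \<tau> t),
          att = (\<lambda>u\<in>S. case dec u of
              Inl_cell s \<Rightarrow> (\<lambda>x\<in>topspace (bsphere (cdim (A n) s)). j (att (A n) s x))
            | Inr_cell t \<Rightarrow> (\<lambda>x\<in>topspace (bsphere (cdim \<tau> t)).
                j (inv_into (topspace (sbd (A n))) (stage_incl n) (att \<tau> t x))))\<rparr>)"

primrec stack_rec :: "'u::universe cellcx \<Rightarrow> 'u stratum \<Rightarrow> nat \<Rightarrow> 'u stratum \<times> ('u \<Rightarrow> 'u)" where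
  "stack_rec A \<tau> 0 =
     (let j = (\<lambda>x\<in>topspace (sbd (A 0)). x) in (stack_stratum A \<tau> 0 (sbd (A 0)) j, j))"
| "stack_rec A \<tau> (Suc n) =
     (let (\<rho>, j) = stack_rec A \<tau> n;
          j' = body_map (A n) j (\<lambda>s. enc (Inl_cell s))
      in (stack_stratum A \<tau> (Suc n) (body \<rho>) j', j'))"

definition stack :: "'u::universe cellcx \<Rightarrow> 'u stratum \<Rightarrow> 'u cellcx" where
  "stack A \<tau> n = fst (stack_rec A \<tau> n)"

definition stack_incl :: "'u::universe cellcx \<Rightarrow> 'u stratum \<Rightarrow> 'u cellmor" where
  "stack_incl A \<tau> =
     Cellmor A (\<lambda>n. snd (stack_rec A \<tau> n)) (\<lambda>n. \<lambda>s\<in>cells (A n). enc (Inl_cell s)) (stack A \<tau>)"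

text \<open>The canonical identification of the body of \<open>\<tau>\<close> with the body of \<open>\<tau> * A\<close>.\<close>

definition stack_ident :: "'u::universe cellcx \<Rightarrow> 'u stratum \<Rightarrow> 'u \<Rightarrow> 'u" where
  "stack_ident A \<tau> = restrict
     (body_induced (cx_map (stack_incl A \<tau>))
        (\<lambda>t d. stage_incl (Suc (level A \<tau> t)) (enc (Cell_pt (enc (Inr_cell t)) d))))
     (topspace (body \<tau>))"

definition transport :: "('u \<Rightarrow> 'u) \<Rightarrow> 'u topology \<Rightarrow> 'u stratum \<Rightarrow> 'u stratum" where
  "transport \<theta> Y \<sigma> = \<sigma>\<lparr>sbd := Y,
     att := (\<lambda>s\<in>cells \<sigma>. \<lambda>x\<in>topspace (bsphere (cdim \<sigma> s)). \<theta> (att \<sigma> s x))\<rparr>"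

text \<open>For \<open>A\<close>, \<open>B\<close> with \<open>cx_body A = sbd (B 0)\<close>: the complex \<open>A\<^sub>k\<close> obtained from \<open>A\<close> by composing with
  the first \<open>k\<close> strata of \<open>B\<close>, and the canonical identification \<open>\<theta>\<^sub>k\<close> of the boundary of \<open>B k\<close> with the
  body of \<open>A\<^sub>k\<close>, along which the stratum \<open>B k\<close> is transported before it is composed with \<open>A\<^sub>k\<close>.\<close>

primrec comp_rec :: "'u::universe cellcx \<Rightarrow> 'u cellcx \<Rightarrow> nat \<Rightarrow> 'u cellcx \<times> ('u \<Rightarrow> 'u)" where
  "comp_rec B A 0 = (A, \<lambda>y\<in>topspace (sbd (B 0)). y)"
| "comp_rec B A (Suc k) =
     (let (A', \<theta>) = comp_rec B A k;
          \<tau> = transport \<theta> (cx_body A') (B k)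
      in (stack A' \<tau>, compose (topspace (body (B k))) (stack_ident A' \<tau>) (body_map (B k) \<theta> id)))"

definition comp_stage :: "'u::universe cellcx \<Rightarrow> 'u cellcx \<Rightarrow> nat \<Rightarrow> 'u cellcx" where
  "comp_stage B A k = fst (comp_rec B A k)"

definition comp_theta :: "'u::universe cellcx \<Rightarrow> 'u cellcx \<Rightarrow> nat \<Rightarrow> 'u \<Rightarrow> 'u" where
  "comp_theta B A k = snd (comp_rec B A k)"

definition comp_step :: "'u::universe cellcx \<Rightarrow> 'u cellcx \<Rightarrow> nat \<Rightarrow> 'u cellmor" where
  "comp_step B A k = stack_incl (comp_stage B A k)
     (transport (comp_theta B A k) (cx_body (comp_stage B A k)) (B k))"

text \<open>\<open>B * A\<close> is the colimit of the \<open>A\<^sub>k\<close>, chosen such that, like all \<open>A\<^sub>k\<close>, it has the boundary of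
  \<open>A\<close> and the coprojections are the identity there.\<close>

definition comp_cocone :: "'u::universe cellcx \<Rightarrow> 'u cellcx \<Rightarrow> 'u cellcx \<times> (nat \<Rightarrow> 'u cellmor)" where
  "comp_cocone B A = (SOME (Q, \<iota>).
     is_seq_colimit CELLCX (comp_stage B A) (comp_step B A) Q \<iota> \<and>
     sbd (Q 0) = sbd (A 0) \<and> (\<forall>k. cm_map (\<iota> k) 0 = (\<lambda>x\<in>topspace (sbd (A 0)). x)))"

definition cx_comp :: "'u::universe cellcx \<Rightarrow> 'u cellcx \<Rightarrow> 'u cellcx" where
  "cx_comp B A = fst (comp_cocone B A)"

text \<open>The canonical identification of the body of \<open>B\<close> with the body of \<open>B * A\<close>.\<close>

definition comp_ident :: "'u::universe cellcx \<Rightarrow> 'u cellcx \<Rightarrow> 'u \<Rightarrow> 'u" where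
  "comp_ident B A = restrict
     (cx_induced (\<lambda>k y. cx_map (snd (comp_cocone B A) k) (comp_theta B A k y)))
     (topspace (cx_body B))"


section \<open>The functors \<open>K\<close> and \<open>E\<close>\<close>

text \<open>The \<open>n\<close>-th stratum of \<open>K f\<close>, given \<open>X = A\<^sub>n\<close> and \<open>e = E\<^sub>n f : X \<rightarrow> B\<close>; \<open>P d u\<close> says that
  \<open>u : bsphere d \<rightarrow> X\<close> factors through the previous stage. The cell \<open>Square_cell d u v\<close> is the
  square \<open>(u, v)\<close> from the inclusion \<open>bsphere d \<rightarrow> disc d\<close> to \<open>e\<close>.\<close>

definition K_cells ::
  "(nat \<Rightarrow> ((nat \<Rightarrow> real) \<Rightarrow> 'u) \<Rightarrow> bool) \<Rightarrow> 'u topology \<Rightarrow> ('u \<Rightarrow> 'u) \<Rightarrow> 'u topology \<Rightarrow> 'u::universe set" where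
  "K_cells P X e B = {enc (Square_cell d u v) | d u v.
     continuous_map (bsphere d) X u \<and> u \<in> extensional (topspace (bsphere d)) \<and>
     continuous_map (disc d) B v \<and> v \<in> extensional (topspace (disc d)) \<and>
     (\<forall>x \<in> topspace (bsphere d). e (u x) = v x) \<and> \<not> P d u}"

definition K_stratum ::
  "(nat \<Rightarrow> ((nat \<Rightarrow> real) \<Rightarrow> 'u) \<Rightarrow> bool) \<Rightarrow> 'u topology \<Rightarrow> ('u \<Rightarrow> 'u) \<Rightarrow> 'u topology \<Rightarrow> 'u::universe stratum" where
  "K_stratum P X e B = \<lparr>
     sbd = X,
     cells = K_cells P X e B,
     cdim = (\<lambda>s\<in>K_cells P X e B. case dec s of Square_cell d u v \<Rightarrow> d),
     att = (\<lambda>s\<in>K_cells P X e B. case dec s of Square_cell d u v \<Rightarrow> u)\<rparr>"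

primrec K_rec :: "'u::universe cmap \<Rightarrow> nat \<Rightarrow> 'u stratum \<times> ('u \<Rightarrow> 'u)" where
  "K_rec f 0 = (K_stratum (\<lambda>d u. False) (cdom f) (cfun f) (ccod f), cfun f)"
| "K_rec f (Suc n) =
     (let (\<sigma>, e) = K_rec f n;
          e' = body_induced e (\<lambda>s. case dec s of Square_cell d u v \<Rightarrow> v)
      in (K_stratum (factors_through old (sbd \<sigma>)) (body \<sigma>) e' (ccod f), e'))"

definition K_ob :: "'u::universe cmap \<Rightarrow> 'u cellcx" where
  "K_ob f n = fst (K_rec f n)"

definition E_ob :: "'u::universe cmap \<Rightarrow> 'u cmap" where
  "E_ob f = Cmap (cx_body (K_ob f))
     (restrict (cx_induced (\<lambda>n. snd (K_rec f n))) (topspace (cx_body (K_ob f)))) (ccod f)"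

definition UK_counit :: "'u::universe cmap \<Rightarrow> 'u cmap square" where
  "UK_counit f = Sq (U_ob (K_ob f)) (Idm TOP (cdom f)) (E_ob f) f"

definition K_functr :: "('u::universe cmap, 'u cmap square, 'u cellcx, 'u cellmor) functr" where
  "K_functr = right_adjoint CELLCX TOP2 U_functr K_ob UK_counit"

definition UK :: "('u::universe cmap, 'u cmap square, 'u cmap, 'u cmap square) functr" where
  "UK = cmp_functr U_functr K_functr"

definition UK_comult :: "'u::universe cmap \<Rightarrow> 'u cmap square" where
  "UK_comult = adjunction_comult CELLCX TOP2 U_functr K_ob UK_counit"

definition E_functr :: "('u::universe cmap, 'u cmap square, 'u cmap, 'u cmap square) functr" where
  "E_functr = \<lparr>
     Fob = E_ob,
     Fmo = (\<lambda>\<sigma>. Sq (E_ob (sq_src \<sigma>))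
       (Cmap (cx_body (K_ob (sq_src \<sigma>))) (cx_map (Fmo K_functr \<sigma>)) (cx_body (K_ob (sq_tgt \<sigma>))))
       (sq_bot \<sigma>) (E_ob (sq_tgt \<sigma>)))\<rparr>"

definition E_unit :: "'u::universe cmap \<Rightarrow> 'u cmap square" where
  "E_unit f = Sq f (U_ob (K_ob f)) (Idm TOP (ccod f)) (E_ob f)"

text \<open>The morphism \<open>\<phi> : K E f * K f \<rightarrow> K f\<close> corresponding to \<open>(1, E E f)\<close>, where \<open>E E f\<close> is defined on
  the body of \<open>K E f\<close> and so has to be composed with the inverse of \<open>comp_ident\<close>.\<close>

definition E_mult_mor :: "'u::universe cmap \<Rightarrow> 'u cellmor" where
  "E_mult_mor f =
     (let B = K_ob (E_ob f); Q = cx_comp B (K_ob f)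
      in transpose CELLCX TOP2 U_functr K_ob UK_counit Q f
           (Sq (U_ob Q) (Idm TOP (cdom f))
              (Cmap (cx_body Q)
                 (\<lambda>z\<in>topspace (cx_body Q).
                    cfun (E_ob (E_ob f)) (inv_into (topspace (cx_body B)) (comp_ident B (K_ob f)) z))
                 (ccod f))
              f))"

definition E_mult :: "'u::universe cmap \<Rightarrow> 'u cmap square" where
  "E_mult f =
     (let B = K_ob (E_ob f)
      in Sq (E_ob (E_ob f))
           (Cmap (cx_body B)
              (compose (topspace (cx_body B)) (cx_map (E_mult_mor f)) (comp_ident B (K_ob f)))
              (cx_body (K_ob f)))
           (Idm TOP (ccod f)) (E_ob f))"

end

theory Submission
  imports Defs
begin

text \<open>Write \<open>M f\<close> for the body of \<open>K f\<close>. A cell of \<open>K f\<close> is a square from the inclusion of a sphere in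
  a disc to some \<open>E\<^sub>n f\<close>, so it is determined by its attaching map into \<open>M f\<close> and by the composite of
  its characteristic map with \<open>E f\<close>. Call a map between bodies cellular if it sends characteristic maps
  to characteristic maps. Then a cellular map \<open>c\<close> into \<open>M f\<close> is determined by its restriction to the
  boundary and by \<open>E f \<circ> c\<close> (\<open>cellular_unique\<close>). The maps \<open>M f \<rightarrow> M g\<close> induced by squares, the
  comultiplications \<open>\<delta>\<^sub>f : M f \<rightarrow> M (UK f)\<close> and the multiplications \<open>\<mu>\<^sub>f : M (E f) \<rightarrow> M f\<close> are all
  cellular, and so are their composites. Each law of an algebraic weak factorisation system, including
  distributivity, comes down to equations between such composites, and it is immediate that the two sides
  agree on the boundary and after \<open>E\<close>. This part of the argument is purely formal; it is the locale
  \<open>cellular_factorisation\<close>.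

  It remains to construct these maps. The transpose of a square \<open>U A \<rightarrow> f\<close> is defined stage by stage
  (\<open>transpose_eq_lift\<close>). That it sends cells to cells of \<open>K f\<close>, whose attaching maps must not
  factor through an earlier stage, holds because stages are closed in one another: factoring through a
  stage is then a condition on points (\<open>is_cellcx_iff\<close>), and the stage at which a point first
  occurs is preserved.

  The multiplication requires an analysis of the composite \<open>B * A\<close>: its body is that of \<open>B\<close>
  (\<open>homeomorphic_ident\<close>), and its characteristic maps include those of \<open>A\<close> and \<open>B\<close>
  (\<open>cellular_ident\<close>). For a single stratum this uses that a compact subset of a cell complex
  lies in a finite stage (\<open>compactin_bounded_stage\<close>). For the passage to the colimit, sequential
  colimits are constructed explicitly (\<open>is_seq_colimit_colim\<close>), and any such colimit is
  preserved by the formation of bodies, as maps from a body to \<open>Z\<close> are the same as morphisms to the cell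
  complex \<open>K\<close> of the identity of \<open>Z\<close>.\<close>


section \<open>Discs and spheres\<close>

lemma bsphere_eq_subtopology_disc: "bsphere n = subtopology (disc n) (topspace (bsphere n))"
proof -
  have "bsphere n = subtopology (subtopology (Euclidean_space n) {x. (\<Sum>i<n. (x i)\<^sup>2) \<le> 1}) {x. (\<Sum>i<n. (x i)\<^sup>2) = 1}"
    unfolding bsphere_def subtopology_subtopology by (rule arg_cong[where f = "subtopology _"]) auto
  then show ?thesis
    by (metis disc_def subtopology_restrict topspace_subtopology_subset bsphere_subset_disc Int_absorb1 topspace_subtopology)
qed

lemma continuous_map_sum_squares:
  "continuous_map (Euclidean_space n) euclideanreal (\<lambda>x. \<Sum>i<k. (x i)\<^sup>2)"
  unfolding Euclidean_space_def
  by (intro continuous_intros) (simp_all add: continuous_map_from_subtopology[OF continuous_map_product_projection[of _ UNIV "\<lambda>_. euclideanreal"]])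

lemma closedin_bsphere: "closedin (disc n) (topspace (bsphere n))"
proof -
  have "continuous_map (disc n) euclideanreal (\<lambda>x. \<Sum>i<n. (x i)\<^sup>2)"
    unfolding disc_def by (intro continuous_map_from_subtopology continuous_map_sum_squares)
  then have "closedin (disc n) {x \<in> topspace (disc n). (\<Sum>i<n. (x i)\<^sup>2) \<in> {1}}"
    by (rule closedin_continuous_map_preimage) simp
  moreover have "{x \<in> topspace (disc n). (\<Sum>i<n. (x i)\<^sup>2) \<in> {1}} = topspace (bsphere n)"
    by (auto simp: disc_def bsphere_def)
  ultimately show ?thesis
    by simp
qed

lemma closedin_disc_singleton: "d \<in> topspace (disc n) \<Longrightarrow> closedin (disc n) {d}"
  by (simp add: disc_def closedin_Hausdorff_sing_eq Hausdorff_space_subtopology Hausdorff_Euclidean_space)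

lemma compact_space_bsphere: "compact_space (bsphere n)"
proof -
  let ?P = "powertop_real (UNIV :: nat set)"
  have eq: "topspace (bsphere n) = {x. (\<forall>i\<ge>n. x i = 0) \<and> (\<Sum>i<n. (x i)\<^sup>2) = 1}"
    by (auto simp: bsphere_def topspace_Euclidean_space)
  have c: "continuous_map ?P euclideanreal (\<lambda>x. x i)" for i
    using continuous_map_product_projection[of i UNIV "\<lambda>_. euclideanreal"] by simp
  have z: "closedin ?P {x \<in> topspace ?P. x i \<in> {0}}" for i
    by (rule closedin_continuous_map_preimage[OF c]) simp
  have "continuous_map ?P euclideanreal (\<lambda>x. \<Sum>i<n. (x i)\<^sup>2)"
    by (intro continuous_intros) (simp_all add: c)
  then have s: "closedin ?P {x \<in> topspace ?P. (\<Sum>i<n. (x i)\<^sup>2) \<in> {1}}"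
    by (rule closedin_continuous_map_preimage) simp
  have "topspace (bsphere n) =
      {x \<in> topspace ?P. (\<Sum>i<n. (x i)\<^sup>2) \<in> {1}} \<inter> topspace ?P \<inter> (\<Inter>i\<in>{n..}. {x \<in> topspace ?P. x i \<in> {0}})"
    unfolding eq by auto
  moreover have "closedin ?P \<dots>"
    by (intro closedin_Int s closedin_Inter closedin_topspace) (use z in auto)
  ultimately have cl: "closedin ?P (topspace (bsphere n))"
    by metis
  have "\<bar>x i\<bar> \<le> 1" if x: "x \<in> topspace (bsphere n)" for x i
  proof (cases "i < n")
    case True
    then have "(x i)\<^sup>2 \<le> (\<Sum>i<n. (x i)\<^sup>2)"
      by (intro member_le_sum) auto
    with x show ?thesis
      by (simp add: eq abs_square_le_1)
  qed (use x in \<open>auto simp: eq\<close>)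
  then have "topspace (bsphere n) \<subseteq> PiE UNIV (\<lambda>i. {-1..1})"
    by (fastforce simp: abs_le_iff)
  moreover have "compactin ?P (PiE UNIV (\<lambda>i. {-1..1}))"
    by (simp add: compactin_PiE)
  ultimately have "compactin ?P (topspace (bsphere n))"
    using cl closed_compactin by blast
  moreover have "bsphere n = subtopology ?P (topspace (bsphere n))"
    by (simp add: bsphere_def Euclidean_space_def subtopology_subtopology)
  ultimately show ?thesis
    using compact_space_subtopology by metis
qed


section \<open>Closed embeddings of stages\<close>

abbreviation "pts \<sigma> \<equiv> topspace (sbd \<sigma>)"
abbreviation "body_pts A \<equiv> topspace (cx_body A)"
abbreviation "disc_of \<sigma> s \<equiv> topspace (disc (cdim \<sigma> s))"
abbreviation "bdry \<sigma> s \<equiv> topspace (bsphere (cdim \<sigma> s))"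

lemma inj_old: "inj old"
  by (simp add: inj_def old_def)

lemma old_eq_iff [simp]: "old x = old y \<longleftrightarrow> x = y"
  by (simp add: old_def)

lemma dec_old [simp]: "dec (old x) = Old_pt x"
  by (simp add: old_def)

lemma cell_pt_not_old [simp]: "enc (Cell_pt s d) \<notin> range old" "enc (Cell_pt s d) \<noteq> old x" "old x \<noteq> enc (Cell_pt s d)"
  by (auto simp: old_def)

lemma continuous_map_composeI:
  assumes "continuous_map X Y f" "continuous_map Y Z g" "\<And>x. x \<in> topspace X \<Longrightarrow> k x = g (f x)"
  shows "continuous_map X Z k"
  by (rule continuous_map_eq[OF continuous_map_compose[OF assms(1,2)]]) (simp add: assms(3))

text \<open>The maps between the stages of a cell complex are closed injections. Because of the following two
  lemmas, factoring through a stage is a condition on points.\<close>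

lemma continuous_map_inv_closed_inj:
  assumes i: "closed_map X Y i" "inj i"
    and b: "continuous_map S Y b" "b ` topspace S \<subseteq> i ` topspace X"
  shows "continuous_map S X (inv i \<circ> b)"
proof -
  have "{x \<in> topspace S. inv i (b x) \<in> C} = {x \<in> topspace S. b x \<in> i ` C}" if "closedin X C" for C
    using b(2) inv_f_f[OF i(2)] closedin_subset[OF that] by force
  moreover have "closedin S {x \<in> topspace S. b x \<in> i ` C}" if "closedin X C" for C
    using closedin_continuous_map_preimage[OF b(1)] i(1) that by (simp add: closed_map_def)
  moreover have "inv i (b x) \<in> topspace X" if "x \<in> topspace S" for x
    using that b(2) inv_f_f[OF i(2)] by fastforce
  ultimately show ?thesis
    by (auto simp: continuous_map_closedin)
qed

lemma factors_through_closed_inj_iff: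
  assumes i: "closed_map X Y i" "inj i" and b: "continuous_map (bsphere n) Y b"
  shows "factors_through i X n b \<longleftrightarrow> b ` topspace (bsphere n) \<subseteq> i ` topspace X"
proof
  assume "factors_through i X n b"
  then show "b ` topspace (bsphere n) \<subseteq> i ` topspace X"
    by (fastforce simp: factors_through_def continuous_map_def)
next
  assume s: "b ` topspace (bsphere n) \<subseteq> i ` topspace X"
  have "b x = i ((inv i \<circ> b) x)" if "x \<in> topspace (bsphere n)" for x
    using s that by (force simp: inv_f_f[OF i(2)])
  then show "factors_through i X n b"
    unfolding factors_through_def using continuous_map_inv_closed_inj[OF i b s] by blast
qed

lemma closedin_body_iff:
  assumes \<sigma>: "is_stratum \<sigma>"
  shows "closedin (body \<sigma>) V \<longleftrightarrow> V \<subseteq> body_points \<sigma> \<and> closedin (sbd \<sigma>) {x \<in> pts \<sigma>. old x \<in> V} \<and>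
    (\<forall>s \<in> cells \<sigma>. closedin (disc (cdim \<sigma> s)) {d \<in> disc_of \<sigma> s. char_map \<sigma> s d \<in> V})"
proof -
  have 1: "{x \<in> pts \<sigma>. old x \<in> body_points \<sigma> - V} =
      pts \<sigma> - {x \<in> pts \<sigma>. old x \<in> V}"
    by (auto simp: body_points_def)
  have 2: "{d \<in> disc_of \<sigma> s. char_map \<sigma> s d \<in> body_points \<sigma> - V} =
      disc_of \<sigma> s - {d \<in> disc_of \<sigma> s. char_map \<sigma> s d \<in> V}" if "s \<in> cells \<sigma>" for s
    using char_map_in_body_points[OF \<sigma> that] by auto
  have 3: "(\<forall>s \<in> cells \<sigma>. openin (disc (cdim \<sigma> s))
        {d \<in> disc_of \<sigma> s. char_map \<sigma> s d \<in> body_points \<sigma> - V}) \<longleftrightarrow>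
      (\<forall>s \<in> cells \<sigma>. closedin (disc (cdim \<sigma> s)) {d \<in> disc_of \<sigma> s. char_map \<sigma> s d \<in> V})"
    by (rule ball_cong[OF refl], subst 2) (auto simp: closedin_def)
  show ?thesis
    unfolding closedin_def[of "body \<sigma>"] topspace_body[OF \<sigma>] openin_body body_open_def 1 3
    by (auto simp: closedin_def[of "sbd \<sigma>"])
qed

lemma closed_map_old:
  assumes \<sigma>: "is_stratum \<sigma>"
  shows "closed_map (sbd \<sigma>) (body \<sigma>) old"
  unfolding closed_map_def
proof (intro allI impI)
  fix C assume C: "closedin (sbd \<sigma>) C"
  have "{x \<in> pts \<sigma>. old x \<in> old ` C} = C"
    using closedin_subset[OF C] by auto
  moreover have "closedin (disc (cdim \<sigma> s)) {d \<in> disc_of \<sigma> s. char_map \<sigma> s d \<in> old ` C}"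
    if s: "s \<in> cells \<sigma>" for s
  proof -
    have "{d \<in> disc_of \<sigma> s. char_map \<sigma> s d \<in> old ` C} =
        {d \<in> bdry \<sigma> s. att \<sigma> s d \<in> C}"
      using bsphere_subset_disc[of "cdim \<sigma> s"] by (auto simp: char_map_def split: if_splits)
    moreover have "closedin (bsphere (cdim \<sigma> s)) {d \<in> bdry \<sigma> s. att \<sigma> s d \<in> C}"
      using \<sigma> s C by (intro closedin_continuous_map_preimage) (auto simp: is_stratum_def)
    ultimately show ?thesis
      using bsphere_eq_subtopology_disc closedin_bsphere closedin_closed_subtopology by metis
  qed
  moreover have "old ` C \<subseteq> body_points \<sigma>"
    using closedin_subset[OF C] by (auto simp: body_points_def)
  ultimately show "closedin (body \<sigma>) (old ` C)"
    using C by (simp add: closedin_body_iff[OF \<sigma>])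
qed

lemma closedin_cell_pt:
  assumes \<sigma>: "is_stratum \<sigma>" and x: "x \<in> body_points \<sigma>" "x \<notin> range old"
  shows "closedin (body \<sigma>) {x}"
proof -
  obtain s d where s: "x = enc (Cell_pt s d)" "s \<in> cells \<sigma>"
      "d \<in> disc_of \<sigma> s - bdry \<sigma> s"
    using x by (auto simp: body_points_def)
  have "{d' \<in> disc_of \<sigma> s'. char_map \<sigma> s' d' \<in> {x}} = (if s' = s then {d} else {})" for s'
    using s by (auto simp: char_map_def split: if_splits)
  moreover have "{y \<in> pts \<sigma>. old y \<in> {x}} = {}"
    using x by auto
  ultimately show ?thesis
    using x s closedin_disc_singleton by (auto simp: closedin_body_iff[OF \<sigma>] simp del: mem_Collect_eq)
qed

lemma continuous_map_att: "is_stratum \<sigma> \<Longrightarrow> s \<in> cells \<sigma> \<Longrightarrow> continuous_map (bsphere (cdim \<sigma> s)) (sbd \<sigma>) (att \<sigma> s)"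
  by (simp add: is_stratum_def)

lemma att_in_sbd: "is_stratum \<sigma> \<Longrightarrow> s \<in> cells \<sigma> \<Longrightarrow> x \<in> bdry \<sigma> s \<Longrightarrow> att \<sigma> s x \<in> pts \<sigma>"
  by (auto simp: is_stratum_def continuous_map_def)

lemma char_map_in_body: "is_stratum \<sigma> \<Longrightarrow> s \<in> cells \<sigma> \<Longrightarrow> d \<in> disc_of \<sigma> s \<Longrightarrow> char_map \<sigma> s d \<in> topspace (body \<sigma>)"
  by (simp add: topspace_body char_map_in_body_points)

lemma old_in_body_iff: "is_stratum \<sigma> \<Longrightarrow> old x \<in> topspace (body \<sigma>) \<longleftrightarrow> x \<in> pts \<sigma>"
  by (auto simp: topspace_body body_points_def)

lemma body_cases:
  assumes "is_stratum \<sigma>" "z \<in> topspace (body \<sigma>)"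
  obtains (old) x where "x \<in> pts \<sigma>" "z = old x"
  | (cell) s d where "s \<in> cells \<sigma>" "d \<in> disc_of \<sigma> s" "d \<notin> bdry \<sigma> s"
      "z = enc (Cell_pt s d)" "char_map \<sigma> s d = enc (Cell_pt s d)"
  using assms by (fastforce simp: topspace_body body_points_def char_map_def)


section \<open>Cell complexes\<close>



definition first_stage :: "'u::universe \<Rightarrow> nat" where
  "first_stage z = (case dec z of Stage_pt n x \<Rightarrow> n)"

lemma stage_incl_Suc_old [simp]: "stage_incl (Suc n) (old x) = stage_incl n x"
  by (rule stage_incl_old)

lemma stage_incl_Suc_new: "x \<notin> range old \<Longrightarrow> stage_incl (Suc n) x = enc (Stage_pt (Suc n) x)"
  by (simp add: stage_incl.simps)

declare stage_incl.simps [simp del]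

lemma first_stage_incl_le: "first_stage (stage_incl n x) \<le> n"
  by (induction n arbitrary: x) (simp_all add: first_stage_def stage_incl.simps le_SucI)

lemma first_stage_incl_new: "n = 0 \<or> x \<notin> range old \<Longrightarrow> first_stage (stage_incl n x) = n"
  by (cases n) (auto simp: first_stage_def stage_incl_Suc_new stage_incl.simps(1))

lemma first_stage_incl_Suc_less: "first_stage (stage_incl (Suc n) x) \<le> n \<longleftrightarrow> x \<in> range old"
proof (cases "x \<in> range old")
  case True
  then show ?thesis
    using first_stage_incl_le by auto
next
  case False
  then show ?thesis
    by (simp add: first_stage_incl_new)
qed

lemma inj_stage_incl: "inj (stage_incl n)"
proof (induction n)
  case (Suc n)
  have "x = y" if e: "stage_incl (Suc n) x = stage_incl (Suc n) y" for x y :: 'a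
  proof (cases "x \<in> range old")
    case True
    with e have "y \<in> range old"
      by (metis first_stage_incl_Suc_less)
    with True e show ?thesis
      by (auto dest: injD[OF Suc])
  next
    case False
    with e have "y \<notin> range old"
      by (metis first_stage_incl_Suc_less)
    with False e show ?thesis
      by (simp add: stage_incl_Suc_new)
  qed
  then show ?case
    by (rule injI)
qed (simp add: inj_def stage_incl.simps)

lemma stage_incl_eq_iff [simp]: "stage_incl n x = stage_incl n y \<longleftrightarrow> x = y"
  by (simp add: inj_eq[OF inj_stage_incl])

lemma stage_incl_old_pow: "m \<le> n \<Longrightarrow> stage_incl n ((old ^^ (n - m)) x) = stage_incl m x"
  by (induction n rule: dec_induct) (simp_all add: Suc_diff_le)

lemma inj_old_pow: "inj (old ^^ k)"
  by (simp add: inj_fn inj_old)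

text \<open>Properness is added by \<open>is_cellcx_iff\<close> below, in a form whose justification is that stages are
  closed in one another.\<close>

definition connected_strata :: "'u::universe cellcx \<Rightarrow> bool" where
  "connected_strata A \<longleftrightarrow> (\<forall>n. is_stratum (A n)) \<and> (\<forall>n. sbd (A (Suc n)) = body (A n))"

lemma closed_map_old_pow:
  assumes A: "connected_strata A"
  shows "closed_map (sbd (A m)) (sbd (A (m + k))) (old ^^ k)"
proof (induction k)
  case (Suc k)
  have "closed_map (sbd (A (m + k))) (sbd (A (Suc (m + k)))) old"
    using A closed_map_old by (metis connected_strata_def)
  from closed_map_compose[OF Suc this] show ?case
    by (simp add: comp_def)
qed (simp add: closed_map_id id_def[symmetric])

lemma old_pow_in_sbd_iff:
  assumes A: "connected_strata A"
  shows "(old ^^ k) x \<in> pts (A (m + k)) \<longleftrightarrow> x \<in> pts (A m)"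
  using A by (induction k) (simp_all add: connected_strata_def old_in_body_iff)

lemma stage_incl_in_stage_iff:
  assumes A: "connected_strata A" and x: "x \<in> pts (A n)"
  shows "stage_incl n x \<in> stage_incl m ` pts (A m) \<longleftrightarrow> first_stage (stage_incl n x) \<le> m"
proof
  assume "stage_incl n x \<in> stage_incl m ` pts (A m)"
  then show "first_stage (stage_incl n x) \<le> m"
    using first_stage_incl_le by auto
next
  assume r: "first_stage (stage_incl n x) \<le> m"
  show "stage_incl n x \<in> stage_incl m ` pts (A m)"
  proof (cases "n \<le> m")
    case True
    then have "stage_incl n x = stage_incl m ((old ^^ (m - n)) x)"
      by (simp add: stage_incl_old_pow)
    moreover have "(old ^^ (m - n)) x \<in> pts (A m)"
      using old_pow_in_sbd_iff[OF A, of "m - n" x n] x True by simp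
    ultimately show ?thesis
      by blast
  next
    case False
    then have "m \<le> n"
      by simp
    then show ?thesis
      using x r
    proof (induction n arbitrary: x rule: dec_induct)
      case (step n)
      then obtain y where y: "x = old y"
        using first_stage_incl_Suc_less[of n x] by (metis le_trans image_iff)
      with step.prems A have "y \<in> pts (A n)"
        by (simp add: connected_strata_def old_in_body_iff)
      with step y show ?case
        by simp
    qed simp
  qed
qed

lemma in_stage_iff:
  assumes A: "connected_strata A" and z: "z \<in> body_pts A"
  shows "z \<in> stage_incl m ` pts (A m) \<longleftrightarrow> first_stage z \<le> m"
proof -
  obtain n x where "x \<in> pts (A n)" "z = stage_incl n x"
    using z by (auto simp: topspace_cx_body)
  then show ?thesis
    using stage_incl_in_stage_iff[OF A] by simp
qed

lemma old_pow_image_iff: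
  assumes A: "connected_strata A" and mn: "m \<le> n" and x: "x \<in> pts (A n)"
  shows "x \<in> (old ^^ (n - m)) ` pts (A m) \<longleftrightarrow> first_stage (stage_incl n x) \<le> m"
proof -
  have "x \<in> (old ^^ (n - m)) ` pts (A m) \<longleftrightarrow>
      stage_incl n x \<in> stage_incl n ` (old ^^ (n - m)) ` pts (A m)"
    by (simp add: inj_image_mem_iff[OF inj_stage_incl])
  also have "stage_incl n ` (old ^^ (n - m)) ` pts (A m) = stage_incl m ` pts (A m)"
    by (simp add: image_image stage_incl_old_pow[OF mn])
  finally show ?thesis
    by (simp add: stage_incl_in_stage_iff[OF A x])
qed

text \<open>As stages are closed in one another, an attaching map factors through an earlier stage as soon as
  its values lie there. So properness can be tested on points, and only against the stage just before,
  which contains all earlier ones.\<close>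

lemma is_cellcx_iff:
  "is_cellcx A \<longleftrightarrow> connected_strata A \<and>
    (\<forall>n. \<forall>s \<in> cells (A (Suc n)). \<exists>x \<in> bdry (A (Suc n)) s. att (A (Suc n)) s x \<notin> range old)"
    (is "_ \<longleftrightarrow> _ \<and> ?P")
proof (cases "connected_strata A")
  case A: True
  have f: "factors_through (old ^^ (n - m)) (sbd (A m)) (cdim (A n) s) (att (A n) s) \<longleftrightarrow>
      (\<forall>x \<in> bdry (A n) s. first_stage (stage_incl n (att (A n) s x)) \<le> m)"
    if mn: "m \<le> n" and s: "s \<in> cells (A n)" for m n s
  proof -
    have st: "is_stratum (A n)"
      using A by (simp add: connected_strata_def)
    have "closed_map (sbd (A m)) (sbd (A n)) (old ^^ (n - m))"
      using closed_map_old_pow[OF A, of m "n - m"] mn by simp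
    from factors_through_closed_inj_iff[OF this inj_old_pow continuous_map_att[OF st s]]
    show ?thesis
      using old_pow_image_iff[OF A mn] att_in_sbd[OF st s] by blast
  qed
  have "(\<forall>n. \<forall>s \<in> cells (A n). \<forall>m < n.
      \<not> factors_through (old ^^ (n - m)) (sbd (A m)) (cdim (A n) s) (att (A n) s)) \<longleftrightarrow> ?P" (is "?L \<longleftrightarrow> _")
  proof
    assume L: ?L
    show ?P
    proof (intro allI ballI)
      fix n s assume s: "s \<in> cells (A (Suc n))"
      then have "\<not> factors_through (old ^^ (Suc n - n)) (sbd (A n)) (cdim (A (Suc n)) s) (att (A (Suc n)) s)"
        using L by blast
      then show "\<exists>x \<in> bdry (A (Suc n)) s. att (A (Suc n)) s x \<notin> range old"
        using f[of n "Suc n" s] s first_stage_incl_Suc_less by auto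
    qed
  next
    assume P: ?P
    show ?L
    proof (intro allI ballI impI)
      fix n s m assume s: "s \<in> cells (A n)" and mn: "m < n"
      then obtain k where n: "n = Suc k"
        by (cases n) auto
      obtain x where "x \<in> bdry (A n) s" "att (A n) s x \<notin> range old"
        using P s n by blast
      then show "\<not> factors_through (old ^^ (n - m)) (sbd (A m)) (cdim (A n) s) (att (A n) s)"
        using f[of m n s] s mn first_stage_incl_new[of n] by fastforce
    qed
  qed
  with A show ?thesis
    by (simp add: is_cellcx_def connected_strata_def)
qed (auto simp: is_cellcx_def connected_strata_def)

lemma cellcx_connected: "is_cellcx A \<Longrightarrow> connected_strata A"
  by (simp add: is_cellcx_iff)

lemma cellcx_stratum: "is_cellcx A \<Longrightarrow> is_stratum (A n)"
  by (simp add: is_cellcx_def)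

lemma cellcx_sbd_Suc: "is_cellcx A \<Longrightarrow> sbd (A (Suc n)) = body (A n)"
  by (simp add: is_cellcx_def)

lemma cellcx_proper:
  assumes "is_cellcx A" "s \<in> cells (A n)"
  obtains "n = 0" | x where "x \<in> bdry (A n) s" "first_stage (stage_incl n (att (A n) s x)) = n"
proof (cases n)
  case (Suc m)
  then obtain x where "x \<in> bdry (A n) s" "att (A n) s x \<notin> range old"
    using assms unfolding is_cellcx_iff by blast
  then show ?thesis
    using that(2) first_stage_incl_new by blast
qed (use that in blast)



definition cx_char :: "'u::universe cellcx \<Rightarrow> nat \<Rightarrow> 'u \<Rightarrow> (nat \<Rightarrow> real) \<Rightarrow> 'u" where
  "cx_char A n s d = stage_incl (Suc n) (char_map (A n) s d)"

lemma continuous_map_cx_char: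
  assumes "is_cellcx A" "s \<in> cells (A n)"
  shows "continuous_map (disc (cdim (A n) s)) (cx_body A) (cx_char A n s)"
proof -
  have "continuous_map (disc (cdim (A n) s)) (cx_body A) (stage_incl (Suc n) \<circ> char_map (A n) s)"
    using body_pushout(2)[OF cellcx_stratum[OF assms(1)] assms(2)] cx_body_colimit(1)[OF assms(1), of "Suc n"]
    by (simp add: cellcx_sbd_Suc[OF assms(1)] continuous_map_compose)
  then show ?thesis
    by (simp add: cx_char_def[abs_def] comp_def)
qed

lemma stage_incl_in_cx_body: "x \<in> pts (A n) \<Longrightarrow> stage_incl n x \<in> body_pts A"
  by (auto simp: topspace_cx_body)

lemma cx_char_in_cx_body:
  "is_cellcx A \<Longrightarrow> s \<in> cells (A n) \<Longrightarrow> d \<in> disc_of (A n) s \<Longrightarrow> cx_char A n s d \<in> body_pts A"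
  unfolding cx_char_def by (rule stage_incl_in_cx_body) (simp add: cellcx_sbd_Suc cellcx_stratum char_map_in_body)

lemma cx_char_bsphere: "d \<in> bdry (A n) s \<Longrightarrow> cx_char A n s d = stage_incl n (att (A n) s d)"
  by (simp add: cx_char_def char_map_def)



lemma stage_eqI:
  assumes A: "is_cellcx A"
    and 0: "\<And>x. x \<in> pts (A 0) \<Longrightarrow> k (stage_incl 0 x) = l (stage_incl 0 x)"
    and c: "\<And>m s d. m < n \<Longrightarrow> s \<in> cells (A m) \<Longrightarrow> d \<in> disc_of (A m) s \<Longrightarrow>
      k (cx_char A m s d) = l (cx_char A m s d)"
    and x: "x \<in> pts (A n)"
  shows "k (stage_incl n x) = l (stage_incl n x)"
  using c x
proof (induction n arbitrary: x)
  case (Suc n)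
  from Suc.prems(2) have "x \<in> topspace (body (A n))"
    by (simp add: cellcx_sbd_Suc[OF A])
  with cellcx_stratum[OF A] show ?case
  proof (cases rule: body_cases)
    case (old y)
    with Suc show ?thesis
      by simp
  next
    case (cell s d)
    then show ?thesis
      using Suc.prems(1)[of n s d] by (simp add: cx_char_def)
  qed
qed (use 0 in simp)

lemma cx_eqI:
  assumes A: "is_cellcx A"
    and 0: "\<And>x. x \<in> pts (A 0) \<Longrightarrow> k (stage_incl 0 x) = l (stage_incl 0 x)"
    and c: "\<And>n s d. s \<in> cells (A n) \<Longrightarrow> d \<in> disc_of (A n) s \<Longrightarrow>
      k (cx_char A n s d) = l (cx_char A n s d)"
    and z: "z \<in> body_pts A"
  shows "k z = l z"
  by (rule cx_body_colimit(4)[OF A _ z], rule stage_eqI[OF A]) (use 0 c in auto)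

lemma closed_map_stage_incl:
  assumes A: "is_cellcx A"
  shows "closed_map (sbd (A n)) (cx_body A) (stage_incl n)"
  unfolding closed_map_def
proof (intro allI impI)
  note Ac = cellcx_connected[OF A]
  fix C assume C: "closedin (sbd (A n)) C"
  then have CX: "C \<subseteq> pts (A n)"
    by (rule closedin_subset)
  have pre: "closedin (sbd (A m)) {x \<in> pts (A m). stage_incl m x \<in> stage_incl n ` C}" for m
  proof (cases "n \<le> m")
    case True
    have "stage_incl m x \<in> stage_incl n ` C \<longleftrightarrow> x \<in> (old ^^ (m - n)) ` C" for x
    proof -
      have "stage_incl n ` C = stage_incl m ` (old ^^ (m - n)) ` C"
        by (simp add: image_image stage_incl_old_pow[OF True])
      then show ?thesis
        by (simp only: inj_image_mem_iff[OF inj_stage_incl])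
    qed
    moreover have "closedin (sbd (A m)) ((old ^^ (m - n)) ` C)"
      using closed_map_old_pow[OF Ac, of n "m - n"] C True by (simp add: closed_map_def)
    moreover have "{x \<in> pts (A m). x \<in> (old ^^ (m - n)) ` C} = (old ^^ (m - n)) ` C"
      using closedin_subset[OF calculation(2)] by auto
    ultimately show ?thesis
      by simp
  next
    case False
    then have e: "stage_incl m x = stage_incl n ((old ^^ (n - m)) x)" for x :: 'a
      by (simp add: stage_incl_old_pow)
    have "continuous_map (sbd (A m)) (sbd (A (m + k))) (old ^^ k)" for k
    proof (induction k)
      case (Suc k)
      have "continuous_map (sbd (A (m + k))) (sbd (A (Suc (m + k)))) old"
        using body_pushout(1)[OF cellcx_stratum[OF A]] by (simp add: cellcx_sbd_Suc[OF A])
      from continuous_map_compose[OF Suc this] show ?case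
        by (simp add: comp_def)
    qed (simp add: id_def[symmetric])
    from this[of "n - m"] False have "continuous_map (sbd (A m)) (sbd (A n)) (old ^^ (n - m))"
      by simp
    from closedin_continuous_map_preimage[OF this C] show ?thesis
      by (simp add: e inj_image_mem_iff[OF inj_stage_incl])
  qed
  have "{x \<in> pts (A m). stage_incl m x \<in> body_pts A - stage_incl n ` C} =
      pts (A m) - {x \<in> pts (A m). stage_incl m x \<in> stage_incl n ` C}" for m
    by (auto simp: stage_incl_in_cx_body)
  with pre have "openin (cx_body A) (body_pts A - stage_incl n ` C)"
    unfolding openin_cx_body cx_open_def by (auto simp: topspace_cx_body[of A, symmetric] openin_diff)
  moreover have "stage_incl n ` C \<subseteq> body_pts A"
    using CX by (auto simp: stage_incl_in_cx_body)
  ultimately show "closedin (cx_body A) (stage_incl n ` C)"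
    by (simp add: closedin_def)
qed

lemma closedin_cx_bodyI:
  assumes "V \<subseteq> body_pts A"
    and "\<And>n. closedin (sbd (A n)) {x \<in> pts (A n). stage_incl n x \<in> V}"
  shows "closedin (cx_body A) V"
proof -
  have "{x \<in> pts (A n). stage_incl n x \<in> body_pts A - V} =
      pts (A n) - {x \<in> pts (A n). stage_incl n x \<in> V}" for n
    by (auto simp: stage_incl_in_cx_body)
  with assms show ?thesis
    unfolding closedin_def openin_cx_body cx_open_def by (auto simp: topspace_cx_body[of A, symmetric] openin_diff)
qed

lemma closedin_cx_body_singleton:
  assumes A: "is_cellcx A" and w: "w \<in> body_pts A" "0 < first_stage w"
  shows "closedin (cx_body A) {w}"
proof -
  obtain n where n: "first_stage w = Suc n"
    using w(2) by (cases "first_stage w") auto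
  obtain x where x: "x \<in> pts (A (Suc n))" "w = stage_incl (Suc n) x"
    using in_stage_iff[OF cellcx_connected[OF A] w(1), of "Suc n"] n by auto
  have "x \<notin> range old"
    using first_stage_incl_Suc_less[of n x] x n by simp
  then have "closedin (sbd (A (Suc n))) {x}"
    using closedin_cell_pt[OF cellcx_stratum[OF A]] x(1) cellcx_stratum[OF A]
    by (simp add: cellcx_sbd_Suc[OF A] topspace_body)
  then have "closedin (cx_body A) (stage_incl (Suc n) ` {x})"
    using closed_map_stage_incl[OF A] unfolding closed_map_def by blast
  then show ?thesis
    by (simp add: x(2))
qed

text \<open>Otherwise \<open>K\<close> contains points \<open>w r\<close> that first occur at stage \<open>r\<close>, for infinitely many \<open>r > 0\<close>.
  Points that are not in the boundary are closed, whatever the boundary is like, and a stage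
  contains only finitely many of the \<open>w r\<close>, so that all sets of points \<open>w r\<close> are closed. An infinite set
  with this property has no limit point, which contradicts compactness.\<close>

lemma compactin_bounded_stage:
  assumes A: "is_cellcx A" and K: "compactin (cx_body A) K"
  shows "\<exists>n. \<forall>z \<in> K. first_stage z \<le> n"
proof (rule ccontr)
  assume unb: "\<nexists>n. \<forall>z \<in> K. first_stage z \<le> n"
  define R where "R = first_stage ` K - {0}"
  have "infinite R"
  proof
    assume "finite R"
    then obtain n where "\<forall>r \<in> R. r \<le> n"
      using finite_nat_set_iff_bounded_le by auto
    then have "\<forall>z \<in> K. first_stage z \<le> n"
      by (fastforce simp: R_def)
    with unb show False
      by blast
  qed
  define w where "w r = (SOME z. z \<in> K \<and> first_stage z = r)" for r
  have w: "w r \<in> K" "first_stage (w r) = r" if "r \<in> R" for r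
    using someI_ex[of "\<lambda>z. z \<in> K \<and> first_stage z = r"] that by (auto simp: w_def R_def)
  have KX: "K \<subseteq> body_pts A"
    using K by (rule compactin_subset_topspace)
  have closed: "closedin (cx_body A) (w ` T)" if T: "T \<subseteq> R" for T
  proof (rule closedin_cx_bodyI)
    show "w ` T \<subseteq> body_pts A"
      using w T KX by blast
    fix n
    have "r \<le> n" if "r \<in> T" "stage_incl n x = w r" for r x
      using w(2) T that first_stage_incl_le[of n x] by force
    then have "{x \<in> pts (A n). stage_incl n x \<in> w ` T} =
        {x \<in> pts (A n). stage_incl n x \<in> w ` {r \<in> T. r \<le> n}}"
      by (auto simp: image_iff)
    moreover have "closedin (cx_body A) {w r}" if "r \<in> T" for r
    proof -
      have "r \<in> R" "0 < r"
        using T that by (auto simp: R_def)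
      then show ?thesis
        using w[of r] KX by (intro closedin_cx_body_singleton[OF A]) auto
    qed
    then have "closedin (cx_body A) (\<Union>r \<in> {r \<in> T. r \<le> n}. {w r})"
      by (intro closedin_Union) auto
    then have "closedin (cx_body A) (w ` {r \<in> T. r \<le> n})"
      by (simp add: UNION_singleton_eq_range)
    ultimately show "closedin (sbd (A n)) {x \<in> pts (A n). stage_incl n x \<in> w ` T}"
      by (simp add: closedin_continuous_map_preimage[OF cx_body_colimit(1)[OF A]])
  qed
  have "inj_on w R"
    by (rule inj_onI) (metis w(2))
  with \<open>infinite R\<close> have "infinite (w ` R)"
    by (simp add: finite_image_iff)
  moreover have "w ` R \<subseteq> K"
    using w by blast
  ultimately obtain z where z: "z \<in> cx_body A derived_set_of (w ` R)"
    using compactin_imp_Bolzano_Weierstrass[OF K] by blast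
  have "w ` R - {z} = w ` {r \<in> R. w r \<noteq> z}"
    by auto
  then have "closedin (cx_body A) (w ` R - {z})"
    using closed by simp
  then have "openin (cx_body A) (body_pts A - (w ` R - {z}))"
    by blast
  moreover have "z \<in> body_pts A - (w ` R - {z})"
    using z by (simp add: derived_set_of_def)
  ultimately obtain y where "y \<noteq> z" "y \<in> w ` R" "y \<in> body_pts A - (w ` R - {z})"
    using z unfolding in_derived_set_of by metis
  then show False
    by blast
qed


section \<open>Maps out of bodies and morphisms of cell complexes\<close>

lemma body_induced_old [simp]: "body_induced g h (old x) = g x"
  by (simp add: body_induced_def)

lemma body_induced_cell [simp]: "body_induced g h (enc (Cell_pt s d)) = h s d"
  by (simp add: body_induced_def)

lemma body_induced_char_map:
  assumes "d \<in> bdry \<sigma> s \<Longrightarrow> g (att \<sigma> s d) = h s d"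
  shows "body_induced g h (char_map \<sigma> s d) = h s d"
  using assms by (simp add: char_map_def)

lemma continuous_map_bodyI:
  assumes \<sigma>: "is_stratum \<sigma>"
    and b: "continuous_map (sbd \<sigma>) Z (\<lambda>x. k (old x))"
    and c: "\<And>s. s \<in> cells \<sigma> \<Longrightarrow> continuous_map (disc (cdim \<sigma> s)) Z (\<lambda>d. k (char_map \<sigma> s d))"
  shows "continuous_map (body \<sigma>) Z k"
proof -
  note p = body_pushout[OF \<sigma>]
  have i: "continuous_map (body \<sigma>) Z (body_induced (\<lambda>x. k (old x)) (\<lambda>s d. k (char_map \<sigma> s d)))" (is "continuous_map _ _ ?i")
    using p(4)[OF b c] p(3) by force
  have "?i z = k z" if "z \<in> topspace (body \<sigma>)" for z
    by (rule p(5)[OF _ _ that]) (simp_all add: body_induced_char_map p(3))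
  with i show ?thesis
    by (rule continuous_map_eq)
qed

lemma body_map_old: "is_stratum \<sigma> \<Longrightarrow> x \<in> pts \<sigma> \<Longrightarrow> body_map \<sigma> f p (old x) = old (f x)"
  by (simp add: body_map_def old_in_body_iff)

lemma body_map_cell_pt:
  assumes "is_stratum \<sigma>" "s \<in> cells \<sigma>" "d \<in> disc_of \<sigma> s" "d \<notin> bdry \<sigma> s"
  shows "body_map \<sigma> f p (enc (Cell_pt s d)) = enc (Cell_pt (p s) d)"
  using assms by (auto simp: body_map_def topspace_body body_points_def)

lemma body_map_char_map:
  assumes \<sigma>: "is_stratum \<sigma>" "s \<in> cells \<sigma>" "d \<in> disc_of \<sigma> s" and f: "stratum_mor \<sigma> \<tau> f p"
  shows "body_map \<sigma> f p (char_map \<sigma> s d) = char_map \<tau> (p s) d"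
proof (cases "d \<in> bdry \<sigma> s")
  case True
  then show ?thesis
    using assms by (simp add: char_map_def body_map_old att_in_sbd stratum_mor_def)
next
  case False
  then show ?thesis
    using assms by (simp add: char_map_def body_map_cell_pt stratum_mor_def)
qed

lemma body_map_in_range_old:
  assumes \<sigma>: "is_stratum \<sigma>" and x: "x \<in> topspace (body \<sigma>)" 
  shows "body_map \<sigma> f p x \<in> range old \<longleftrightarrow> x \<in> range old"
  using \<sigma> x by (cases rule: body_cases) (simp_all add: body_map_old[OF \<sigma>] body_map_cell_pt[OF \<sigma>])

lemma body_map_extensional: "body_map \<sigma> f p \<in> extensional (topspace (body \<sigma>))"
  by (simp add: body_map_def)

lemma continuous_map_body_map:
  assumes \<sigma>: "is_stratum \<sigma>" and \<tau>: "is_stratum \<tau>" and f: "stratum_mor \<sigma> \<tau> f p"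
  shows "continuous_map (body \<sigma>) (body \<tau>) (body_map \<sigma> f p)"
proof (rule continuous_map_bodyI[OF \<sigma>])
  have "continuous_map (sbd \<sigma>) (body \<tau>) (old \<circ> f)"
    using f body_pushout(1)[OF \<tau>] by (auto simp: stratum_mor_def intro: continuous_map_compose)
  then show "continuous_map (sbd \<sigma>) (body \<tau>) (\<lambda>x. body_map \<sigma> f p (old x))"
    by (rule continuous_map_eq) (simp add: body_map_old[OF \<sigma>])
next
  fix s assume s: "s \<in> cells \<sigma>"
  have "continuous_map (disc (cdim \<tau> (p s))) (body \<tau>) (char_map \<tau> (p s))"
    using f s by (intro body_pushout(2)[OF \<tau>]) (auto simp: stratum_mor_def)
  then have "continuous_map (disc (cdim \<sigma> s)) (body \<tau>) (char_map \<tau> (p s))"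
    using f s by (simp add: stratum_mor_def)
  then show "continuous_map (disc (cdim \<sigma> s)) (body \<tau>) (\<lambda>d. body_map \<sigma> f p (char_map \<sigma> s d))"
    by (rule continuous_map_eq) (simp add: body_map_char_map[OF \<sigma> s _ f])
qed

lemma stratum_mor_compose:
  assumes "is_stratum \<sigma>" "stratum_mor \<sigma> \<tau> f p" "stratum_mor \<tau> \<rho> g q"
  shows "stratum_mor \<sigma> \<rho> (compose (pts \<sigma>) g f) (compose (cells \<sigma>) q p)"
proof -
  have "continuous_map (sbd \<sigma>) (sbd \<rho>) (g \<circ> f)"
    using assms by (auto simp: stratum_mor_def intro: continuous_map_compose)
  then have "continuous_map (sbd \<sigma>) (sbd \<rho>) (compose (pts \<sigma>) g f)"
    by (rule continuous_map_eq) (simp add: compose_def)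
  moreover have "p s \<in> cells \<tau>" "cdim \<tau> (p s) = cdim \<sigma> s"
      "\<And>x. x \<in> bdry \<sigma> s \<Longrightarrow> f (att \<sigma> s x) = att \<tau> (p s) x"
    if "s \<in> cells \<sigma>" for s
    using assms(2) that by (auto simp: stratum_mor_def)
  moreover have "q s \<in> cells \<rho>" "cdim \<rho> (q s) = cdim \<tau> s"
      "\<And>x. x \<in> bdry \<tau> s \<Longrightarrow> g (att \<tau> s x) = att \<rho> (q s) x"
    if "s \<in> cells \<tau>" for s
    using assms(3) that by (auto simp: stratum_mor_def)
  ultimately show ?thesis
    using assms(1) unfolding stratum_mor_def
    by (simp add: compose_eq att_in_sbd compose_extensional PiE_def Pi_def)
qed

lemma body_map_compose:
  assumes \<sigma>: "is_stratum \<sigma>" and \<tau>: "is_stratum \<tau>" and f: "stratum_mor \<sigma> \<tau> f p"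
  shows "body_map \<sigma> (compose (pts \<sigma>) g f) (compose (cells \<sigma>) q p) =
    compose (topspace (body \<sigma>)) (body_map \<tau> g q) (body_map \<sigma> f p)"
proof (rule extensionalityI[OF body_map_extensional compose_extensional])
  fix z assume z: "z \<in> topspace (body \<sigma>)"
  have p: "p s \<in> cells \<tau>" "cdim \<tau> (p s) = cdim \<sigma> s" if "s \<in> cells \<sigma>" for s
    using f that by (auto simp: stratum_mor_def)
  have fX: "f x \<in> pts \<tau>" if "x \<in> pts \<sigma>" for x
    using f that by (auto simp: stratum_mor_def continuous_map_def)
  from \<sigma> z show "body_map \<sigma> (compose (pts \<sigma>) g f) (compose (cells \<sigma>) q p) z =
      compose (topspace (body \<sigma>)) (body_map \<tau> g q) (body_map \<sigma> f p) z"
  proof (cases rule: body_cases)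
    case (old x)
    then show ?thesis
      using z by (simp add: compose_eq body_map_old \<sigma> \<tau> fX)
  next
    case (cell s d)
    then show ?thesis
      using z by (simp add: compose_eq body_map_cell_pt \<sigma> \<tau> p)
  qed
qed

lemma cellmor_mor: "is_cellmor \<phi> \<Longrightarrow> stratum_mor (cm_src \<phi> n) (cm_tgt \<phi> n) (cm_map \<phi> n) (cm_cells \<phi> n)"
  by (simp add: is_cellmor_def)

lemma cellmor_src: "is_cellmor \<phi> \<Longrightarrow> is_cellcx (cm_src \<phi>)"
  by (simp add: is_cellmor_def)

lemma cellmor_tgt: "is_cellmor \<phi> \<Longrightarrow> is_cellcx (cm_tgt \<phi>)"
  by (simp add: is_cellmor_def)

lemma cellmor_Suc: "is_cellmor \<phi> \<Longrightarrow> cm_map \<phi> (Suc n) = body_map (cm_src \<phi> n) (cm_map \<phi> n) (cm_cells \<phi> n)"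
  by (simp add: is_cellmor_def)

lemma cellmor_map: "is_cellmor \<phi> \<Longrightarrow> continuous_map (sbd (cm_src \<phi> n)) (sbd (cm_tgt \<phi> n)) (cm_map \<phi> n)"
  using cellmor_mor by (auto simp: stratum_mor_def)

lemma cellmor_map_in: "is_cellmor \<phi> \<Longrightarrow> x \<in> pts (cm_src \<phi> n) \<Longrightarrow> cm_map \<phi> n x \<in> pts (cm_tgt \<phi> n)"
  using cellmor_map by (fastforce simp: continuous_map_def)

lemma cellmor_cells:
  assumes "is_cellmor \<phi>" "s \<in> cells (cm_src \<phi> n)"
  shows "cm_cells \<phi> n s \<in> cells (cm_tgt \<phi> n)" "cdim (cm_tgt \<phi> n) (cm_cells \<phi> n s) = cdim (cm_src \<phi> n) s"
    and "x \<in> bdry (cm_src \<phi> n) s \<Longrightarrow>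
      cm_map \<phi> n (att (cm_src \<phi> n) s x) = att (cm_tgt \<phi> n) (cm_cells \<phi> n s) x"
  using cellmor_mor[OF assms(1), of n] assms(2) by (auto simp: stratum_mor_def)

lemma cellmor_eqI:
  assumes "is_cellmor \<phi>" "is_cellmor \<psi>" "cm_src \<phi> = cm_src \<psi>" "cm_tgt \<phi> = cm_tgt \<psi>"
    and "cm_map \<phi> 0 = cm_map \<psi> 0"
    and cells: "\<And>n s. cm_map \<phi> n = cm_map \<psi> n \<Longrightarrow> s \<in> cells (cm_src \<psi> n) \<Longrightarrow> cm_cells \<phi> n s = cm_cells \<psi> n s"
  shows "\<phi> = \<psi>"
proof -
  have c: "cm_cells \<phi> n = cm_cells \<psi> n" if "cm_map \<phi> n = cm_map \<psi> n" for n
  proof (rule extensionalityI)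
    show "cm_cells \<phi> n \<in> extensional (cells (cm_src \<psi> n))" "cm_cells \<psi> n \<in> extensional (cells (cm_src \<psi> n))"
      using cellmor_mor[OF assms(1), of n] cellmor_mor[OF assms(2), of n] assms(3)
      by (auto simp: stratum_mor_def PiE_def)
  qed (use that cells in blast)
  have m: "cm_map \<phi> n = cm_map \<psi> n" for n
    by (induction n) (use assms c in \<open>simp_all add: cellmor_Suc\<close>)
  have "cm_map \<phi> = cm_map \<psi>" "cm_cells \<phi> = cm_cells \<psi>"
    using m c by blast+
  with assms show ?thesis
    by (simp add: cellmor.expand)
qed

lemma cx_map_aux:
  assumes \<phi>: "is_cellmor \<phi>"
  shows "continuous_map (cx_body (cm_src \<phi>)) (cx_body (cm_tgt \<phi>)) (cx_induced (\<lambda>n x. stage_incl n (cm_map \<phi> n x))) \<and>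
    (\<forall>n. \<forall>x \<in> pts (cm_src \<phi> n).
      cx_induced (\<lambda>n x. stage_incl n (cm_map \<phi> n x)) (stage_incl n x) = stage_incl n (cm_map \<phi> n x))"
proof (rule cx_body_colimit(3)[OF cellmor_src[OF \<phi>]])
  fix n
  show "continuous_map (sbd (cm_src \<phi> n)) (cx_body (cm_tgt \<phi>)) (\<lambda>x. stage_incl n (cm_map \<phi> n x))"
    using cellmor_map[OF \<phi>] cx_body_colimit(1)[OF cellmor_tgt[OF \<phi>]] by (rule continuous_map_composeI) simp
qed (simp add: cellmor_Suc[OF \<phi>] body_map_old cellcx_stratum cellmor_src[OF \<phi>])

lemma continuous_map_cx_map:
  "is_cellmor \<phi> \<Longrightarrow> continuous_map (cx_body (cm_src \<phi>)) (cx_body (cm_tgt \<phi>)) (cx_map \<phi>)"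
  by (rule continuous_map_eq[OF conjunct1[OF cx_map_aux]]) (simp_all add: cx_map_def)

lemma cx_map_stage_incl:
  "is_cellmor \<phi> \<Longrightarrow> x \<in> pts (cm_src \<phi> n) \<Longrightarrow> cx_map \<phi> (stage_incl n x) = stage_incl n (cm_map \<phi> n x)"
  using cx_map_aux[of \<phi>] by (simp add: cx_map_def stage_incl_in_cx_body)

lemma cx_map_cx_char:
  assumes \<phi>: "is_cellmor \<phi>" and s: "s \<in> cells (cm_src \<phi> n)" "d \<in> disc_of (cm_src \<phi> n) s"
  shows "cx_map \<phi> (cx_char (cm_src \<phi>) n s d) = cx_char (cm_tgt \<phi>) n (cm_cells \<phi> n s) d"
proof -
  note A = cellmor_src[OF \<phi>]
  have "char_map (cm_src \<phi> n) s d \<in> pts (cm_src \<phi> (Suc n))"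
    using s by (simp add: cellcx_sbd_Suc[OF A] char_map_in_body cellcx_stratum[OF A])
  then show ?thesis
    using s by (simp add: cx_char_def cx_map_stage_incl[OF \<phi>] cellmor_Suc[OF \<phi>]
        body_map_char_map[OF cellcx_stratum[OF A] s cellmor_mor[OF \<phi>]])
qed

lemma cx_map_extensional: "cx_map \<phi> \<in> extensional (body_pts (cm_src \<phi>))"
  by (simp add: cx_map_def)

lemma hom_CELLCX: "\<phi> \<in> hom CELLCX A B \<longleftrightarrow> is_cellmor \<phi> \<and> cm_src \<phi> = A \<and> cm_tgt \<phi> = B"
  by (auto simp: hom_def CELLCX_def)

lemma Cmp_CELLCX_sel [simp]:
  "cm_src (Cmp CELLCX \<psi> \<phi>) = cm_src \<phi>"
  "cm_tgt (Cmp CELLCX \<psi> \<phi>) = cm_tgt \<psi>"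
  "cm_map (Cmp CELLCX \<psi> \<phi>) n = compose (pts (cm_src \<phi> n)) (cm_map \<psi> n) (cm_map \<phi> n)"
  "cm_cells (Cmp CELLCX \<psi> \<phi>) n = compose (cells (cm_src \<phi> n)) (cm_cells \<psi> n) (cm_cells \<phi> n)"
  by (simp_all add: CELLCX_def)

lemma cellmor_Cmp:
  assumes \<phi>: "is_cellmor \<phi>" and \<psi>: "is_cellmor \<psi>" and e: "cm_tgt \<phi> = cm_src \<psi>"
  shows "is_cellmor (Cmp CELLCX \<psi> \<phi>)"
proof -
  have m: "is_stratum (cm_src \<phi> n)" "is_stratum (cm_src \<psi> n)"
      "stratum_mor (cm_src \<phi> n) (cm_src \<psi> n) (cm_map \<phi> n) (cm_cells \<phi> n)" for n
    using \<phi> \<psi> cellmor_mor[OF \<phi>] by (simp_all add: cellcx_stratum cellmor_src e)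
  have "stratum_mor (cm_src \<phi> n) (cm_tgt \<psi> n) (compose (pts (cm_src \<phi> n)) (cm_map \<psi> n) (cm_map \<phi> n))
      (compose (cells (cm_src \<phi> n)) (cm_cells \<psi> n) (cm_cells \<phi> n))" for n
    by (rule stratum_mor_compose[OF m(1) m(3) cellmor_mor[OF \<psi>]])
  moreover have "compose (topspace (body (cm_src \<phi> n))) (body_map (cm_src \<psi> n) (cm_map \<psi> n) (cm_cells \<psi> n))
        (body_map (cm_src \<phi> n) (cm_map \<phi> n) (cm_cells \<phi> n)) =
      body_map (cm_src \<phi> n) (compose (pts (cm_src \<phi> n)) (cm_map \<psi> n) (cm_map \<phi> n))
        (compose (cells (cm_src \<phi> n)) (cm_cells \<psi> n) (cm_cells \<phi> n))" for n
    by (rule body_map_compose[OF m(1) m(2) m(3), symmetric])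
  ultimately show ?thesis
    using \<phi> \<psi> by (simp add: is_cellmor_def[of "Cmp CELLCX \<psi> \<phi>"] cellmor_src cellmor_tgt cellmor_Suc e cellcx_sbd_Suc)
qed

lemma cx_map_Cmp:
  assumes \<phi>: "is_cellmor \<phi>" and \<psi>: "is_cellmor \<psi>" and e: "cm_tgt \<phi> = cm_src \<psi>"
    and z: "z \<in> body_pts (cm_src \<phi>)"
  shows "cx_map (Cmp CELLCX \<psi> \<phi>) z = cx_map \<psi> (cx_map \<phi> z)"
proof (rule cx_body_colimit(4)[OF cellmor_src[OF \<phi>] _ z])
  fix n x assume x: "x \<in> pts (cm_src \<phi> n)"
  then have "cm_map \<phi> n x \<in> pts (cm_src \<psi> n)"
    using cellmor_map_in[OF \<phi>] by (simp add: e)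
  with x show "cx_map (Cmp CELLCX \<psi> \<phi>) (stage_incl n x) = cx_map \<psi> (cx_map \<phi> (stage_incl n x))"
    using cx_map_stage_incl[OF cellmor_Cmp[OF \<phi> \<psi> e], of x n]
    by (simp add: cx_map_stage_incl \<phi> \<psi> compose_eq)
qed


section \<open>The cell complex \<open>K f\<close>\<close>

abbreviation K_map :: "'u::universe cmap \<Rightarrow> nat \<Rightarrow> 'u \<Rightarrow> 'u" where
  "K_map f n \<equiv> snd (K_rec f n)"

lemma Mor_TOP: "f \<in> Mor TOP \<longleftrightarrow> continuous_map (cdom f) (ccod f) (cfun f) \<and> cfun f \<in> extensional (topspace (cdom f))"
  by (cases f) (auto simp: TOP_def)

lemma K_ob_0: "K_ob f 0 = K_stratum (\<lambda>d u. False) (cdom f) (cfun f) (ccod f)"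
  by (simp add: K_ob_def)

lemma K_ob_Suc:
  "K_ob f (Suc n) = K_stratum (factors_through old (sbd (K_ob f n))) (body (K_ob f n)) (K_map f (Suc n)) (ccod f)"
  by (simp add: K_ob_def split_beta Let_def)

lemma K_map_0: "K_map f 0 = cfun f"
  by simp

lemma K_map_Suc:
  "K_map f (Suc n) = body_induced (K_map f n) (\<lambda>s. case dec s of Square_cell d u v \<Rightarrow> v)"
  by (simp add: split_beta Let_def)

lemmas [simp del] = K_rec.simps

lemma sbd_K_stratum [simp]: "sbd (K_stratum P X e B) = X"
  and cells_K_stratum [simp]: "cells (K_stratum P X e B) = K_cells P X e B"
  by (simp_all add: K_stratum_def)

lemma K_stratum_cell:
  assumes "enc (Square_cell d u v) \<in> K_cells P X e B"
  shows "cdim (K_stratum P X e B) (enc (Square_cell d u v)) = d" "att (K_stratum P X e B) (enc (Square_cell d u v)) = u"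
  using assms by (simp_all add: K_stratum_def)

lemma is_stratum_K_stratum: "is_stratum (K_stratum P X e B)"
  by (auto simp: is_stratum_def K_stratum_def K_cells_def)

lemma is_stratum_K_ob: "is_stratum (K_ob f n)"
  by (cases n) (simp_all add: K_ob_0 K_ob_Suc is_stratum_K_stratum)

lemma sbd_K_ob_0 [simp]: "sbd (K_ob f 0) = cdom f"
  by (simp add: K_ob_0)

lemma sbd_K_ob_Suc: "sbd (K_ob f (Suc n)) = body (K_ob f n)"
  by (simp add: K_ob_Suc)

text \<open>The condition of not factoring through the previous stage becomes one on points, because that
  stage is closed.\<close>

lemma cells_K_ob_iff:
  "s \<in> cells (K_ob f n) \<longleftrightarrow> (\<exists>d u v. s = enc (Square_cell d u v) \<and>
     continuous_map (bsphere d) (sbd (K_ob f n)) u \<and> u \<in> extensional (topspace (bsphere d)) \<and>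
     continuous_map (disc d) (ccod f) v \<and> v \<in> extensional (topspace (disc d)) \<and>
     (\<forall>x \<in> topspace (bsphere d). K_map f n (u x) = v x) \<and>
     (n = 0 \<or> (\<exists>x \<in> topspace (bsphere d). u x \<notin> range old)))"
proof (cases n)
  case 0
  then show ?thesis
    by (auto simp: K_ob_0 K_cells_def K_map_0)
next
  case (Suc m)
  note st = is_stratum_K_ob[of f m]
  have new: "\<not> factors_through old (sbd (K_ob f m)) d u \<longleftrightarrow> (\<exists>x \<in> topspace (bsphere d). u x \<notin> range old)"
    if u: "continuous_map (bsphere d) (body (K_ob f m)) u" for d u
  proof -
    have "u x \<in> old ` pts (K_ob f m) \<longleftrightarrow> u x \<in> range old" if "x \<in> topspace (bsphere d)" for x
    proof -
      have "u x \<in> topspace (body (K_ob f m))"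
        using u that by (auto simp: continuous_map_def)
      then show ?thesis
        using old_in_body_iff[OF st] by auto
    qed
    then show ?thesis
      using factors_through_closed_inj_iff[OF closed_map_old[OF st] inj_old u] by blast
  qed
  show ?thesis
    unfolding Suc K_ob_Suc cells_K_stratum sbd_K_stratum K_cells_def by (simp add: new cong: conj_cong)
qed

lemma K_ob_cell:
  assumes "enc (Square_cell d u v) \<in> cells (K_ob f n)"
  shows "cdim (K_ob f n) (enc (Square_cell d u v)) = d" "att (K_ob f n) (enc (Square_cell d u v)) = u"
  using assms by (cases n; simp add: K_ob_0 K_ob_Suc K_stratum_cell)+

lemma is_cellcx_K_ob: "is_cellcx (K_ob f)"
proof -
  have "\<exists>x \<in> bdry (K_ob f (Suc n)) s. att (K_ob f (Suc n)) s x \<notin> range old"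
    if s: "s \<in> cells (K_ob f (Suc n))" for n s
  proof -
    obtain d u v where "s = enc (Square_cell d u v)" "\<exists>x \<in> topspace (bsphere d). u x \<notin> range old"
      using s unfolding cells_K_ob_iff by blast
    with s show ?thesis
      by (simp add: K_ob_cell)
  qed
  then show ?thesis
    by (simp add: is_cellcx_iff connected_strata_def is_stratum_K_ob sbd_K_ob_Suc)
qed

lemma K_map_old: "K_map f (Suc n) (old x) = K_map f n x"
  by (simp add: K_map_Suc)

lemma K_map_char_map:
  assumes "enc (Square_cell d u v) \<in> cells (K_ob f n)"
  shows "K_map f (Suc n) (char_map (K_ob f n) (enc (Square_cell d u v)) x) = v x"
proof -
  have "\<forall>x \<in> topspace (bsphere d). K_map f n (u x) = v x"
    using assms unfolding cells_K_ob_iff by auto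
  then show ?thesis
    using assms by (simp add: K_map_Suc char_map_def K_ob_cell)
qed

lemma continuous_map_K_map:
  assumes f: "f \<in> Mor TOP"
  shows "continuous_map (sbd (K_ob f n)) (ccod f) (K_map f n)"
proof (induction n)
  case (Suc n)
  show ?case
    unfolding sbd_K_ob_Suc
  proof (rule continuous_map_bodyI[OF is_stratum_K_ob])
    fix s assume s: "s \<in> cells (K_ob f n)"
    then obtain d u v where "s = enc (Square_cell d u v)" "continuous_map (disc d) (ccod f) v"
      unfolding cells_K_ob_iff by blast
    with s show "continuous_map (disc (cdim (K_ob f n) s)) (ccod f) (\<lambda>d. K_map f (Suc n) (char_map (K_ob f n) s d))"
      by (simp add: K_ob_cell K_map_char_map eta_contract_eq)
  qed (simp add: K_map_old Suc)
qed (use f in \<open>simp add: Mor_TOP K_map_0\<close>)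

lemma E_ob_sel [simp]: "cdom (E_ob f) = cx_body (K_ob f)" "ccod (E_ob f) = ccod f"
  by (simp_all add: E_ob_def)

lemma E_ob_aux:
  assumes f: "f \<in> Mor TOP"
  shows "continuous_map (cx_body (K_ob f)) (ccod f) (cx_induced (K_map f)) \<and>
    (\<forall>n. \<forall>x \<in> pts (K_ob f n). cx_induced (K_map f) (stage_incl n x) = K_map f n x)"
  by (rule cx_body_colimit(3)[OF is_cellcx_K_ob]) (simp_all add: continuous_map_K_map[OF f] K_map_old)

lemma E_ob_Mor: "f \<in> Mor TOP \<Longrightarrow> E_ob f \<in> Mor TOP"
  unfolding Mor_TOP[of "E_ob f"] E_ob_sel
  by (intro conjI continuous_map_eq[OF conjunct1[OF E_ob_aux]]) (simp_all add: E_ob_def)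

lemma E_ob_stage_incl:
  "f \<in> Mor TOP \<Longrightarrow> x \<in> pts (K_ob f n) \<Longrightarrow> cfun (E_ob f) (stage_incl n x) = K_map f n x"
  using E_ob_aux[of f] by (simp add: E_ob_def stage_incl_in_cx_body)

lemma E_ob_cx_char:
  assumes f: "f \<in> Mor TOP" and s: "enc (Square_cell d u v) \<in> cells (K_ob f n)" and x: "x \<in> topspace (disc d)"
  shows "cfun (E_ob f) (cx_char (K_ob f) n (enc (Square_cell d u v)) x) = v x"
proof -
  have "char_map (K_ob f n) (enc (Square_cell d u v)) x \<in> pts (K_ob f (Suc n))"
    using s x by (simp add: sbd_K_ob_Suc char_map_in_body is_stratum_K_ob K_ob_cell)
  then show ?thesis
    using s by (simp add: cx_char_def E_ob_stage_incl[OF f] K_map_char_map)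
qed

text \<open>By properness, the stratum of a cell is the latest stage at which a point of its boundary first
  occurs (\<open>0\<close> if it has none), so it can be read off from the attaching map into the body. Within a stratum, a cell is a
  square, of which the attaching map is the upper half and the composite of the characteristic map with
  \<open>E f\<close> the lower half.\<close>

lemma K_ob_cell_eqI:
  assumes f: "f \<in> Mor TOP" and s: "s \<in> cells (K_ob f m)" and t: "t \<in> cells (K_ob f n)"
    and dim: "cdim (K_ob f m) s = d" "cdim (K_ob f n) t = d"
    and bd: "\<And>x. x \<in> topspace (bsphere d) \<Longrightarrow> cx_char (K_ob f) m s x = cx_char (K_ob f) n t x"
    and int: "\<And>x. x \<in> topspace (disc d) \<Longrightarrow>
      cfun (E_ob f) (cx_char (K_ob f) m s x) = cfun (E_ob f) (cx_char (K_ob f) n t x)"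
  shows "m = n \<and> s = t"
proof
  have eq: "stage_incl m (att (K_ob f m) s x) = stage_incl n (att (K_ob f n) t x)" if "x \<in> topspace (bsphere d)" for x
    using bd[OF that] that dim by (simp add: cx_char_bsphere)
  have "m \<le> n" using is_cellcx_K_ob s
  proof (cases rule: cellcx_proper)
    case (2 x)
    then show ?thesis
      using eq[of x] first_stage_incl_le[of n] dim by metis
  qed simp
  moreover have "n \<le> m" using is_cellcx_K_ob t
  proof (cases rule: cellcx_proper)
    case (2 x)
    then show ?thesis
      using eq[of x] first_stage_incl_le[of m] dim by metis
  qed simp
  ultimately show mn: "m = n"
    by simp
  obtain d1 u v where s': "s = enc (Square_cell d1 u v)"
      "u \<in> extensional (topspace (bsphere d1))" "v \<in> extensional (topspace (disc d1))"
    using s unfolding cells_K_ob_iff by blast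
  obtain d2 u' v' where t': "t = enc (Square_cell d2 u' v')"
      "u' \<in> extensional (topspace (bsphere d2))" "v' \<in> extensional (topspace (disc d2))"
    using t unfolding cells_K_ob_iff by blast
  note at = K_ob_cell[OF s[unfolded s'(1)]] K_ob_cell[OF t[unfolded t'(1)]]
  have [simp]: "d1 = d" "d2 = d"
    using dim s' t' at by simp_all
  have "u = u'"
    using eq s' t' at mn by (intro extensionalityI[where A = "topspace (bsphere d)"]) simp_all
  moreover have "v = v'"
    using int s' t' E_ob_cx_char[OF f s[unfolded s'(1)]] E_ob_cx_char[OF f t[unfolded t'(1)]]
    by (intro extensionalityI[where A = "topspace (disc d)"]) simp_all
  ultimately show "s = t"
    by (simp add: s' t')
qed


section \<open>Transposes\<close>

lemma U_ob_sel [simp]: "cdom (U_ob A) = sbd (A 0)" "ccod (U_ob A) = cx_body A"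
  "cfun (U_ob A) = restrict (stage_incl 0) (pts (A 0))"
  by (simp_all add: U_ob_def)

lemma U_ob_Mor: "is_cellcx A \<Longrightarrow> U_ob A \<in> Mor TOP"
  unfolding Mor_TOP U_ob_sel by (intro conjI continuous_map_eq[OF cx_body_colimit(1)]) simp_all

text \<open>The stages of the morphism \<open>A \<rightarrow> K f\<close> corresponding to a square \<open>(a, b) : U A \<rightarrow> f\<close>. Knowing the map
  \<open>c\<close> on stage \<open>n\<close>, a cell of \<open>A\<close> is sent to the square formed by its attaching map, followed by \<open>c\<close>,
  and its characteristic map, followed by \<open>b\<close>.\<close>

definition lift_cell :: "'u::universe cellcx \<Rightarrow> ('u \<Rightarrow> 'u) \<Rightarrow> nat \<Rightarrow> ('u \<Rightarrow> 'u) \<Rightarrow> 'u \<Rightarrow> 'u" where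
  "lift_cell A b n c = (\<lambda>s\<in>cells (A n). enc (Square_cell (cdim (A n) s)
     (\<lambda>x\<in>bdry (A n) s. c (att (A n) s x))
     (\<lambda>x\<in>disc_of (A n) s. b (cx_char A n s x))))"

primrec lift_map :: "'u::universe cellcx \<Rightarrow> ('u \<Rightarrow> 'u) \<Rightarrow> ('u \<Rightarrow> 'u) \<Rightarrow> nat \<Rightarrow> 'u \<Rightarrow> 'u" where
  "lift_map A a b 0 = a"
| "lift_map A a b (Suc n) = body_map (A n) (lift_map A a b n) (lift_cell A b n (lift_map A a b n))"

definition lift :: "'u::universe cellcx \<Rightarrow> 'u cmap \<Rightarrow> ('u \<Rightarrow> 'u) \<Rightarrow> ('u \<Rightarrow> 'u) \<Rightarrow> 'u cellmor" where
  "lift A f a b = Cellmor A (lift_map A a b) (\<lambda>n. lift_cell A b n (lift_map A a b n)) (K_ob f)"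

locale square_from_U =
  fixes A :: "'u::universe cellcx" and f :: "'u cmap" and a b :: "'u \<Rightarrow> 'u"
  assumes A: "is_cellcx A" and f: "f \<in> Mor TOP"
    and a: "continuous_map (sbd (A 0)) (cdom f) a" "a \<in> extensional (pts (A 0))"
    and b: "continuous_map (cx_body A) (ccod f) b"
    and commutes: "\<And>x. x \<in> pts (A 0) \<Longrightarrow> cfun f (a x) = b (stage_incl 0 x)"
begin

abbreviation "c \<equiv> lift_map A a b"

abbreviation "p \<equiv> \<lambda>n. lift_cell A b n (c n)"

lemma stratum_mor_lift:
  assumes cont: "continuous_map (sbd (A n)) (sbd (K_ob f n)) (c n)" "c n \<in> extensional (pts (A n))"
    and proj: "\<And>x. x \<in> pts (A n) \<Longrightarrow> K_map f n (c n x) = b (stage_incl n x)"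
    and new: "\<And>x. 0 < n \<Longrightarrow> x \<in> pts (A n) \<Longrightarrow> c n x \<in> range old \<Longrightarrow> x \<in> range old"
  shows "stratum_mor (A n) (K_ob f n) (c n) (p n)"
proof -
  note st = cellcx_stratum[OF A, of n]
  have cell: "p n s \<in> cells (K_ob f n) \<and> cdim (K_ob f n) (p n s) = cdim (A n) s \<and>
      (\<forall>x \<in> bdry (A n) s. c n (att (A n) s x) = att (K_ob f n) (p n s) x)"
    if s: "s \<in> cells (A n)" for s
  proof -
    let ?d = "cdim (A n) s"
    define u where "u = (\<lambda>x\<in>topspace (bsphere ?d). c n (att (A n) s x))"
    define v where "v = (\<lambda>x\<in>topspace (disc ?d). b (cx_char A n s x))"
    have ps: "p n s = enc (Square_cell ?d u v)"
      using s by (simp add: lift_cell_def u_def v_def)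
    have u: "continuous_map (bsphere ?d) (sbd (K_ob f n)) u"
      using continuous_map_att[OF st s] cont(1) by (rule continuous_map_composeI) (simp add: u_def)
    have v: "continuous_map (disc ?d) (ccod f) v"
      using continuous_map_cx_char[OF A s] b by (rule continuous_map_composeI) (simp add: v_def)
    have uv: "K_map f n (u x) = v x" if x: "x \<in> topspace (bsphere ?d)" for x
      using x bsphere_subset_disc[of ?d] by (auto simp: u_def v_def proj att_in_sbd[OF st s] cx_char_bsphere)
    \<comment> \<open>As \<open>A\<close> is proper, the attaching map meets a point that is new at stage \<open>n\<close>, and \<open>c n\<close> keeps it new.\<close>
    have "n = 0 \<or> (\<exists>x \<in> topspace (bsphere ?d). u x \<notin> range old)" using A s
    proof (cases rule: cellcx_proper)
      case (2 x)
      show ?thesis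
      proof (cases n)
        case (Suc m)
        then have "att (A n) s x \<notin> range old"
          using 2 first_stage_incl_Suc_less[of m "att (A n) s x"] by auto
        then have "u x \<notin> range old"
          using new[of "att (A n) s x"] 2 Suc att_in_sbd[OF st s, of x] by (auto simp: u_def)
        with 2 show ?thesis
          by blast
      qed simp
    qed simp
    with u v uv have "p n s \<in> cells (K_ob f n)"
      unfolding ps cells_K_ob_iff by (auto simp: u_def v_def)
    then show ?thesis
      using K_ob_cell[of ?d u v f n] by (auto simp: ps u_def)
  qed
  then show ?thesis
    using cont by (auto simp: stratum_mor_def lift_cell_def)
qed

lemma lift_stage:
  "continuous_map (sbd (A n)) (sbd (K_ob f n)) (c n) \<and> c n \<in> extensional (pts (A n)) \<and>
   (\<forall>x \<in> pts (A n). K_map f n (c n x) = b (stage_incl n x) \<and>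
     (0 < n \<longrightarrow> c n x \<in> range old \<longrightarrow> x \<in> range old))"
proof (induction n)
  case 0
  then show ?case
    using a commutes by (simp add: K_map_0)
next
  case (Suc n)
  note st = cellcx_stratum[OF A, of n]
  have m: "stratum_mor (A n) (K_ob f n) (c n) (p n)"
    by (rule stratum_mor_lift) (use Suc in auto)
  have "K_map f (Suc n) (c (Suc n) z) = b (stage_incl (Suc n) z)" if z: "z \<in> topspace (body (A n))" for z
  proof (rule body_pushout(5)[OF st _ _ z])
    fix x assume "x \<in> pts (A n)"
    then show "K_map f (Suc n) (c (Suc n) (old x)) = b (stage_incl (Suc n) (old x))"
      using Suc by (simp add: body_map_old[OF st] K_map_old)
  next
    fix s d assume s: "s \<in> cells (A n)" and d: "d \<in> disc_of (A n) s"
    have "p n s \<in> cells (K_ob f n)"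
      using m s by (auto simp: stratum_mor_def)
    moreover have "p n s = enc (Square_cell (cdim (A n) s) (\<lambda>x\<in>bdry (A n) s. c n (att (A n) s x))
        (\<lambda>x\<in>disc_of (A n) s. b (cx_char A n s x)))"
      using s by (simp add: lift_cell_def)
    ultimately have "K_map f (Suc n) (char_map (K_ob f n) (p n s) d) = b (cx_char A n s d)"
      using d by (simp add: K_map_char_map)
    then show "K_map f (Suc n) (c (Suc n) (char_map (A n) s d)) = b (stage_incl (Suc n) (char_map (A n) s d))"
      by (simp add: body_map_char_map[OF st s d m] cx_char_def)
  qed
  then show ?case
    using continuous_map_body_map[OF st is_stratum_K_ob m]
    by (simp add: cellcx_sbd_Suc[OF A] sbd_K_ob_Suc body_map_extensional body_map_in_range_old[OF st])
qed

lemma is_cellmor_lift: "is_cellmor (lift A f a b)"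
proof -
  have "stratum_mor (A n) (K_ob f n) (c n) (p n)" for n
    by (rule stratum_mor_lift) (use lift_stage[of n] in auto)
  then show ?thesis
    by (simp add: is_cellmor_def lift_def A is_cellcx_K_ob)
qed

lemma E_ob_cx_map_lift:
  assumes z: "z \<in> body_pts A"
  shows "cfun (E_ob f) (cx_map (lift A f a b) z) = b z"
proof (rule cx_body_colimit(4)[OF A _ z])
  fix n x assume x: "x \<in> pts (A n)"
  then have "c n x \<in> pts (K_ob f n)"
    using lift_stage[of n] by (auto simp: continuous_map_def)
  with x show "cfun (E_ob f) (cx_map (lift A f a b) (stage_incl n x)) = b (stage_incl n x)"
    using cx_map_stage_incl[OF is_cellmor_lift, of x n] lift_stage[of n]
    by (simp add: lift_def E_ob_stage_incl[OF f])
qed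

lemma lift_unique:
  assumes h: "is_cellmor h" "cm_src h = A" "cm_tgt h = K_ob f" "cm_map h 0 = a"
    and E: "\<And>z. z \<in> body_pts A \<Longrightarrow> cfun (E_ob f) (cx_map h z) = b z"
  shows "h = lift A f a b"
proof (rule cellmor_eqI[OF h(1) is_cellmor_lift])
  fix n s
  assume cm: "cm_map h n = cm_map (lift A f a b) n" and "s \<in> cells (cm_src (lift A f a b) n)"
  then have s: "s \<in> cells (A n)" and cn: "cm_map h n = c n"
    by (simp_all add: lift_def)
  let ?d = "cdim (A n) s"
  have hs: "cm_cells h n s \<in> cells (K_ob f n)" "cdim (K_ob f n) (cm_cells h n s) = ?d"
    using cellmor_cells[OF h(1), of s n] s h by simp_all
  then obtain d u v where uv: "cm_cells h n s = enc (Square_cell d u v)"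
      "u \<in> extensional (topspace (bsphere d))" "v \<in> extensional (topspace (disc d))"
    unfolding cells_K_ob_iff by blast
  note cell = K_ob_cell[OF hs(1)[unfolded uv(1)]]
  have d: "d = ?d"
    using cell hs uv by simp
  have "u = (\<lambda>x\<in>topspace (bsphere ?d). c n (att (A n) s x))"
    using uv(2) cell uv(1) cellmor_cells(3)[OF h(1), of s n] s h cn
    by (intro extensionalityI[where A = "topspace (bsphere ?d)"]) (simp_all add: d)
  moreover have "v = (\<lambda>x\<in>topspace (disc ?d). b (cx_char A n s x))"
  proof (rule extensionalityI[where A = "topspace (disc ?d)"])
    fix x assume x: "x \<in> topspace (disc ?d)"
    have "v x = cfun (E_ob f) (cx_char (K_ob f) n (cm_cells h n s) x)"
      using E_ob_cx_char[OF f hs(1)[unfolded uv(1)], of x] x d by (simp add: uv(1))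
    also have "\<dots> = cfun (E_ob f) (cx_map h (cx_char A n s x))"
      using cx_map_cx_char[OF h(1), of s n x] s x h by simp
    also have "\<dots> = b (cx_char A n s x)"
      using E cx_char_in_cx_body[OF A s x] by simp
    finally show "v x = (\<lambda>x\<in>topspace (disc ?d). b (cx_char A n s x)) x"
      using x by simp
  qed (use uv d in simp_all)
  ultimately show "cm_cells h n s = cm_cells (lift A f a b) n s"
    using s by (simp add: lift_def lift_cell_def uv(1) d)
qed (use h in \<open>simp_all add: lift_def\<close>)

end


section \<open>The category of spaces and its squares\<close>

lemma hom_TOP: "f \<in> hom TOP X Y \<longleftrightarrow> f \<in> Mor TOP \<and> cdom f = X \<and> ccod f = Y"
  by (auto simp: hom_def TOP_def)

lemma TOP_sel [simp]: "Obj TOP = UNIV" "Dom TOP = cdom" "Cod TOP = ccod" "Idm TOP X = Cmap X (\<lambda>x\<in>topspace X. x) X"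
  by (simp_all add: TOP_def)

lemma Cmp_TOP_sel [simp]:
  "cdom (Cmp TOP g f) = cdom f" "ccod (Cmp TOP g f) = ccod g"
  "cfun (Cmp TOP g f) = compose (topspace (cdom f)) (cfun g) (cfun f)"
  by (simp_all add: TOP_def)

lemma cfun_in: "f \<in> Mor TOP \<Longrightarrow> x \<in> topspace (cdom f) \<Longrightarrow> cfun f x \<in> topspace (ccod f)"
  by (auto simp: Mor_TOP continuous_map_def)

lemma TOP_hom_eqI:
  assumes "f \<in> hom TOP X Y" "g \<in> hom TOP X Y" "\<And>x. x \<in> topspace X \<Longrightarrow> cfun f x = cfun g x"
  shows "f = g"
proof -
  have "cfun f = cfun g"
    using assms by (intro extensionalityI[where A = "topspace X"]) (auto simp: hom_TOP Mor_TOP)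
  with assms show ?thesis
    by (simp add: hom_TOP cmap.expand)
qed

lemma Cmp_TOP_hom:
  assumes "f \<in> hom TOP X Y" "g \<in> hom TOP Y Z"
  shows "Cmp TOP g f \<in> hom TOP X Z"
proof -
  have "continuous_map X Z (cfun g \<circ> cfun f)"
    using assms by (auto simp: hom_TOP Mor_TOP intro: continuous_map_compose)
  then have "continuous_map X Z (compose (topspace X) (cfun g) (cfun f))"
    by (rule continuous_map_eq) (simp add: compose_def)
  with assms show ?thesis
    by (simp add: hom_TOP Mor_TOP)
qed

lemma Idm_TOP_hom: "Idm TOP X \<in> hom TOP X X"
  using continuous_map_eq[OF continuous_map_id, of X "\<lambda>x\<in>topspace X. x"] by (simp add: hom_TOP Mor_TOP)

lemma category_TOP: "category (TOP :: ('u topology, 'u cmap) cat)"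
proof
  fix f g h :: "'u cmap" and X Y Z W :: "'u topology"
  assume f: "f \<in> hom TOP X Y"
  show "Cmp TOP f (Idm TOP X) = f"
    by (rule TOP_hom_eqI[OF Cmp_TOP_hom[OF Idm_TOP_hom f] f]) (simp add: compose_eq)
  show "Cmp TOP (Idm TOP Y) f = f"
  proof (rule TOP_hom_eqI[OF Cmp_TOP_hom[OF f Idm_TOP_hom] f])
    fix x assume "x \<in> topspace X"
    then show "cfun (Cmp TOP (Idm TOP Y) f) x = cfun f x"
      using cfun_in[of f x] f by (simp add: compose_eq hom_TOP)
  qed
  assume g: "g \<in> hom TOP Y Z"
  show gf: "Cmp TOP g f \<in> hom TOP X Z"
    using f g by (rule Cmp_TOP_hom)
  assume h: "h \<in> hom TOP Z W"
  show "Cmp TOP h (Cmp TOP g f) = Cmp TOP (Cmp TOP h g) f"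
  proof (rule TOP_hom_eqI[OF Cmp_TOP_hom[OF gf h] Cmp_TOP_hom[OF f Cmp_TOP_hom[OF g h]]])
    fix x assume "x \<in> topspace X"
    then show "cfun (Cmp TOP h (Cmp TOP g f)) x = cfun (Cmp TOP (Cmp TOP h g) f) x"
      using cfun_in[of f x] f g by (simp add: compose_eq hom_TOP)
  qed
qed (use Idm_TOP_hom in simp_all)

lemma arrow_cat_sel [simp]: "Obj (arrow_cat C) = Mor C" "Dom (arrow_cat C) = sq_src" "Cod (arrow_cat C) = sq_tgt"
  "Idm (arrow_cat C) f = Sq f (Idm C (Dom C f)) (Idm C (Cod C f)) f"
  "Cmp (arrow_cat C) \<tau> \<sigma> =
    Sq (sq_src \<sigma>) (Cmp C (sq_top \<tau>) (sq_top \<sigma>)) (Cmp C (sq_bot \<tau>) (sq_bot \<sigma>)) (sq_tgt \<tau>)"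
  by (simp_all add: arrow_cat_def)

lemma Sq_hom_arrow_cat:
  "Sq f' a b g' \<in> hom (arrow_cat C) f g \<longleftrightarrow> f' = f \<and> g' = g \<and> f \<in> Mor C \<and> g \<in> Mor C \<and>
    a \<in> hom C (Dom C f) (Dom C g) \<and> b \<in> hom C (Cod C f) (Cod C g) \<and> Cmp C g a = Cmp C b f"
  by (auto simp: hom_def arrow_cat_def)

abbreviation K_transpose :: "'u::universe cellcx \<Rightarrow> 'u cmap \<Rightarrow> 'u cmap square \<Rightarrow> 'u cellmor" where
  "K_transpose \<equiv> transpose CELLCX TOP2 U_functr K_ob UK_counit"

lemma transpose_eq_lift:
  assumes A: "is_cellcx A" and f: "f \<in> Mor TOP"
    and \<sigma>: "Sq (U_ob A) a b f \<in> hom TOP2 (U_ob A) f"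
  shows "square_from_U A f (cfun a) (cfun b)"
    and "K_transpose A f (Sq (U_ob A) a b f) = lift A f (cfun a) (cfun b)"
proof -
  have ha: "a \<in> hom TOP (sbd (A 0)) (cdom f)" and hb: "b \<in> hom TOP (cx_body A) (ccod f)"
    and comm: "Cmp TOP f a = Cmp TOP b (U_ob A)"
    using \<sigma> by (auto simp: Sq_hom_arrow_cat)
  interpret square_from_U A f "cfun a" "cfun b"
  proof
    fix x assume x: "x \<in> pts (A 0)"
    have "cfun (Cmp TOP f a) x = cfun (Cmp TOP b (U_ob A)) x"
      using comm by simp
    then show "cfun f (cfun a x) = cfun b (stage_incl 0 x)"
      using ha x by (simp add: compose_eq hom_TOP)
  qed (use A f ha hb in \<open>auto simp: hom_TOP Mor_TOP\<close>)
  show "square_from_U A f (cfun a) (cfun b)" ..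
  have iff: "Cmp TOP2 (UK_counit f) (Fmo U_functr h) = Sq (U_ob A) a b f \<longleftrightarrow>
      cm_map h 0 = cfun a \<and> (\<forall>z \<in> body_pts A. cfun (E_ob f) (cx_map h z) = cfun b z)"
    if h: "is_cellmor h" "cm_src h = A" "cm_tgt h = K_ob f" for h
  proof -
    let ?h0 = "Cmap (sbd (A 0)) (cm_map h 0) (cdom f)" and ?h1 = "Cmap (cx_body A) (cx_map h) (cx_body (K_ob f))"
    have h0: "?h0 \<in> hom TOP (sbd (A 0)) (cdom f)"
      using cellmor_mor[OF h(1), of 0] h by (simp add: hom_TOP Mor_TOP stratum_mor_def)
    have h1: "?h1 \<in> hom TOP (cx_body A) (cx_body (K_ob f))"
      using continuous_map_cx_map[OF h(1)] cx_map_extensional[of h] h by (simp add: hom_TOP Mor_TOP)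
    have E: "E_ob f \<in> hom TOP (cx_body (K_ob f)) (ccod f)"
      by (simp add: hom_TOP E_ob_Mor[OF f])
    have "Cmp TOP2 (UK_counit f) (Fmo U_functr h) = Sq (U_ob A) (Cmp TOP (Idm TOP (cdom f)) ?h0) (Cmp TOP (E_ob f) ?h1) f"
      using h by (simp add: UK_counit_def U_functr_def)
    also have "Cmp TOP (Idm TOP (cdom f)) ?h0 = ?h0"
      using category.cmp_id_left[OF category_TOP h0] .
    also have "?h0 = a \<longleftrightarrow> cm_map h 0 = cfun a"
    proof
      assume "cm_map h 0 = cfun a"
      then show "?h0 = a"
        by (intro TOP_hom_eqI[OF h0 ha]) simp
    qed auto
    moreover have "Cmp TOP (E_ob f) ?h1 = b \<longleftrightarrow> (\<forall>z \<in> body_pts A. cfun (E_ob f) (cx_map h z) = cfun b z)"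
    proof
      assume "Cmp TOP (E_ob f) ?h1 = b"
      then have "cfun b z = cfun (Cmp TOP (E_ob f) ?h1) z" for z
        by simp
      then show "\<forall>z \<in> body_pts A. cfun (E_ob f) (cx_map h z) = cfun b z"
        by (simp add: compose_eq)
    next
      assume "\<forall>z \<in> body_pts A. cfun (E_ob f) (cx_map h z) = cfun b z"
      then show "Cmp TOP (E_ob f) ?h1 = b"
        by (intro TOP_hom_eqI[OF Cmp_TOP_hom[OF h1 E] hb]) (simp add: compose_eq)
    qed
    ultimately show ?thesis
      by simp
  qed
  show "K_transpose A f (Sq (U_ob A) a b f) = lift A f (cfun a) (cfun b)"
    unfolding transpose_def
  proof (rule the_equality)
    have "cm_src (lift A f (cfun a) (cfun b)) = A" "cm_tgt (lift A f (cfun a) (cfun b)) = K_ob f"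
      "cm_map (lift A f (cfun a) (cfun b)) 0 = cfun a"
      by (simp_all add: lift_def)
    then show "lift A f (cfun a) (cfun b) \<in> hom CELLCX A (K_ob f) \<and>
        Cmp TOP2 (UK_counit f) (Fmo U_functr (lift A f (cfun a) (cfun b))) = Sq (U_ob A) a b f"
      using iff is_cellmor_lift E_ob_cx_map_lift by (simp add: hom_CELLCX)
  next
    fix h assume "h \<in> hom CELLCX A (K_ob f) \<and> Cmp TOP2 (UK_counit f) (Fmo U_functr h) = Sq (U_ob A) a b f"
    then show "h = lift A f (cfun a) (cfun b)"
      using iff[of h] by (intro lift_unique) (auto simp: hom_CELLCX)
  qed
qed


section \<open>Cellular maps\<close>

text \<open>A map between bodies which preserves characteristic maps. Unlike a morphism of cell complexes,
  it may have any behaviour on boundaries and may move cells to other strata: the multiplication of the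
  monad \<open>E\<close> is such a map.\<close>

definition cellular :: "'u::universe cellcx \<Rightarrow> 'u cellcx \<Rightarrow> ('u \<Rightarrow> 'u) \<Rightarrow> bool" where
  "cellular A B c \<longleftrightarrow> (\<forall>n. \<forall>s \<in> cells (A n). \<exists>m. \<exists>t \<in> cells (B m). cdim (B m) t = cdim (A n) s \<and>
     (\<forall>d \<in> disc_of (A n) s. c (cx_char A n s d) = cx_char B m t d))"

lemma cellularE:
  assumes "cellular A B c" "s \<in> cells (A n)"
  obtains m t where "t \<in> cells (B m)" "cdim (B m) t = cdim (A n) s"
    "\<And>d. d \<in> disc_of (A n) s \<Longrightarrow> c (cx_char A n s d) = cx_char B m t d"
  using assms unfolding cellular_def by blast

lemma cellular_cx_map: "is_cellmor \<phi> \<Longrightarrow> cellular (cm_src \<phi>) (cm_tgt \<phi>) (cx_map \<phi>)"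
  unfolding cellular_def using cellmor_cells cx_map_cx_char by blast

lemma cellular_compose:
  assumes "cellular A B c" "cellular B C c'"
  shows "cellular A C (\<lambda>z. c' (c z))"
  unfolding cellular_def
proof (intro allI ballI)
  fix n s assume "s \<in> cells (A n)"
  with assms(1) obtain m t where t: "t \<in> cells (B m)" "cdim (B m) t = cdim (A n) s"
    "\<And>d. d \<in> disc_of (A n) s \<Longrightarrow> c (cx_char A n s d) = cx_char B m t d"
    by (rule cellularE) blast
  from assms(2) t(1) obtain k r where r: "r \<in> cells (C k)" "cdim (C k) r = cdim (B m) t"
    "\<And>d. d \<in> disc_of (B m) t \<Longrightarrow> c' (cx_char B m t d) = cx_char C k r d"
    by (rule cellularE) blast
  show "\<exists>m. \<exists>t \<in> cells (C m). cdim (C m) t = cdim (A n) s \<and>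
      (\<forall>d \<in> disc_of (A n) s. c' (c (cx_char A n s d)) = cx_char C m t d)"
    using t r by (intro exI[of _ k] bexI[of _ r]) simp_all
qed

lemma cellular_cong:
  assumes A: "is_cellcx A" and c: "cellular A B c" and e: "\<And>z. z \<in> body_pts A \<Longrightarrow> c' z = c z"
  shows "cellular A B c'"
  using c e[OF cx_char_in_cx_body[OF A]] unfolding cellular_def by fastforce

text \<open>By induction, the two maps agree on the stage that contains the boundary of a cell, so by
  \<open>K_ob_cell_eqI\<close> they send the cell to the same cell of \<open>K f\<close>.\<close>

lemma cellular_unique:
  assumes A: "is_cellcx A" and f: "f \<in> Mor TOP"
    and c: "cellular A (K_ob f) c" "cellular A (K_ob f) c'"
    and bd: "\<And>x. x \<in> pts (A 0) \<Longrightarrow> c (stage_incl 0 x) = c' (stage_incl 0 x)"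
    and E: "\<And>z. z \<in> body_pts A \<Longrightarrow> cfun (E_ob f) (c z) = cfun (E_ob f) (c' z)"
    and z: "z \<in> body_pts A"
  shows "c z = c' z"
proof -
  have cell: "\<forall>s \<in> cells (A n). \<forall>d \<in> disc_of (A n) s. c (cx_char A n s d) = c' (cx_char A n s d)" for n
  proof (induction n rule: less_induct)
    case (less n)
    have stage: "c (stage_incl n x) = c' (stage_incl n x)" if "x \<in> pts (A n)" for x
      by (rule stage_eqI[where k = c and l = c', OF A bd _ that]) (use less in blast)+
    show ?case
    proof (intro ballI)
      fix s d assume s: "s \<in> cells (A n)" and d: "d \<in> disc_of (A n) s"
      obtain m t where t: "t \<in> cells (K_ob f m)" "cdim (K_ob f m) t = cdim (A n) s"
          "\<And>d. d \<in> disc_of (A n) s \<Longrightarrow> c (cx_char A n s d) = cx_char (K_ob f) m t d"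
        using c(1) s by (rule cellularE) blast
      obtain m' t' where t': "t' \<in> cells (K_ob f m')" "cdim (K_ob f m') t' = cdim (A n) s"
          "\<And>d. d \<in> disc_of (A n) s \<Longrightarrow> c' (cx_char A n s d) = cx_char (K_ob f) m' t' d"
        using c(2) s by (rule cellularE) blast
      have "m = m' \<and> t = t'"
      proof (rule K_ob_cell_eqI[OF f t(1) t'(1) t(2) t'(2)])
        fix x assume x: "x \<in> bdry (A n) s"
        then have "c (cx_char A n s x) = c' (cx_char A n s x)"
          using stage att_in_sbd[OF cellcx_stratum[OF A] s] by (simp add: cx_char_bsphere)
        with x show "cx_char (K_ob f) m t x = cx_char (K_ob f) m' t' x"
          using t(3) t'(3) bsphere_subset_disc by (metis subsetD)
      next
        fix x assume x: "x \<in> disc_of (A n) s"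
        then show "cfun (E_ob f) (cx_char (K_ob f) m t x) = cfun (E_ob f) (cx_char (K_ob f) m' t' x)"
          using E[OF cx_char_in_cx_body[OF A s x]] t(3) t'(3) by simp
      qed
      then show "c (cx_char A n s d) = c' (cx_char A n s d)"
        using t(3)[OF d] t'(3)[OF d] by simp
    qed
  qed
  show ?thesis
    by (rule cx_eqI[where k = c and l = c', OF A bd _ z]) (use cell in blast)+
qed


section \<open>Composition with a stratum\<close>

lemma body_map_cong:
  assumes \<sigma>: "is_stratum \<sigma>" and p: "\<And>s. s \<in> cells \<sigma> \<Longrightarrow> p s = q s"
  shows "body_map \<sigma> f p = body_map \<sigma> f q"
proof (rule extensionalityI[OF body_map_extensional body_map_extensional])
  fix z assume "z \<in> topspace (body \<sigma>)"
  with \<sigma> show "body_map \<sigma> f p z = body_map \<sigma> f q z"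
    by (cases rule: body_cases) (simp_all add: body_map_old[OF \<sigma>] body_map_cell_pt[OF \<sigma>] p)
qed

locale stacking =
  fixes A :: "'u::universe cellcx" and \<tau> :: "'u stratum"
  assumes A: "is_cellcx A" and \<tau>: "is_stratum \<tau>" and sbd: "sbd \<tau> = cx_body A"
begin

abbreviation "L \<equiv> level A \<tau>"
abbreviation "S \<equiv> stack A \<tau>"
abbreviation "j \<equiv> \<lambda>n. snd (stack_rec A \<tau> n)"



definition level_att :: "'u \<Rightarrow> (nat \<Rightarrow> real) \<Rightarrow> 'u" where
  "level_att t x = inv_into (pts (A (L t))) (stage_incl (L t)) (att \<tau> t x)"

lemma factors_iff:
  assumes t: "t \<in> cells \<tau>"
  shows "factors_through (stage_incl n) (sbd (A n)) (cdim \<tau> t) (att \<tau> t) \<longleftrightarrow>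
    att \<tau> t ` bdry \<tau> t \<subseteq> stage_incl n ` pts (A n)"
  using factors_through_closed_inj_iff[OF closed_map_stage_incl[OF A] inj_stage_incl]
    continuous_map_att[OF \<tau> t] sbd by simp

text \<open>The least number in the definition of the level exists, because spheres are compact.\<close>

lemma factors_level:
  assumes t: "t \<in> cells \<tau>"
  shows "factors_through (stage_incl (L t)) (sbd (A (L t))) (cdim \<tau> t) (att \<tau> t)"
proof -
  have "compactin (cx_body A) (att \<tau> t ` bdry \<tau> t)"
    using image_compactin[OF _ continuous_map_att[OF \<tau> t]] compact_space_bsphere
    by (simp add: compact_space_def sbd)
  then obtain n where "\<forall>z \<in> att \<tau> t ` bdry \<tau> t. first_stage z \<le> n"
    using compactin_bounded_stage[OF A] by blast
  then have "att \<tau> t ` bdry \<tau> t \<subseteq> stage_incl n ` pts (A n)"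
    using in_stage_iff[OF cellcx_connected[OF A]] att_in_sbd[OF \<tau> t] by (auto simp: sbd)
  then have "factors_through (stage_incl n) (sbd (A n)) (cdim \<tau> t) (att \<tau> t)"
    by (simp add: factors_iff[OF t])
  then show ?thesis
    unfolding level_def by (rule LeastI)
qed

lemma level_att:
  assumes t: "t \<in> cells \<tau>" and x: "x \<in> bdry \<tau> t"
  shows "level_att t x \<in> pts (A (L t))" "stage_incl (L t) (level_att t x) = att \<tau> t x"
proof -
  have "att \<tau> t x \<in> stage_incl (L t) ` pts (A (L t))"
    using factors_level[OF t] x by (auto simp: factors_iff[OF t])
  then show "level_att t x \<in> pts (A (L t))" "stage_incl (L t) (level_att t x) = att \<tau> t x"
    unfolding level_att_def by (rule inv_into_into, rule f_inv_into_f)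
qed

lemma continuous_map_level_att:
  assumes t: "t \<in> cells \<tau>"
  shows "continuous_map (bsphere (cdim \<tau> t)) (sbd (A (L t))) (level_att t)"
proof -
  have "continuous_map (bsphere (cdim \<tau> t)) (sbd (A (L t))) (inv (stage_incl (L t)) \<circ> att \<tau> t)"
    using continuous_map_att[OF \<tau> t] factors_level[OF t]
    by (intro continuous_map_inv_closed_inj[OF closed_map_stage_incl[OF A] inj_stage_incl])
      (simp_all add: sbd factors_iff[OF t])
  then show ?thesis
    by (rule continuous_map_eq) (metis comp_apply inv_f_f[OF inj_stage_incl] level_att(2)[OF t])
qed

lemma level_att_new:
  assumes t: "t \<in> cells \<tau>" and n: "L t = Suc n"
  shows "\<exists>x \<in> bdry \<tau> t. level_att t x \<notin> range old"
proof -
  have "\<not> factors_through (stage_incl n) (sbd (A n)) (cdim \<tau> t) (att \<tau> t)"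
    using not_less_Least[of n] n unfolding level_def by (metis lessI)
  then obtain x where x: "x \<in> bdry \<tau> t" "att \<tau> t x \<notin> stage_incl n ` pts (A n)"
    by (auto simp: factors_iff[OF t])
  have "level_att t x \<noteq> old y" for y
  proof
    assume y: "level_att t x = old y"
    then have "y \<in> pts (A n)"
      using level_att(1)[OF t x(1)] by (simp add: n cellcx_sbd_Suc[OF A] old_in_body_iff[OF cellcx_stratum[OF A]])
    moreover have "att \<tau> t x = stage_incl n y"
      using level_att(2)[OF t x(1)] y by (simp add: n)
    ultimately show False
      using x(2) by blast
  qed
  with x(1) show ?thesis
    by blast
qed

lemma j_0: "j 0 = (\<lambda>x\<in>pts (A 0). x)"
  by (simp add: Let_def)

lemma j_Suc: "j (Suc n) = body_map (A n) (j n) (\<lambda>s. enc (Inl_cell s))"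
  by (simp add: split_beta Let_def)

lemma sbd_S_0 [simp]: "sbd (S 0) = sbd (A 0)"
  by (simp add: stack_def Let_def stack_stratum_def)

lemma sbd_S_Suc: "sbd (S (Suc n)) = body (S n)"
  by (simp add: stack_def split_beta Let_def stack_stratum_def)

lemma S_eq: "S n = stack_stratum A \<tau> n (sbd (S n)) (j n)"
  by (cases n) (simp_all add: stack_def split_beta Let_def stack_stratum_def)

lemma cells_S: "cells (S n) = (\<lambda>s. enc (Inl_cell s)) ` cells (A n) \<union> (\<lambda>t. enc (Inr_cell t)) ` {t \<in> cells \<tau>. L t = n}"
  by (subst S_eq) (simp add: stack_stratum_def Let_def)

lemma cells_S_cases:
  assumes "u \<in> cells (S n)"
  obtains (Inl) s where "u = enc (Inl_cell s)" "s \<in> cells (A n)"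
  | (Inr) t where "u = enc (Inr_cell t)" "t \<in> cells \<tau>" "L t = n"
  using assms by (auto simp: cells_S)

lemma Inl_in_cells [simp]: "s \<in> cells (A n) \<Longrightarrow> enc (Inl_cell s) \<in> cells (S n)"
  by (simp add: cells_S)

lemma Inr_in_cells [simp]: "t \<in> cells \<tau> \<Longrightarrow> enc (Inr_cell t) \<in> cells (S (L t))"
  by (simp add: cells_S)

lemma S_Inl:
  assumes "s \<in> cells (A n)"
  shows "cdim (S n) (enc (Inl_cell s)) = cdim (A n) s"
    and "att (S n) (enc (Inl_cell s)) = (\<lambda>x\<in>bdry (A n) s. j n (att (A n) s x))"
  using assms by (subst S_eq; simp add: stack_stratum_def Let_def)+

lemma S_Inr:
  assumes "t \<in> cells \<tau>"
  shows "cdim (S (L t)) (enc (Inr_cell t)) = cdim \<tau> t"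
    and "att (S (L t)) (enc (Inr_cell t)) = (\<lambda>x\<in>bdry \<tau> t. j (L t) (level_att t x))"
  using assms by (subst S_eq; simp add: stack_stratum_def Let_def level_att_def)+

lemma is_stratum_S:
  assumes j: "continuous_map (sbd (A n)) (sbd (S n)) (j n)"
  shows "is_stratum (S n)"
proof -
  have att: "continuous_map (bsphere (cdim (S n) u)) (sbd (S n)) (att (S n) u) \<and>
      att (S n) u \<in> extensional (bdry (S n) u)" if "u \<in> cells (S n)" for u
    using that
  proof (cases rule: cells_S_cases)
    case (Inl s)
    have "continuous_map (bsphere (cdim (A n) s)) (sbd (S n))
        (\<lambda>x\<in>bdry (A n) s. j n (att (A n) s x))"
      using continuous_map_att[OF cellcx_stratum[OF A] Inl(2)] j by (rule continuous_map_composeI) simp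
    then show ?thesis
      by (simp add: Inl S_Inl)
  next
    case (Inr t)
    have "continuous_map (bsphere (cdim \<tau> t)) (sbd (S n)) (\<lambda>x\<in>bdry \<tau> t. j n (level_att t x))"
      using continuous_map_level_att[OF Inr(2)] j unfolding Inr(3) by (rule continuous_map_composeI) simp
    then show ?thesis
      using S_Inr[OF Inr(2)] by (simp add: Inr)
  qed
  moreover have "cdim (S n) \<in> extensional (cells (S n))" "att (S n) \<in> extensional (cells (S n))"
    by (subst (1 2) S_eq; simp add: stack_stratum_def Let_def)+
  ultimately show ?thesis
    unfolding is_stratum_def by blast
qed

lemma stratum_mor_j:
  assumes j: "continuous_map (sbd (A n)) (sbd (S n)) (j n)" "j n \<in> extensional (pts (A n))"
  shows "stratum_mor (A n) (S n) (j n) (\<lambda>s\<in>cells (A n). enc (Inl_cell s))"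
  using j by (auto simp: stratum_mor_def S_Inl)

lemma j_Suc': "j (Suc n) = body_map (A n) (j n) (\<lambda>s\<in>cells (A n). enc (Inl_cell s))"
  unfolding j_Suc by (rule body_map_cong[OF cellcx_stratum[OF A]]) simp

lemma j_stage: "continuous_map (sbd (A n)) (sbd (S n)) (j n) \<and> j n \<in> extensional (pts (A n))"
proof (induction n)
  case 0
  have "continuous_map (sbd (A 0)) (sbd (A 0)) (\<lambda>x\<in>pts (A 0). x)"
    by (rule continuous_map_eq[OF continuous_map_id]) simp
  then show ?case
    by (simp only: sbd_S_0 j_0 restrict_extensional)
next
  case (Suc n)
  have "continuous_map (body (A n)) (body (S n)) (j (Suc n))"
    unfolding j_Suc' using Suc
    by (intro continuous_map_body_map[OF cellcx_stratum[OF A] is_stratum_S stratum_mor_j]) simp_all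
  then show ?case
    by (simp only: cellcx_sbd_Suc[OF A] sbd_S_Suc) (simp only: j_Suc body_map_extensional)
qed

lemma j_in: "x \<in> pts (A n) \<Longrightarrow> j n x \<in> pts (S n)"
  using j_stage[of n] by (auto simp: continuous_map_def)

lemma j_new: "0 < n \<Longrightarrow> x \<in> pts (A n) \<Longrightarrow> j n x \<in> range old \<longleftrightarrow> x \<in> range old"
  by (cases n) (simp_all only: j_Suc cellcx_sbd_Suc[OF A] body_map_in_range_old[OF cellcx_stratum[OF A]])

lemma is_cellcx_stack: "is_cellcx S"
proof -
  have "\<exists>x \<in> bdry (S (Suc n)) u. att (S (Suc n)) u x \<notin> range old"
    if "u \<in> cells (S (Suc n))" for n u
    using that
  proof (cases rule: cells_S_cases)
    case (Inl s)
    obtain x where x: "x \<in> bdry (A (Suc n)) s" "att (A (Suc n)) s x \<notin> range old"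
      using A Inl(2) unfolding is_cellcx_iff by blast
    then have "j (Suc n) (att (A (Suc n)) s x) \<notin> range old"
      using j_new[OF zero_less_Suc att_in_sbd[OF cellcx_stratum[OF A] Inl(2) x(1)]] by simp
    with x(1) show ?thesis
      by (intro bexI[of _ x]) (simp_all only: Inl S_Inl restrict_apply', simp_all)
  next
    case (Inr t)
    obtain x where x: "x \<in> bdry \<tau> t" "level_att t x \<notin> range old"
      using level_att_new[OF Inr(2,3)] by blast
    then have "j (Suc n) (level_att t x) \<notin> range old"
      using j_new[OF zero_less_Suc, of "level_att t x" n] level_att(1)[OF Inr(2) x(1)] Inr(3) by simp
    with x(1) show ?thesis
      using S_Inr[OF Inr(2)] unfolding Inr(3) by (intro bexI[of _ x]) (simp_all only: Inr(1) restrict_apply', simp_all)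
  qed
  then show ?thesis
    using is_stratum_S j_stage by (simp add: is_cellcx_iff connected_strata_def sbd_S_Suc)
qed

lemma stack_incl_sel [simp]: "cm_src (stack_incl A \<tau>) = A" "cm_tgt (stack_incl A \<tau>) = S"
  "cm_map (stack_incl A \<tau>) = j" "cm_cells (stack_incl A \<tau>) = (\<lambda>n. \<lambda>s\<in>cells (A n). enc (Inl_cell s))"
  by (simp_all add: stack_incl_def)

lemma is_cellmor_stack_incl: "is_cellmor (stack_incl A \<tau>)"
  unfolding is_cellmor_def stack_incl_sel using j_stage by (intro conjI allI A is_cellcx_stack stratum_mor_j j_Suc') simp_all

lemma stack_incl_stage: "x \<in> pts (A n) \<Longrightarrow> cx_map (stack_incl A \<tau>) (stage_incl n x) = stage_incl n (j n x)"
  using cx_map_stage_incl[OF is_cellmor_stack_incl, of x n] by (simp only: stack_incl_sel)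

lemma stack_incl_char:
  "s \<in> cells (A n) \<Longrightarrow> d \<in> disc_of (A n) s \<Longrightarrow>
    cx_map (stack_incl A \<tau>) (cx_char A n s d) = cx_char S n (enc (Inl_cell s)) d"
  using cx_map_cx_char[OF is_cellmor_stack_incl, of s n d] by (simp only: stack_incl_sel restrict_apply')

lemma stack_ident_old:
  "z \<in> body_pts A \<Longrightarrow> stack_ident A \<tau> (old z) = cx_map (stack_incl A \<tau>) z"
  by (simp add: stack_ident_def old_in_body_iff[OF \<tau>] sbd)

lemma stack_ident_char_map:
  assumes t: "t \<in> cells \<tau>" and d: "d \<in> disc_of \<tau> t"
  shows "stack_ident A \<tau> (char_map \<tau> t d) = cx_char S (L t) (enc (Inr_cell t)) d"
proof (cases "d \<in> bdry \<tau> t")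
  case True
  have "stack_ident A \<tau> (char_map \<tau> t d) = cx_map (stack_incl A \<tau>) (stage_incl (L t) (level_att t d))"
    using True att_in_sbd[OF \<tau> t True] by (simp add: char_map_def stack_ident_old sbd level_att(2)[OF t])
  also have "\<dots> = stage_incl (L t) (att (S (L t)) (enc (Inr_cell t)) d)"
    using True by (simp add: stack_incl_stage level_att(1)[OF t] S_Inr[OF t])
  finally show ?thesis
    using True by (simp add: cx_char_bsphere S_Inr[OF t])
next
  case False
  then show ?thesis
    using char_map_in_body[OF \<tau> t d] by (simp add: stack_ident_def char_map_def cx_char_def S_Inr[OF t])
qed

end




lemma transport_sel [simp]: "sbd (transport \<theta> Y \<sigma>) = Y" "cells (transport \<theta> Y \<sigma>) = cells \<sigma>"
  "cdim (transport \<theta> Y \<sigma>) = cdim \<sigma>"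
  "att (transport \<theta> Y \<sigma>) = (\<lambda>s\<in>cells \<sigma>. \<lambda>x\<in>bdry \<sigma> s. \<theta> (att \<sigma> s x))"
  by (simp_all add: transport_def)

lemma is_stratum_transport:
  assumes \<sigma>: "is_stratum \<sigma>" and \<theta>: "continuous_map (sbd \<sigma>) Y \<theta>"
  shows "is_stratum (transport \<theta> Y \<sigma>)"
proof -
  have "continuous_map (bsphere (cdim \<sigma> s)) Y (\<lambda>x\<in>bdry \<sigma> s. \<theta> (att \<sigma> s x))" if s: "s \<in> cells \<sigma>" for s
  proof -
    have "continuous_map (bsphere (cdim \<sigma> s)) Y (\<theta> \<circ> att \<sigma> s)"
      using continuous_map_att[OF \<sigma> s] \<theta> by (rule continuous_map_compose)
    then show ?thesis
      by (rule continuous_map_eq) simp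
  qed
  with \<sigma> show ?thesis
    by (simp add: is_stratum_def)
qed

text \<open>In \<open>B * A\<close> the boundary of a stratum \<open>\<sigma>\<close> of \<open>B\<close> is not equal to the body of the complex onto which
  \<open>\<sigma>\<close> is composed, but only identified with it, by \<open>\<theta>\<close>. The locale therefore treats the transport of \<open>\<sigma>\<close>
  along a homeomorphism.\<close>

locale stacking_along =
  fixes A :: "'u::universe cellcx" and \<sigma> :: "'u stratum" and \<theta> \<theta>' :: "'u \<Rightarrow> 'u"
  assumes A': "is_cellcx A" and \<sigma>: "is_stratum \<sigma>" and \<theta>: "homeomorphic_maps (sbd \<sigma>) (cx_body A) \<theta> \<theta>'"
begin

abbreviation "\<tau> \<equiv> transport \<theta> (cx_body A) \<sigma>"

sublocale stacking A \<tau>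
proof
  show "is_stratum \<tau>"
    using \<theta> by (intro is_stratum_transport[OF \<sigma>]) (simp add: homeomorphic_maps_def)
qed (simp_all add: A')

lemma \<theta>_in: "y \<in> pts \<sigma> \<Longrightarrow> \<theta> y \<in> body_pts A"
  using \<theta> by (auto simp: homeomorphic_maps_def continuous_map_def)

lemma \<theta>'_in: "z \<in> body_pts A \<Longrightarrow> \<theta>' z \<in> pts \<sigma>"
  using \<theta> by (auto simp: homeomorphic_maps_def continuous_map_def)

lemma \<theta>'_\<theta>: "y \<in> pts \<sigma> \<Longrightarrow> \<theta>' (\<theta> y) = y"
  using \<theta> by (auto simp: homeomorphic_maps_def)

lemma \<theta>_\<theta>': "z \<in> body_pts A \<Longrightarrow> \<theta> (\<theta>' z) = z"
  using \<theta> by (auto simp: homeomorphic_maps_def)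

definition F :: "'u \<Rightarrow> 'u" where
  "F = compose (topspace (body \<sigma>)) (stack_ident A \<tau>) (body_map \<sigma> \<theta> id)"

lemma F_old: "y \<in> pts \<sigma> \<Longrightarrow> F (old y) = cx_map (stack_incl A \<tau>) (\<theta> y)"
  by (simp add: F_def compose_eq old_in_body_iff[OF \<sigma>] body_map_old[OF \<sigma>] stack_ident_old \<theta>_in)

lemma F_char_map:
  assumes t: "t \<in> cells \<sigma>" and d: "d \<in> disc_of \<sigma> t"
  shows "F (char_map \<sigma> t d) = cx_char S (L t) (enc (Inr_cell t)) d"
proof -
  have "body_map \<sigma> \<theta> id (char_map \<sigma> t d) = char_map \<tau> t d"
  proof (cases "d \<in> bdry \<sigma> t")
    case True
    then show ?thesis
      using t by (simp add: char_map_def body_map_old[OF \<sigma>] att_in_sbd[OF \<sigma> t])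
  next
    case False
    then show ?thesis
      using body_map_cell_pt[OF \<sigma> t d] by (simp add: char_map_def)
  qed
  then show ?thesis
    using t d stack_ident_char_map[of t d] by (simp add: F_def compose_eq char_map_in_body[OF \<sigma> t d])
qed

lemma continuous_map_F: "continuous_map (body \<sigma>) (cx_body S) F"
proof (rule continuous_map_bodyI[OF \<sigma>])
  have "continuous_map (sbd \<sigma>) (cx_body S) (cx_map (stack_incl A \<tau>) \<circ> \<theta>)"
    using \<theta> continuous_map_cx_map[OF is_cellmor_stack_incl]
    by (intro continuous_map_compose) (simp_all add: homeomorphic_maps_def)
  then show "continuous_map (sbd \<sigma>) (cx_body S) (\<lambda>x. F (old x))"
    by (rule continuous_map_eq) (simp add: F_old)
next
  fix t assume t: "t \<in> cells \<sigma>"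
  have "continuous_map (disc (cdim \<sigma> t)) (cx_body S) (cx_char S (L t) (enc (Inr_cell t)))"
    using continuous_map_cx_char[OF is_cellcx_stack Inr_in_cells, of t] S_Inr(1)[of t] t by simp
  then show "continuous_map (disc (cdim \<sigma> t)) (cx_body S) (\<lambda>d. F (char_map \<sigma> t d))"
    by (rule continuous_map_eq) (simp add: F_char_map t)
qed

text \<open>The inverse \<open>G\<close> of \<open>F\<close> is defined stage by stage: the cells of \<open>A\<close> are sent into the boundary of
  \<open>\<sigma>\<close>, and the other cells are those of \<open>\<sigma>\<close>.\<close>

definition G_cell :: "nat \<Rightarrow> 'u \<Rightarrow> (nat \<Rightarrow> real) \<Rightarrow> 'u" where
  "G_cell n u = (case dec u of Inl_cell s \<Rightarrow> (\<lambda>d. old (\<theta>' (cx_char A n s d))) | Inr_cell t \<Rightarrow> char_map \<sigma> t)"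

primrec G_stage :: "nat \<Rightarrow> 'u \<Rightarrow> 'u" where
  "G_stage 0 = (\<lambda>x. old (\<theta>' (stage_incl 0 x)))"
| "G_stage (Suc n) = body_induced (G_stage n) (G_cell n)"

definition G :: "'u \<Rightarrow> 'u" where
  "G = cx_induced G_stage"

lemma G_cell_Inl: "G_cell n (enc (Inl_cell s)) d = old (\<theta>' (cx_char A n s d))"
  by (simp add: G_cell_def)

lemma G_cell_Inr: "G_cell n (enc (Inr_cell t)) d = char_map \<sigma> t d"
  by (simp add: G_cell_def)

lemma continuous_map_old_\<theta>': "continuous_map (cx_body A) (body \<sigma>) (\<lambda>z. old (\<theta>' z))"
proof -
  have "continuous_map (cx_body A) (body \<sigma>) (old \<circ> \<theta>')"
    using \<theta> body_pushout(1)[OF \<sigma>] by (intro continuous_map_compose) (simp_all add: homeomorphic_maps_def)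
  then show ?thesis
    by (simp add: comp_def)
qed

lemma G_stage_char_map:
  assumes j: "\<And>x. x \<in> pts (A n) \<Longrightarrow> G_stage n (j n x) = old (\<theta>' (stage_incl n x))"
    and u: "u \<in> cells (S n)"
  shows "G_stage (Suc n) (char_map (S n) u d) = G_cell n u d"
  unfolding G_stage.simps
proof (rule body_induced_char_map)
  assume d: "d \<in> bdry (S n) u"
  from u show "G_stage n (att (S n) u d) = G_cell n u d"
  proof (cases rule: cells_S_cases)
    case (Inl s)
    with d have d': "d \<in> bdry (A n) s"
      by (simp only: S_Inl)
    show ?thesis
      using d' j[OF att_in_sbd[OF cellcx_stratum[OF A] Inl(2) d']]
      by (simp add: Inl(1) S_Inl[OF Inl(2)] G_cell_Inl cx_char_bsphere)
  next
    case (Inr t)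
    have t: "t \<in> cells \<sigma>" and d': "d \<in> bdry \<sigma> t"
      using Inr d S_Inr[of t] by simp_all
    have "G_stage n (att (S n) u d) = G_stage n (j n (level_att t d))"
      using S_Inr(2)[of t] t d' by (simp add: Inr)
    also have "\<dots> = old (\<theta>' (stage_incl n (level_att t d)))"
      using j level_att(1)[of t d] t d' Inr(3) by simp
    also have "stage_incl n (level_att t d) = \<theta> (att \<sigma> t d)"
      using level_att(2)[of t d] t d' Inr(3) by simp
    finally show ?thesis
      using d' by (simp add: Inr(1) G_cell_Inr char_map_def \<theta>'_\<theta> att_in_sbd[OF \<sigma> t])
  qed
qed

lemma G_stage:
  "continuous_map (sbd (S n)) (body \<sigma>) (G_stage n) \<and>
   (\<forall>x \<in> pts (A n). G_stage n (j n x) = old (\<theta>' (stage_incl n x)))"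
proof (induction n)
  case 0
  have "continuous_map (sbd (A 0)) (body \<sigma>) ((\<lambda>z. old (\<theta>' z)) \<circ> stage_incl 0)"
    using cx_body_colimit(1)[OF A] continuous_map_old_\<theta>' by (rule continuous_map_compose)
  then show ?case
    by (simp add: comp_def Let_def)
next
  case (Suc n)
  note st = cellcx_stratum[OF A, of n] and stS = cellcx_stratum[OF is_cellcx_stack, of n]
  have char: "G_stage (Suc n) (char_map (S n) u d) = G_cell n u d" if "u \<in> cells (S n)" for u d
    using G_stage_char_map[OF _ that] Suc by blast
  have "continuous_map (body (S n)) (body \<sigma>) (G_stage (Suc n))"
  proof (rule continuous_map_bodyI[OF stS])
    show "continuous_map (sbd (S n)) (body \<sigma>) (\<lambda>x. G_stage (Suc n) (old x))"
      using Suc by simp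
    fix u assume u: "u \<in> cells (S n)"
    then have "continuous_map (disc (cdim (S n) u)) (body \<sigma>) (G_cell n u)"
    proof (cases rule: cells_S_cases)
      case (Inl s)
      have "continuous_map (disc (cdim (A n) s)) (body \<sigma>) ((\<lambda>z. old (\<theta>' z)) \<circ> cx_char A n s)"
        using continuous_map_cx_char[OF A Inl(2)] continuous_map_old_\<theta>' by (rule continuous_map_compose)
      then show ?thesis
        by (simp add: Inl(1) S_Inl[OF Inl(2)] comp_def G_cell_def)
    next
      case (Inr t)
      then show ?thesis
        using body_pushout(2)[OF \<sigma>, of t] S_Inr(1)[of t] by (simp add: G_cell_def)
    qed
    then show "continuous_map (disc (cdim (S n) u)) (body \<sigma>) (\<lambda>d. G_stage (Suc n) (char_map (S n) u d))"
      unfolding char[OF u] by (simp add: eta_contract_eq)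
  qed
  moreover have "G_stage (Suc n) (j (Suc n) z) = old (\<theta>' (stage_incl (Suc n) z))" if z: "z \<in> topspace (body (A n))" for z
  proof (rule body_pushout(5)[OF st _ _ z])
    fix x assume x: "x \<in> pts (A n)"
    have "j (Suc n) (old x) = old (j n x)"
      unfolding j_Suc by (rule body_map_old[OF st x])
    then show "G_stage (Suc n) (j (Suc n) (old x)) = old (\<theta>' (stage_incl (Suc n) (old x)))"
      using Suc x by (simp del: stack_rec.simps)
  next
    fix s d assume s: "s \<in> cells (A n)" and d: "d \<in> disc_of (A n) s"
    have "j (Suc n) (char_map (A n) s d) = char_map (S n) (enc (Inl_cell s)) d"
      unfolding j_Suc' using body_map_char_map[OF st s d stratum_mor_j] j_stage[of n] s by simp
    then show "G_stage (Suc n) (j (Suc n) (char_map (A n) s d)) = old (\<theta>' (stage_incl (Suc n) (char_map (A n) s d)))"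
      using s by (simp del: stack_rec.simps G_stage.simps add: char G_cell_Inl cx_char_def)
  qed
  ultimately show ?case
    unfolding cellcx_sbd_Suc[OF A] sbd_S_Suc by blast
qed

lemma G: "continuous_map (cx_body S) (body \<sigma>) G"
  and G_stage_incl: "x \<in> pts (S n) \<Longrightarrow> G (stage_incl n x) = G_stage n x"
proof -
  have "continuous_map (cx_body S) (body \<sigma>) G \<and> (\<forall>n. \<forall>x \<in> pts (S n). G (stage_incl n x) = G_stage n x)"
    unfolding G_def by (rule cx_body_colimit(3)[OF is_cellcx_stack]) (use G_stage in simp_all)
  then show "continuous_map (cx_body S) (body \<sigma>) G" "x \<in> pts (S n) \<Longrightarrow> G (stage_incl n x) = G_stage n x"
    by blast+
qed

lemma G_cx_char:
  assumes "u \<in> cells (S n)" "d \<in> disc_of (S n) u"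
  shows "G (cx_char S n u d) = G_cell n u d"
proof -
  have "char_map (S n) u d \<in> pts (S (Suc n))"
    unfolding sbd_S_Suc using assms by (rule char_map_in_body[OF cellcx_stratum[OF is_cellcx_stack]])
  then show ?thesis
    unfolding cx_char_def using G_stage_incl G_stage_char_map[OF _ assms(1)] G_stage by metis
qed

lemma homeomorphic_maps_stack: "homeomorphic_maps (body \<sigma>) (cx_body S) F G"
  unfolding homeomorphic_maps_def
proof (intro conjI ballI continuous_map_F G)
  fix z assume z: "z \<in> topspace (body \<sigma>)"
  show "G (F z) = z"
  proof (rule body_pushout(5)[OF \<sigma> _ _ z])
    fix y assume y: "y \<in> pts \<sigma>"
    obtain n x where x: "x \<in> pts (A n)" "\<theta> y = stage_incl n x"
      using \<theta>_in[OF y] by (auto simp: topspace_cx_body)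
    then have "G (F (old y)) = old (\<theta>' (\<theta> y))"
      using G_stage[of n] j_in by (simp add: F_old[OF y] stack_incl_stage G_stage_incl del: stack_rec.simps)
    then show "G (F (old y)) = old y"
      by (simp add: \<theta>'_\<theta> y)
  next
    fix t d assume t: "t \<in> cells \<sigma>" "d \<in> disc_of \<sigma> t"
    then show "G (F (char_map \<sigma> t d)) = char_map \<sigma> t d"
      using S_Inr(1)[of t] by (simp add: F_char_map G_cx_char G_cell_Inr)
  qed
next
  fix z assume z: "z \<in> body_pts S"
  show "F (G z) = z"
  proof (rule cx_eqI[OF is_cellcx_stack _ _ z])
    fix x assume x: "x \<in> pts (S 0)"
    then have x': "x \<in> pts (A 0)"
      by simp
    have "G (stage_incl 0 x) = old (\<theta>' (stage_incl 0 x))"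
      using G_stage_incl[OF x] by simp
    then show "F (G (stage_incl 0 x)) = stage_incl 0 x"
      using x' stack_incl_stage[OF x']
      by (simp add: F_old \<theta>'_in \<theta>_\<theta>' stage_incl_in_cx_body Let_def)
  next
    fix n u d assume u: "u \<in> cells (S n)" and d: "d \<in> disc_of (S n) u"
    from u show "F (G (cx_char S n u d)) = cx_char S n u d"
    proof (cases rule: cells_S_cases)
      case (Inl s)
      then have "d \<in> disc_of (A n) s"
        using d by (simp add: S_Inl)
      then show ?thesis
        using cx_char_in_cx_body[OF A Inl(2)]
        by (simp add: G_cx_char[OF u d, unfolded Inl(1)] Inl(1) G_cell_Inl F_old \<theta>'_in \<theta>_\<theta>' stack_incl_char[OF Inl(2)])
    next
      case (Inr t)
      then show ?thesis
        using d S_Inr(1)[of t] by (simp add: G_cx_char[OF u d, unfolded Inr(1)] G_cell_Inr F_char_map)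
    qed
  qed
qed

end


section \<open>Colimits of cell complexes\<close>

text \<open>In a sequence of cell complexes whose steps send a cell \<open>s\<close> to \<open>Inl_cell s\<close>, a cell of the colimit
  is represented at the first index at which it occurs.\<close>

abbreviation inl :: "'u::universe \<Rightarrow> 'u" where
  "inl s \<equiv> enc (Inl_cell s)"

primrec cell_incl :: "nat \<Rightarrow> 'u::universe \<Rightarrow> 'u" where
  "cell_incl 0 s = enc (Stage_pt 0 s)"
| "cell_incl (Suc k) s = (if s \<in> range inl then cell_incl k (inv inl s) else enc (Stage_pt (Suc k) s))"

lemma inj_inl: "inj inl"
  by (simp add: inj_def)

lemma inv_inl: "inv inl (inl s) = s"
  by (rule inv_f_f[OF inj_inl])

lemma cell_incl_inl [simp]: "cell_incl (Suc k) (inl s) = cell_incl k s"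
  by (simp add: inv_inl)

declare cell_incl.simps [simp del]

definition colim_stratum ::
  "(nat \<Rightarrow> 'u::universe cellcx) \<Rightarrow> nat \<Rightarrow> 'u topology \<Rightarrow> (nat \<Rightarrow> 'u \<Rightarrow> 'u) \<Rightarrow> 'u stratum" where
  "colim_stratum F n Z i =
     (let C = (\<Union>k. cell_incl k ` cells (F k n))
      in \<lparr>sbd = Z,
          cells = C,
          cdim = (\<lambda>u\<in>C. case dec u of Stage_pt k s \<Rightarrow> cdim (F k n) s),
          att = (\<lambda>u\<in>C. case dec u of Stage_pt k s \<Rightarrow>
            (\<lambda>x\<in>bdry (F k n) s. i k (att (F k n) s x)))\<rparr>)"

primrec colim_rec :: "(nat \<Rightarrow> 'u::universe cellcx) \<Rightarrow> nat \<Rightarrow> 'u stratum \<times> (nat \<Rightarrow> 'u \<Rightarrow> 'u)" where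
  "colim_rec F 0 =
     (let i = (\<lambda>k. \<lambda>x\<in>pts (F 0 0). x) in (colim_stratum F 0 (sbd (F 0 0)) i, i))"
| "colim_rec F (Suc n) =
     (let (\<rho>, i) = colim_rec F n;
          i' = (\<lambda>k. body_map (F k n) (i k) (\<lambda>s\<in>cells (F k n). cell_incl k s))
      in (colim_stratum F (Suc n) (body \<rho>) i', i'))"

definition colim :: "(nat \<Rightarrow> 'u::universe cellcx) \<Rightarrow> 'u cellcx" where
  "colim F n = fst (colim_rec F n)"

definition colim_incl :: "(nat \<Rightarrow> 'u::universe cellcx) \<Rightarrow> nat \<Rightarrow> 'u cellmor" where
  "colim_incl F k =
     Cellmor (F k) (\<lambda>n. snd (colim_rec F n) k) (\<lambda>n. \<lambda>s\<in>cells (F k n). cell_incl k s) (colim F)"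

locale inl_sequence =
  fixes F :: "nat \<Rightarrow> 'u::universe cellcx" and c :: "nat \<Rightarrow> 'u cellmor" and X :: "'u topology"
  assumes c: "c k \<in> hom CELLCX (F k) (F (Suc k))"
    and sbd_0 [simp]: "sbd (F k 0) = X"
    and c_map_0: "cm_map (c k) 0 = (\<lambda>x\<in>topspace X. x)"
    and c_cells: "cm_cells (c k) n = (\<lambda>s\<in>cells (F k n). inl s)"
    and inl_cell: "inl s \<in> cells (F (Suc k) n) \<Longrightarrow> s \<in> cells (F k n)"
begin

lemma c_mor: "is_cellmor (c k)" and c_src [simp]: "cm_src (c k) = F k" and c_tgt [simp]: "cm_tgt (c k) = F (Suc k)"
  using c by (simp_all add: hom_CELLCX)

lemma F: "is_cellcx (F k)"
  using cellmor_src[OF c_mor[of k]] by simp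

lemma c_cell:
  assumes "s \<in> cells (F k n)"
  shows "inl s \<in> cells (F (Suc k) n)" "cdim (F (Suc k) n) (inl s) = cdim (F k n) s"
    and "x \<in> bdry (F k n) s \<Longrightarrow> att (F (Suc k) n) (inl s) x = cm_map (c k) n (att (F k n) s x)"
  using cellmor_cells[OF c_mor, of s k n] assms by (simp_all add: c_cells)

lemma case_cell_incl:
  assumes D: "\<And>k s. s \<in> cells (F k n) \<Longrightarrow> D (Suc k) (inl s) = D k s" and s: "s \<in> cells (F k n)"
  shows "(case dec (cell_incl k s) of Stage_pt m t \<Rightarrow> D m t) = D k s"
  using s
proof (induction k arbitrary: s)
  case (Suc k)
  show ?case
  proof (cases "s \<in> range inl")
    case True
    then obtain s' where "s = inl s'"
      by blast
    with Suc D show ?thesis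
      using inl_cell by simp
  qed (simp add: cell_incl.simps)
qed (simp add: cell_incl.simps)

abbreviation "Q \<equiv> colim F"
abbreviation "i \<equiv> \<lambda>n. snd (colim_rec F n)"

lemma i_0: "i 0 k = (\<lambda>x\<in>topspace X. x)"
  by (simp add: Let_def)

lemma i_Suc: "i (Suc n) k = body_map (F k n) (i n k) (\<lambda>s\<in>cells (F k n). cell_incl k s)"
  by (simp add: split_beta Let_def)

lemma sbd_Q_0 [simp]: "sbd (Q 0) = X"
  by (simp add: colim_def Let_def colim_stratum_def)

lemma sbd_Q_Suc: "sbd (Q (Suc n)) = body (Q n)"
  by (simp add: colim_def split_beta Let_def colim_stratum_def)

lemma Q_eq: "Q n = colim_stratum F n (sbd (Q n)) (i n)"
  by (cases n) (simp_all add: colim_def split_beta Let_def colim_stratum_def)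

lemmas [simp del] = colim_rec.simps

lemma cells_Q: "cells (Q n) = (\<Union>k. cell_incl k ` cells (F k n))"
  by (subst Q_eq) (simp add: colim_stratum_def Let_def)

text \<open>Compatibility of the coprojections \<open>i n k\<close> with the steps. It is needed already for the construction
  of the next stage, where it makes the attaching map of a cell of \<open>Q\<close> independent of the index at which
  the cell is represented.\<close>

definition coherent :: "nat \<Rightarrow> bool" where
  "coherent n \<longleftrightarrow> (\<forall>k. \<forall>x \<in> pts (F k n). i n (Suc k) (cm_map (c k) n x) = i n k x)"

lemma cell_Q:
  assumes n: "coherent n" and s: "s \<in> cells (F k n)"
  shows "cell_incl k s \<in> cells (Q n)" "cdim (Q n) (cell_incl k s) = cdim (F k n) s"
    and "att (Q n) (cell_incl k s) = (\<lambda>x\<in>bdry (F k n) s. i n k (att (F k n) s x))"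
proof -
  show u: "cell_incl k s \<in> cells (Q n)"
    using s by (auto simp: cells_Q)
  have "cdim (Q n) (cell_incl k s) = (case dec (cell_incl k s) of Stage_pt m t \<Rightarrow> cdim (F m n) t)"
    using u unfolding cells_Q by (subst Q_eq) (simp add: colim_stratum_def Let_def)
  also have "\<dots> = cdim (F k n) s"
    by (rule case_cell_incl[where D = "\<lambda>m. cdim (F m n)", OF _ s]) (simp add: c_cell)
  finally show "cdim (Q n) (cell_incl k s) = cdim (F k n) s" .
  have "att (Q n) (cell_incl k s) = (case dec (cell_incl k s) of Stage_pt m t \<Rightarrow>
      (\<lambda>x\<in>bdry (F m n) t. i n m (att (F m n) t x)))"
    using u unfolding cells_Q by (subst Q_eq) (simp add: colim_stratum_def Let_def)
  also have "\<dots> = (\<lambda>x\<in>bdry (F k n) s. i n k (att (F k n) s x))"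
  proof (rule case_cell_incl[where D = "\<lambda>m t. \<lambda>x\<in>bdry (F m n) t. i n m (att (F m n) t x)", OF _ s])
    fix k s assume s: "s \<in> cells (F k n)"
    have "i n (Suc k) (att (F (Suc k) n) (inl s) x) = i n k (att (F k n) s x)"
      if "x \<in> bdry (F k n) s" for x
      using n att_in_sbd[OF cellcx_stratum[OF F] s that] c_cell(3)[OF s that] by (simp add: coherent_def)
    then show "(\<lambda>x\<in>bdry (F (Suc k) n) (inl s). i n (Suc k) (att (F (Suc k) n) (inl s) x)) =
        (\<lambda>x\<in>bdry (F k n) s. i n k (att (F k n) s x))"
      using c_cell(2)[OF s] by (simp cong: restrict_cong)
  qed
  finally show "att (Q n) (cell_incl k s) = (\<lambda>x\<in>bdry (F k n) s. i n k (att (F k n) s x))" .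
qed

lemma stage_Q:
  "coherent n \<and> (\<forall>k. continuous_map (sbd (F k n)) (sbd (Q n)) (i n k) \<and> i n k \<in> extensional (pts (F k n))) \<Longrightarrow>
    is_stratum (Q n) \<and> (\<forall>k. stratum_mor (F k n) (Q n) (i n k) (\<lambda>s\<in>cells (F k n). cell_incl k s))"
proof (intro conjI allI)
  assume i: "coherent n \<and> (\<forall>k. continuous_map (sbd (F k n)) (sbd (Q n)) (i n k) \<and> i n k \<in> extensional (pts (F k n)))"
  then have n: "coherent n"
    by simp
  have "continuous_map (bsphere (cdim (Q n) u)) (sbd (Q n)) (att (Q n) u) \<and>
      att (Q n) u \<in> extensional (bdry (Q n) u)" if uQ: "u \<in> cells (Q n)" for u
  proof -
    obtain k s where u: "u = cell_incl k s" and s: "s \<in> cells (F k n)"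
      using uQ by (auto simp: cells_Q)
    have "continuous_map (bsphere (cdim (F k n) s)) (sbd (Q n)) (i n k \<circ> att (F k n) s)"
      using continuous_map_att[OF cellcx_stratum[OF F] s] i by (intro continuous_map_compose) auto
    then have "continuous_map (bsphere (cdim (F k n) s)) (sbd (Q n))
        (\<lambda>x\<in>bdry (F k n) s. i n k (att (F k n) s x))"
      by (rule continuous_map_eq) simp
    then show ?thesis
      by (simp add: u cell_Q[OF n s])
  qed
  moreover have "cdim (Q n) \<in> extensional (cells (Q n))" "att (Q n) \<in> extensional (cells (Q n))"
    by (subst (1 2) Q_eq; simp add: colim_stratum_def Let_def)+
  ultimately show "is_stratum (Q n)"
    unfolding is_stratum_def by blast
  fix k
  have "\<forall>s \<in> cells (F k n). cdim (Q n) (cell_incl k s) = cdim (F k n) s \<and>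
      (\<forall>x \<in> bdry (F k n) s. i n k (att (F k n) s x) = att (Q n) (cell_incl k s) x)"
    using cell_Q[OF n] by simp
  then show "stratum_mor (F k n) (Q n) (i n k) (\<lambda>s\<in>cells (F k n). cell_incl k s)"
    using i cell_Q(1)[OF n] unfolding stratum_mor_def by (simp add: PiE_def Pi_def)
qed

lemma i_stage:
  "coherent n \<and> (\<forall>k. continuous_map (sbd (F k n)) (sbd (Q n)) (i n k) \<and> i n k \<in> extensional (pts (F k n)))"
proof (induction n)
  case 0
  have c0: "continuous_map X X (\<lambda>x\<in>topspace X. x)"
    by (rule continuous_map_eq[OF continuous_map_id]) simp
  show ?case
    unfolding coherent_def i_0 c_map_0 sbd_0 sbd_Q_0
    by (intro conjI allI ballI c0) (simp_all only: restrict_apply' restrict_extensional)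
next
  case (Suc n)
  then have n: "coherent n"
    by simp
  note st = cellcx_stratum[OF F]
  have m: "is_stratum (Q n)" "stratum_mor (F k n) (Q n) (i n k) (\<lambda>s\<in>cells (F k n). cell_incl k s)" for k
    using stage_Q[OF Suc] by blast+
  have "continuous_map (body (F k n)) (body (Q n)) (i (Suc n) k)" for k
    unfolding i_Suc by (rule continuous_map_body_map[OF st m])
  moreover have "i (Suc n) (Suc k) (cm_map (c k) (Suc n) z) = i (Suc n) k z" if "z \<in> topspace (body (F k n))" for k z
    using st that
  proof (cases rule: body_cases)
    case (old x)
    then show ?thesis
      using n cellmor_map_in[OF c_mor, of x k n] unfolding i_Suc coherent_def
      by (simp add: cellmor_Suc[OF c_mor] body_map_old[OF st])
  next
    case (cell s d)
    then show ?thesis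
      unfolding i_Suc
      by (simp add: cellmor_Suc[OF c_mor] body_map_cell_pt[OF st] c_cells c_cell)
  qed
  ultimately show ?case
    unfolding coherent_def cellcx_sbd_Suc[OF F] sbd_Q_Suc i_Suc
    by (intro conjI allI ballI) (simp_all only: body_map_extensional)
qed

lemmas coherent = conjunct1[OF i_stage]

lemma stratum_mor_i: "stratum_mor (F k n) (Q n) (i n k) (\<lambda>s\<in>cells (F k n). cell_incl k s)"
  using stage_Q[OF i_stage] by blast

lemma is_cellcx_Q: "is_cellcx Q"
proof -
  have "\<exists>x \<in> bdry (Q (Suc n)) u. att (Q (Suc n)) u x \<notin> range old"
    if uQ: "u \<in> cells (Q (Suc n))" for n u
  proof -
    obtain k s where u: "u = cell_incl k s" and s: "s \<in> cells (F k (Suc n))"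
      using uQ by (auto simp: cells_Q)
    obtain x where x: "x \<in> bdry (F k (Suc n)) s" "att (F k (Suc n)) s x \<notin> range old"
      using F s unfolding is_cellcx_iff by blast
    have "att (F k (Suc n)) s x \<in> topspace (body (F k n))"
      using att_in_sbd[OF cellcx_stratum[OF F] s x(1)] by (simp add: cellcx_sbd_Suc[OF F])
    then have "i (Suc n) k (att (F k (Suc n)) s x) \<notin> range old"
      unfolding i_Suc using body_map_in_range_old[OF cellcx_stratum[OF F]] x(2) by blast
    with x(1) show ?thesis
      unfolding u cell_Q[OF coherent s] by (intro bexI[of _ x]) (simp_all only: restrict_apply' simp_thms)
  qed
  then show ?thesis
    using stage_Q[OF i_stage] by (simp add: is_cellcx_iff connected_strata_def sbd_Q_Suc)
qed

lemma colim_incl_sel [simp]: "cm_src (colim_incl F k) = F k" "cm_tgt (colim_incl F k) = Q"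
  "cm_map (colim_incl F k) n = i n k" "cm_cells (colim_incl F k) n = (\<lambda>s\<in>cells (F k n). cell_incl k s)"
  by (simp_all add: colim_incl_def)

lemma is_cellmor_colim_incl: "is_cellmor (colim_incl F k)"
  unfolding is_cellmor_def colim_incl_sel by (intro conjI allI F is_cellcx_Q stratum_mor_i i_Suc)

lemma colim_incl_step: "Cmp CELLCX (colim_incl F (Suc k)) (c k) = colim_incl F k"
proof (rule cellmor_eqI)
  show "is_cellmor (Cmp CELLCX (colim_incl F (Suc k)) (c k))"
    by (rule cellmor_Cmp[OF c_mor is_cellmor_colim_incl]) simp
  show "is_cellmor (colim_incl F k)"
    by (rule is_cellmor_colim_incl)
  have "compose (pts (F k 0)) (i 0 (Suc k)) (cm_map (c k) 0) = i 0 k"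
    unfolding c_map_0 i_0 sbd_0 by (simp add: compose_def fun_eq_iff restrict_def)
  then show "cm_map (Cmp CELLCX (colim_incl F (Suc k)) (c k)) 0 = cm_map (colim_incl F k) 0"
    by (simp only: Cmp_CELLCX_sel colim_incl_sel c_src)
  fix n s assume "s \<in> cells (cm_src (colim_incl F k) n)"
  then show "cm_cells (Cmp CELLCX (colim_incl F (Suc k)) (c k)) n s = cm_cells (colim_incl F k) n s"
    by (simp add: compose_eq c_cells c_cell)
qed simp_all

end

locale inl_cocone = inl_sequence F c X
  for F :: "nat \<Rightarrow> 'u::universe cellcx" and c :: "nat \<Rightarrow> 'u cellmor" and X +
  fixes R :: "'u cellcx" and \<kappa> :: "nat \<Rightarrow> 'u cellmor"
  assumes \<kappa>: "\<kappa> k \<in> hom CELLCX (F k) R" and \<kappa>_step: "Cmp CELLCX (\<kappa> (Suc k)) (c k) = \<kappa> k"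
begin

lemma \<kappa>_mor: "is_cellmor (\<kappa> k)" and \<kappa>_src [simp]: "cm_src (\<kappa> k) = F k" and \<kappa>_tgt [simp]: "cm_tgt (\<kappa> k) = R"
  using \<kappa> by (simp_all add: hom_CELLCX)

lemma \<kappa>_cells_step: "s \<in> cells (F k n) \<Longrightarrow> cm_cells (\<kappa> (Suc k)) n (inl s) = cm_cells (\<kappa> k) n s"
  using arg_cong[OF \<kappa>_step[of k], where f = "\<lambda>\<phi>. cm_cells \<phi> n s"] by (simp add: compose_eq c_cells)

lemma \<kappa>_map_0: "x \<in> topspace X \<Longrightarrow> cm_map (\<kappa> k) 0 x = cm_map (\<kappa> 0) 0 x"
proof (induction k)
  case (Suc k)
  then show ?case
    using arg_cong[OF \<kappa>_step[of k], where f = "\<lambda>\<phi>. cm_map \<phi> 0 x"] by (simp add: compose_eq c_map_0 sbd_0)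
qed simp

definition desc_cells :: "nat \<Rightarrow> 'u \<Rightarrow> 'u" where
  "desc_cells n = (\<lambda>u\<in>cells (Q n). case dec u of Stage_pt k s \<Rightarrow> cm_cells (\<kappa> k) n s)"

primrec desc_map :: "nat \<Rightarrow> 'u \<Rightarrow> 'u" where
  "desc_map 0 = cm_map (\<kappa> 0) 0"
| "desc_map (Suc n) = body_map (Q n) (desc_map n) (desc_cells n)"

definition desc :: "'u cellmor" where
  "desc = Cellmor Q desc_map desc_cells R"

lemma desc_cells_incl:
  assumes s: "s \<in> cells (F k n)"
  shows "desc_cells n (cell_incl k s) = cm_cells (\<kappa> k) n s"
  using case_cell_incl[where D = "\<lambda>k. cm_cells (\<kappa> k) n", OF \<kappa>_cells_step s] s
  by (simp add: desc_cells_def cells_Q) blast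

lemma stratum_mor_desc:
  assumes h: "continuous_map (sbd (Q n)) (sbd (R n)) (desc_map n)" "desc_map n \<in> extensional (pts (Q n))"
    and i: "\<And>k x. x \<in> pts (F k n) \<Longrightarrow> desc_map n (i n k x) = cm_map (\<kappa> k) n x"
  shows "stratum_mor (Q n) (R n) (desc_map n) (desc_cells n)"
proof -
  have "desc_cells n u \<in> cells (R n) \<and> cdim (R n) (desc_cells n u) = cdim (Q n) u \<and>
      (\<forall>x \<in> bdry (Q n) u. desc_map n (att (Q n) u x) = att (R n) (desc_cells n u) x)"
    if uQ: "u \<in> cells (Q n)" for u
  proof -
    obtain k s where u: "u = cell_incl k s" and s: "s \<in> cells (F k n)"
      using uQ by (auto simp: cells_Q)
    show ?thesis
      using cellmor_cells[OF \<kappa>_mor, of s k n] s i[OF att_in_sbd[OF cellcx_stratum[OF F] s]]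
      by (simp add: u cell_Q[OF coherent s] desc_cells_incl[OF s])
  qed
  moreover have "desc_cells n \<in> extensional (cells (Q n))"
    by (simp add: desc_cells_def)
  ultimately show ?thesis
    using h unfolding stratum_mor_def by (simp add: PiE_def Pi_def)
qed

lemma desc_stage:
  "continuous_map (sbd (Q n)) (sbd (R n)) (desc_map n) \<and> desc_map n \<in> extensional (pts (Q n)) \<and>
   (\<forall>k. \<forall>x \<in> pts (F k n). desc_map n (i n k x) = cm_map (\<kappa> k) n x)"
proof (induction n)
  case 0
  have "cm_map (\<kappa> 0) 0 (i 0 k x) = cm_map (\<kappa> k) 0 x" if x: "x \<in> pts (F k 0)" for k x
    using \<kappa>_map_0[of x k] x by (simp add: i_0)
  then show ?case
    using cellmor_mor[OF \<kappa>_mor, of 0 0] by (simp add: stratum_mor_def)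
next
  case (Suc n)
  note stF = cellcx_stratum[OF F] and stQ = cellcx_stratum[OF is_cellcx_Q] and R = cellmor_tgt[OF \<kappa>_mor[of 0], simplified]
  have m: "stratum_mor (Q n) (R n) (desc_map n) (desc_cells n)"
    by (rule stratum_mor_desc) (use Suc in auto)
  have "desc_map (Suc n) (i (Suc n) k z) = cm_map (\<kappa> k) (Suc n) z" if z: "z \<in> topspace (body (F k n))" for k z
    using stF z
  proof (cases rule: body_cases)
    case (old x)
    have "i n k x \<in> pts (Q n)"
      using i_stage[of n] old(1) by (auto simp: continuous_map_def)
    then show ?thesis
      using Suc old unfolding i_Suc by (simp add: cellmor_Suc[OF \<kappa>_mor] body_map_old[OF stF] body_map_old[OF stQ])
  next
    case (cell s d)
    note cq = cell_Q[OF coherent cell(1)]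
    have "body_map (Q n) (desc_map n) (desc_cells n) (enc (Cell_pt (cell_incl k s) d)) = enc (Cell_pt (desc_cells n (cell_incl k s)) d)"
      using cell by (intro body_map_cell_pt[OF stQ cq(1)]) (simp_all add: cq)
    then show ?thesis
      using cell unfolding i_Suc by (simp add: cellmor_Suc[OF \<kappa>_mor] body_map_cell_pt[OF stF] desc_cells_incl)
  qed
  then show ?case
    using continuous_map_body_map[OF stQ cellcx_stratum[OF R] m]
    unfolding sbd_Q_Suc cellcx_sbd_Suc[OF R] cellcx_sbd_Suc[OF F] by (simp add: body_map_extensional)
qed

lemma is_cellmor_desc: "is_cellmor desc"
proof -
  have "stratum_mor (Q n) (R n) (desc_map n) (desc_cells n)" for n
    by (rule stratum_mor_desc) (use desc_stage[of n] in auto)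
  then show ?thesis
    using cellmor_tgt[OF \<kappa>_mor[of 0]] by (simp add: is_cellmor_def desc_def is_cellcx_Q)
qed

lemma desc_incl: "Cmp CELLCX desc (colim_incl F k) = \<kappa> k"
proof (rule cellmor_eqI)
  show "is_cellmor (Cmp CELLCX desc (colim_incl F k))"
    by (rule cellmor_Cmp[OF is_cellmor_colim_incl is_cellmor_desc]) (simp add: desc_def)
  show "is_cellmor (\<kappa> k)"
    by (rule \<kappa>_mor)
  show "cm_map (Cmp CELLCX desc (colim_incl F k)) 0 = cm_map (\<kappa> k) 0"
  proof (rule extensionalityI[where A = "pts (F k 0)"])
    show "cm_map (\<kappa> k) 0 \<in> extensional (pts (F k 0))"
      using cellmor_mor[OF \<kappa>_mor, of k 0] by (simp add: stratum_mor_def)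
    fix x assume "x \<in> pts (F k 0)"
    then show "cm_map (Cmp CELLCX desc (colim_incl F k)) 0 x = cm_map (\<kappa> k) 0 x"
      using desc_stage[of 0] by (simp add: compose_eq desc_def del: desc_map.simps)
  qed (simp add: compose_def)
  fix n s assume "s \<in> cells (cm_src (\<kappa> k) n)"
  then show "cm_cells (Cmp CELLCX desc (colim_incl F k)) n s = cm_cells (\<kappa> k) n s"
    by (simp add: compose_eq desc_def desc_cells_incl)
qed (simp_all add: desc_def)

lemma desc_unique:
  assumes h: "h \<in> hom CELLCX Q R" and e: "\<And>k. Cmp CELLCX h (colim_incl F k) = \<kappa> k"
  shows "h = desc"
proof (rule cellmor_eqI[OF _ is_cellmor_desc])
  show hm: "is_cellmor h"
    using h by (simp add: hom_CELLCX)
  show "cm_map h 0 = cm_map desc 0"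
  proof (rule extensionalityI[where A = "topspace X"])
    show "cm_map h 0 \<in> extensional (topspace X)"
      using cellmor_mor[OF hm, of 0] h by (simp add: stratum_mor_def hom_CELLCX)
    show "cm_map desc 0 \<in> extensional (topspace X)"
      using desc_stage[of 0] by (simp add: desc_def)
    fix x assume "x \<in> topspace X"
    then show "cm_map h 0 x = cm_map desc 0 x"
      using arg_cong[OF e[of 0], where f = "\<lambda>\<phi>. cm_map \<phi> 0 x"] by (simp add: compose_eq desc_def i_0)
  qed
  fix n u assume "u \<in> cells (cm_src desc n)"
  then obtain k s where u: "u = cell_incl k s" and s: "s \<in> cells (F k n)"
    by (auto simp: cells_Q desc_def)
  show "cm_cells h n u = cm_cells desc n u"
    using arg_cong[OF e[of k], where f = "\<lambda>\<phi>. cm_cells \<phi> n s"] s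
    by (simp add: compose_eq u desc_def desc_cells_incl)
qed (use h in \<open>simp_all add: hom_CELLCX desc_def\<close>)

end

context inl_sequence
begin

text \<open>The steps act on cells by an injection, so a cell of \<open>Q\<close> is a cell of some \<open>F k\<close>, unique up to
  steps. A morphism from \<open>Q\<close> is therefore determined on cells, hence on stages, by its composites with
  the coprojections.\<close>

lemma is_seq_colimit_colim: "is_seq_colimit CELLCX F c Q (colim_incl F)"
proof -
  have "\<exists>!h. h \<in> hom CELLCX Q R \<and> (\<forall>k. Cmp CELLCX h (colim_incl F k) = \<kappa> k)"
    if "\<And>k. \<kappa> k \<in> hom CELLCX (F k) R" "\<And>k. Cmp CELLCX (\<kappa> (Suc k)) (c k) = \<kappa> k" for R \<kappa>
  proof -
    interpret inl_cocone F c X R \<kappa>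
      by standard (use that in auto)
    have "desc \<in> hom CELLCX Q R"
      using is_cellmor_desc by (simp add: hom_CELLCX desc_def)
    then show ?thesis
      using desc_incl desc_unique by blast
  qed
  then show ?thesis
    using is_cellcx_Q is_cellmor_colim_incl colim_incl_step
    by (simp add: is_seq_colimit_def hom_CELLCX) (simp add: CELLCX_def)
qed

end


text \<open>The functor taking bodies preserves sequential colimits: a map from a body to \<open>Z\<close> is the same as
  a morphism to the cell complex \<open>K\<close> of the identity of \<open>Z\<close>.\<close>

locale body_of_colimit =
  fixes F :: "nat \<Rightarrow> 'u::universe cellcx" and c :: "nat \<Rightarrow> 'u cellmor" and Q :: "'u cellcx" and \<iota> :: "nat \<Rightarrow> 'u cellmor"
  assumes c: "c k \<in> hom CELLCX (F k) (F (Suc k))" and colim: "is_seq_colimit CELLCX F c Q \<iota>"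
begin

lemma c_mor: "is_cellmor (c k)" and c_src [simp]: "cm_src (c k) = F k" and c_tgt [simp]: "cm_tgt (c k) = F (Suc k)"
  using c by (simp_all add: hom_CELLCX)

lemma \<iota>_mor: "is_cellmor (\<iota> k)" and \<iota>_src [simp]: "cm_src (\<iota> k) = F k" and \<iota>_tgt [simp]: "cm_tgt (\<iota> k) = Q"
  using colim by (simp_all add: is_seq_colimit_def hom_CELLCX)

lemma \<iota>_step: "Cmp CELLCX (\<iota> (Suc k)) (c k) = \<iota> k"
  using colim by (simp add: is_seq_colimit_def)

lemma Q: "is_cellcx Q"
  using cellmor_tgt[OF \<iota>_mor[of 0]] by simp

lemma F: "is_cellcx (F k)"
  using cellmor_src[OF \<iota>_mor[of k]] by simp

lemma cx_map_\<iota>_step: "z \<in> body_pts (F k) \<Longrightarrow> cx_map (\<iota> (Suc k)) (cx_map (c k) z) = cx_map (\<iota> k) z"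
  using cx_map_Cmp[OF c_mor \<iota>_mor, of k "Suc k" z] by (simp add: \<iota>_step)

text \<open>The morphism from \<open>A\<close> to \<open>K\<close> of the identity of \<open>Z\<close> that corresponds to \<open>g : cx_body A \<rightarrow> Z\<close>.\<close>

definition classify :: "'u topology \<Rightarrow> 'u cellcx \<Rightarrow> ('u \<Rightarrow> 'u) \<Rightarrow> 'u cellmor" where
  "classify Z A g = lift A (Idm TOP Z) (\<lambda>x\<in>pts (A 0). g (stage_incl 0 x)) g"

lemma square_classify:
  assumes A: "is_cellcx A" and g: "continuous_map (cx_body A) Z g"
  shows "square_from_U A (Idm TOP Z) (\<lambda>x\<in>pts (A 0). g (stage_incl 0 x)) g"
proof
  show "Idm TOP Z \<in> Mor TOP"
    using Idm_TOP_hom by (simp add: hom_TOP)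
  have g0: "continuous_map (sbd (A 0)) Z (\<lambda>x\<in>pts (A 0). g (stage_incl 0 x))"
    using cx_body_colimit(1)[OF A] g by (rule continuous_map_composeI) simp
  then show "continuous_map (sbd (A 0)) (cdom (Idm TOP Z)) (\<lambda>x\<in>pts (A 0). g (stage_incl 0 x))"
    by simp
  fix x assume x: "x \<in> pts (A 0)"
  then have "g (stage_incl 0 x) \<in> topspace Z"
    using g stage_incl_in_cx_body[where A = A, OF x] by (auto simp: continuous_map_def)
  with x show "cfun (Idm TOP Z) ((\<lambda>x\<in>pts (A 0). g (stage_incl 0 x)) x) = g (stage_incl 0 x)"
    by simp
qed (use A g in simp_all)

lemma classify_sel [simp]: "cm_src (classify Z A g) = A" "cm_tgt (classify Z A g) = K_ob (Idm TOP Z)"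
  "cm_map (classify Z A g) 0 = (\<lambda>x\<in>pts (A 0). g (stage_incl 0 x))"
  by (simp_all add: classify_def lift_def)

lemma is_cellmor_classify: "is_cellcx A \<Longrightarrow> continuous_map (cx_body A) Z g \<Longrightarrow> is_cellmor (classify Z A g)"
  unfolding classify_def by (rule square_from_U.is_cellmor_lift[OF square_classify])

lemma E_classify:
  "is_cellcx A \<Longrightarrow> continuous_map (cx_body A) Z g \<Longrightarrow> z \<in> body_pts A \<Longrightarrow>
    cfun (E_ob (Idm TOP Z)) (cx_map (classify Z A g) z) = g z"
  unfolding classify_def by (rule square_from_U.E_ob_cx_map_lift[OF square_classify])

lemma Cmp_classify:
  assumes \<phi>: "is_cellmor \<phi>" and g: "continuous_map (cx_body (cm_tgt \<phi>)) Z g" "continuous_map (cx_body (cm_src \<phi>)) Z g'"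
    and e: "\<And>z. z \<in> body_pts (cm_src \<phi>) \<Longrightarrow> g (cx_map \<phi> z) = g' z"
  shows "Cmp CELLCX (classify Z (cm_tgt \<phi>) g) \<phi> = classify Z (cm_src \<phi>) g'"
  unfolding classify_def[of _ "cm_src \<phi>"]
proof (rule square_from_U.lift_unique[OF square_classify[OF cellmor_src[OF \<phi>] g(2)]])
  note h = is_cellmor_classify[OF cellmor_tgt[OF \<phi>] g(1)]
  show "is_cellmor (Cmp CELLCX (classify Z (cm_tgt \<phi>) g) \<phi>)"
    by (rule cellmor_Cmp[OF \<phi> h]) simp
  show "cm_map (Cmp CELLCX (classify Z (cm_tgt \<phi>) g) \<phi>) 0 = (\<lambda>x\<in>pts (cm_src \<phi> 0). g' (stage_incl 0 x))"
    using e[OF stage_incl_in_cx_body] cellmor_map_in[OF \<phi>]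
    by (simp add: compose_def cx_map_stage_incl[OF \<phi>, symmetric] cong: restrict_cong)
  fix z assume z: "z \<in> body_pts (cm_src \<phi>)"
  then have "cx_map \<phi> z \<in> body_pts (cm_tgt \<phi>)"
    using continuous_map_cx_map[OF \<phi>] by (auto simp: continuous_map_def)
  then show "cfun (E_ob (Idm TOP Z)) (cx_map (Cmp CELLCX (classify Z (cm_tgt \<phi>) g) \<phi>) z) = g' z"
    using e[OF z] cx_map_Cmp[OF \<phi> h _ z] by (simp only: classify_sel E_classify[OF cellmor_tgt[OF \<phi>] g(1)])
qed simp_all

lemma classify_cocone:
  fixes Z :: "'u topology"
  assumes g: "\<And>k. continuous_map (cx_body (F k)) Z (g k)"
    and e: "\<And>k z. z \<in> body_pts (F k) \<Longrightarrow> g (Suc k) (cx_map (c k) z) = g k z"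
  shows "\<exists>!\<phi>. \<phi> \<in> hom CELLCX Q (K_ob (Idm TOP Z)) \<and> (\<forall>k. Cmp CELLCX \<phi> (\<iota> k) = classify Z (F k) (g k))"
proof -
  have "classify Z (F k) (g k) \<in> hom CELLCX (F k) (K_ob (Idm TOP Z))" for k
    using is_cellmor_classify[OF F g] by (simp add: hom_CELLCX)
  moreover have "Cmp CELLCX (classify Z (F (Suc k)) (g (Suc k))) (c k) = classify Z (F k) (g k)" for k
    using Cmp_classify[OF c_mor[of k], of Z "g (Suc k)" "g k"] g e by simp
  moreover have "K_ob (Idm TOP Z) \<in> Obj CELLCX"
    by (simp add: CELLCX_def is_cellcx_K_ob)
  ultimately show ?thesis
    using colim unfolding is_seq_colimit_def by (elim conjE allE impE) auto
qed

lemma body_colimit_exists: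
  fixes Z :: "'u topology"
  assumes g: "\<And>k. continuous_map (cx_body (F k)) Z (g k)"
    and e: "\<And>k z. z \<in> body_pts (F k) \<Longrightarrow> g (Suc k) (cx_map (c k) z) = g k z"
  obtains h where "continuous_map (cx_body Q) Z h" "\<And>k z. z \<in> body_pts (F k) \<Longrightarrow> h (cx_map (\<iota> k) z) = g k z"
proof -
  let ?K = "K_ob (Idm TOP Z)"
  have I: "Idm TOP Z \<in> Mor TOP"
    using Idm_TOP_hom by (simp add: hom_TOP)
  obtain \<phi> where \<phi>: "\<phi> \<in> hom CELLCX Q ?K" "\<And>k. Cmp CELLCX \<phi> (\<iota> k) = classify Z (F k) (g k)"
    using classify_cocone[of Z g] g e by blast
  then have m: "is_cellmor \<phi>" "cm_src \<phi> = Q" "cm_tgt \<phi> = ?K"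
    by (simp_all add: hom_CELLCX)
  have "continuous_map (cx_body Q) (cx_body ?K) (cx_map \<phi>)"
    using continuous_map_cx_map[OF m(1)] by (simp add: m)
  moreover have "continuous_map (cx_body ?K) Z (cfun (E_ob (Idm TOP Z)))"
    using E_ob_Mor[OF I] by (simp add: Mor_TOP)
  ultimately have "continuous_map (cx_body Q) Z (cfun (E_ob (Idm TOP Z)) \<circ> cx_map \<phi>)"
    by (rule continuous_map_compose)
  moreover have "(cfun (E_ob (Idm TOP Z)) \<circ> cx_map \<phi>) (cx_map (\<iota> k) z) = g k z" if "z \<in> body_pts (F k)" for k z
    using cx_map_Cmp[OF \<iota>_mor m(1), of k z] E_classify[OF F g that] that m by (simp add: \<phi>(2))
  ultimately show thesis
    by (rule that)
qed

lemma body_colimit_unique: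
  fixes Z :: "'u topology"
  assumes h: "continuous_map (cx_body Q) Z h" "continuous_map (cx_body Q) Z h'"
    and e: "\<And>k z. z \<in> body_pts (F k) \<Longrightarrow> h (cx_map (\<iota> k) z) = h' (cx_map (\<iota> k) z)"
    and z: "z \<in> body_pts Q"
  shows "h z = h' z"
proof -
  let ?K = "K_ob (Idm TOP Z)" and ?g = "\<lambda>k z. h (cx_map (\<iota> k) z)"
  have g: "continuous_map (cx_body (F k)) Z (?g k)" for k
    using continuous_map_cx_map[OF \<iota>_mor, of k] h(1) by (auto intro: continuous_map_composeI)

  have "classify Z Q h \<in> hom CELLCX Q ?K" "classify Z Q h' \<in> hom CELLCX Q ?K"
    using is_cellmor_classify[OF Q] h by (simp_all add: hom_CELLCX)
  moreover have "Cmp CELLCX (classify Z Q h) (\<iota> k) = classify Z (F k) (?g k)"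
    "Cmp CELLCX (classify Z Q h') (\<iota> k) = classify Z (F k) (?g k)" for k
    using Cmp_classify[OF \<iota>_mor[of k], of Z _ "?g k"] h g e by simp_all
  moreover have "\<exists>!\<phi>. \<phi> \<in> hom CELLCX Q ?K \<and> (\<forall>k. Cmp CELLCX \<phi> (\<iota> k) = classify Z (F k) (?g k))"
    by (rule classify_cocone[OF g]) (simp add: cx_map_\<iota>_step)
  ultimately have "classify Z Q h = classify Z Q h'"
    by blast
  then show ?thesis
    using E_classify[OF Q h(1) z] E_classify[OF Q h(2) z] by simp
qed

end


section \<open>Composition of cell complexes\<close>

locale composing =
  fixes A B :: "'u::universe cellcx"
  assumes A: "is_cellcx A" and B: "is_cellcx B" and AB: "sbd (B 0) = cx_body A"
begin

abbreviation "stage \<equiv> comp_stage B A"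
abbreviation "\<theta> \<equiv> comp_theta B A"
abbreviation "step \<equiv> comp_step B A"

lemma stage_0: "stage 0 = A" and \<theta>_0: "\<theta> 0 = (\<lambda>y\<in>pts (B 0). y)"
  by (simp_all add: comp_stage_def comp_theta_def)

lemma stage_Suc: "stage (Suc k) = stack (stage k) (transport (\<theta> k) (cx_body (stage k)) (B k))"
  by (simp add: comp_stage_def comp_theta_def split_beta Let_def)

lemma \<theta>_Suc: "\<theta> (Suc k) = compose (topspace (body (B k)))
    (stack_ident (stage k) (transport (\<theta> k) (cx_body (stage k)) (B k))) (body_map (B k) (\<theta> k) id)"
  by (simp add: comp_stage_def comp_theta_def split_beta Let_def)

text \<open>Each identification is built from the previous one; being a homeomorphism is what allows the next
  stratum of \<open>B\<close> to be composed.\<close>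

lemma homeomorphic_\<theta>: "is_cellcx (stage k) \<and> (\<exists>\<theta>'. homeomorphic_maps (sbd (B k)) (cx_body (stage k)) (\<theta> k) \<theta>')"
proof (induction k)
  case 0
  have "continuous_map (cx_body A) (cx_body A) (\<lambda>y\<in>body_pts A. y)"
    by (rule continuous_map_eq[OF continuous_map_id]) simp
  then have "homeomorphic_maps (cx_body A) (cx_body A) (\<lambda>y\<in>body_pts A. y) (\<lambda>y\<in>body_pts A. y)"
    unfolding homeomorphic_maps_def by (intro conjI ballI) (simp_all only: restrict_apply')
  then show ?case
    unfolding stage_0 \<theta>_0 AB using A by blast
next
  case (Suc k)
  then obtain \<theta>' where \<theta>': "homeomorphic_maps (sbd (B k)) (cx_body (stage k)) (\<theta> k) \<theta>'"
    by blast
  interpret stacking_along "stage k" "B k" "\<theta> k" \<theta>'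
    using Suc cellcx_stratum[OF B] \<theta>' by unfold_locales auto
  show ?case
    using is_cellcx_stack homeomorphic_maps_stack
    unfolding stage_Suc \<theta>_Suc F_def cellcx_sbd_Suc[OF B] by blast
qed

definition \<theta>' :: "nat \<Rightarrow> 'u \<Rightarrow> 'u" where
  "\<theta>' k = (SOME \<theta>'. homeomorphic_maps (sbd (B k)) (cx_body (stage k)) (\<theta> k) \<theta>')"

lemma \<theta>': "homeomorphic_maps (sbd (B k)) (cx_body (stage k)) (\<theta> k) (\<theta>' k)"
  unfolding \<theta>'_def using homeomorphic_\<theta> by (metis someI_ex)

lemma stacking_step: "stacking_along (stage k) (B k) (\<theta> k) (\<theta>' k)"
  using homeomorphic_\<theta> cellcx_stratum[OF B] \<theta>' by unfold_locales auto

lemma step_hom: "step k \<in> hom CELLCX (stage k) (stage (Suc k))"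
proof -
  interpret stacking_along "stage k" "B k" "\<theta> k" "\<theta>' k"
    by (rule stacking_step)
  show ?thesis
    using is_cellmor_stack_incl by (simp add: hom_CELLCX comp_step_def stage_Suc)
qed

lemma sbd_stage_0: "sbd (stage k 0) = sbd (A 0)"
proof (induction k)
  case (Suc k)
  interpret stacking_along "stage k" "B k" "\<theta> k" "\<theta>' k"
    by (rule stacking_step)
  show ?case
    using Suc sbd_S_0 by (simp add: stage_Suc)
qed (simp add: stage_0)

sublocale inl_sequence stage step "sbd (A 0)"
proof
  fix k n s
  interpret stacking_along "stage k" "B k" "\<theta> k" "\<theta>' k"
    by (rule stacking_step)
  show "step k \<in> hom CELLCX (stage k) (stage (Suc k))"
    by (rule step_hom)
  show "sbd (stage k 0) = sbd (A 0)"
    by (rule sbd_stage_0)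
  show "cm_map (step k) 0 = (\<lambda>x\<in>pts (A 0). x)"
    unfolding comp_step_def stack_incl_sel j_0 sbd_stage_0 ..
  show "cm_cells (step k) n = (\<lambda>s\<in>cells (stage k n). inl s)"
    by (simp add: comp_step_def)
  show "s \<in> cells (stage k n)" if "inl s \<in> cells (stage (Suc k) n)"
    using that unfolding stage_Suc cells_S by auto
qed

abbreviation "BA \<equiv> cx_comp B A"

definition \<iota> :: "nat \<Rightarrow> 'u cellmor" where
  "\<iota> = snd (comp_cocone B A)"

text \<open>The choice in the definition of \<open>B * A\<close> is from a nonempty set, to which the colimit constructed
  above belongs.\<close>

lemma cx_comp_colimit:
  "is_seq_colimit CELLCX stage step BA \<iota>" "sbd (BA 0) = sbd (A 0)" "cm_map (\<iota> k) 0 = (\<lambda>x\<in>pts (A 0). x)"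
proof -
  let ?P = "\<lambda>(Q, \<iota>). is_seq_colimit CELLCX stage step Q \<iota> \<and>
     sbd (Q 0) = sbd (A 0) \<and> (\<forall>k. cm_map (\<iota> k) 0 = (\<lambda>x\<in>pts (A 0). x))"
  have "?P (colim stage, colim_incl stage)"
    using is_seq_colimit_colim by (simp only: prod.case sbd_Q_0 colim_incl_sel i_0 simp_thms)
  then have "?P (comp_cocone B A)"
    unfolding comp_cocone_def by (rule someI[where P = ?P])
  then show "is_seq_colimit CELLCX stage step BA \<iota>" "sbd (BA 0) = sbd (A 0)"
    "cm_map (\<iota> k) 0 = (\<lambda>x\<in>pts (A 0). x)"
    by (simp_all add: split_beta cx_comp_def \<iota>_def)
qed

sublocale BA: body_of_colimit stage step BA \<iota>
  by standard (rule step_hom, rule cx_comp_colimit)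

lemma \<theta>_old: "y \<in> pts (B k) \<Longrightarrow> \<theta> (Suc k) (old y) = cx_map (step k) (\<theta> k y)"
proof -
  interpret stacking_along "stage k" "B k" "\<theta> k" "\<theta>' k"
    by (rule stacking_step)
  show "y \<in> pts (B k) \<Longrightarrow> \<theta> (Suc k) (old y) = cx_map (step k) (\<theta> k y)"
    using F_old by (simp add: \<theta>_Suc F_def comp_step_def)
qed

lemma \<theta>_char_map:
  assumes t: "t \<in> cells (B k)"
  shows "\<exists>m. \<exists>u \<in> cells (stage (Suc k) m). cdim (stage (Suc k) m) u = cdim (B k) t \<and>
    (\<forall>d \<in> disc_of (B k) t. \<theta> (Suc k) (char_map (B k) t d) = cx_char (stage (Suc k)) m u d)"
proof -
  interpret stacking_along "stage k" "B k" "\<theta> k" "\<theta>' k"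
    by (rule stacking_step)
  show ?thesis
    unfolding \<theta>_Suc F_def[symmetric] stage_Suc
    using F_char_map[OF t] S_Inr(1)[of t] t by (intro exI[of _ "L t"] bexI[of _ "enc (Inr_cell t)"]) simp_all
qed

lemma \<theta>_in: "y \<in> pts (B k) \<Longrightarrow> \<theta> k y \<in> body_pts (stage k)"
  using \<theta>'[of k] by (auto simp: homeomorphic_maps_def continuous_map_def)

abbreviation "ident \<equiv> comp_ident B A"

lemma ident_aux:
  "continuous_map (cx_body B) (cx_body BA) (cx_induced (\<lambda>k y. cx_map (\<iota> k) (\<theta> k y))) \<and>
   (\<forall>k. \<forall>y \<in> pts (B k). cx_induced (\<lambda>k y. cx_map (\<iota> k) (\<theta> k y)) (stage_incl k y) = cx_map (\<iota> k) (\<theta> k y))"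
proof (rule cx_body_colimit(3)[OF B])
  fix k
  have "continuous_map (sbd (B k)) (cx_body BA) (cx_map (\<iota> k) \<circ> \<theta> k)"
    using \<theta>'[of k] continuous_map_cx_map[OF BA.\<iota>_mor, of k]
    by (intro continuous_map_compose) (auto simp: homeomorphic_maps_def)
  then show "continuous_map (sbd (B k)) (cx_body BA) (\<lambda>y. cx_map (\<iota> k) (\<theta> k y))"
    by (simp add: comp_def)
  fix y assume "y \<in> pts (B k)"
  then show "cx_map (\<iota> (Suc k)) (\<theta> (Suc k) (old y)) = cx_map (\<iota> k) (\<theta> k y)"
    by (simp add: \<theta>_old BA.cx_map_\<iota>_step \<theta>_in)
qed

lemma continuous_map_ident: "continuous_map (cx_body B) (cx_body BA) ident"
  by (rule continuous_map_eq[OF conjunct1[OF ident_aux]]) (simp add: comp_ident_def \<iota>_def)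

lemma ident_stage_incl: "y \<in> pts (B k) \<Longrightarrow> ident (stage_incl k y) = cx_map (\<iota> k) (\<theta> k y)"
  using ident_aux by (simp add: comp_ident_def \<iota>_def stage_incl_in_cx_body)

text \<open>The spaces \<open>cx_body B\<close> and \<open>cx_body BA\<close> are colimits of sequences that are isomorphic by the
  maps \<open>\<theta> k\<close>.\<close>

lemma homeomorphic_ident: "\<exists>\<psi>. homeomorphic_maps (cx_body B) (cx_body BA) ident \<psi>"
proof -
  have in_B: "\<theta>' k z \<in> pts (B k)" and \<theta>\<theta>': "\<theta> k (\<theta>' k z) = z" if "z \<in> body_pts (stage k)" for k z
    using \<theta>'[of k] that by (auto simp: homeomorphic_maps_def continuous_map_def)
  have \<theta>'\<theta>: "\<theta>' k (\<theta> k y) = y" if "y \<in> pts (B k)" for k y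
    using \<theta>'[of k] that by (auto simp: homeomorphic_maps_def)
  have "continuous_map (cx_body (stage k)) (cx_body B) (stage_incl k \<circ> \<theta>' k)" for k
    using \<theta>'[of k] cx_body_colimit(1)[OF B, of k] by (intro continuous_map_compose) (auto simp: homeomorphic_maps_def)
  then have "continuous_map (cx_body (stage k)) (cx_body B) (\<lambda>z. stage_incl k (\<theta>' k z))" for k
    by (simp add: comp_def)
  moreover have "stage_incl (Suc k) (\<theta>' (Suc k) (cx_map (step k) z)) = stage_incl k (\<theta>' k z)"
    if z: "z \<in> body_pts (stage k)" for k z
  proof -
    have "cx_map (step k) z = \<theta> (Suc k) (old (\<theta>' k z))"
      by (simp add: \<theta>_old in_B \<theta>\<theta>' z)
    moreover have "old (\<theta>' k z) \<in> pts (B (Suc k))"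
      using in_B[OF z] by (simp add: cellcx_sbd_Suc[OF B] old_in_body_iff[OF cellcx_stratum[OF B]])
    ultimately show ?thesis
      by (simp add: \<theta>'\<theta>)
  qed
  ultimately obtain \<psi> where \<psi>: "continuous_map (cx_body BA) (cx_body B) \<psi>"
      "\<And>k z. z \<in> body_pts (stage k) \<Longrightarrow> \<psi> (cx_map (\<iota> k) z) = stage_incl k (\<theta>' k z)"
    by (rule BA.body_colimit_exists[where g = "\<lambda>k z. stage_incl k (\<theta>' k z)"]) auto
  have "\<psi> (ident z) = z" if z: "z \<in> body_pts B" for z
    by (rule cx_body_colimit(4)[OF B _ z]) (simp add: ident_stage_incl \<psi>(2) \<theta>_in \<theta>'\<theta>)
  moreover have "(ident \<circ> \<psi>) z = id z" if z: "z \<in> body_pts BA" for z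
  proof (rule BA.body_colimit_unique[OF _ continuous_map_id _ z])
    show "continuous_map (cx_body BA) (cx_body BA) (ident \<circ> \<psi>)"
      using \<psi>(1) continuous_map_ident by (rule continuous_map_compose)
  qed (simp add: \<psi>(2) ident_stage_incl in_B \<theta>\<theta>')
  ultimately have "homeomorphic_maps (cx_body B) (cx_body BA) ident \<psi>"
    using \<psi>(1) continuous_map_ident by (simp add: homeomorphic_maps_def)
  then show ?thesis
    by blast
qed

lemma ident_stage_0: "z \<in> body_pts A \<Longrightarrow> ident (stage_incl 0 z) = cx_map (\<iota> 0) z"
  using ident_stage_incl[of z 0] by (simp add: AB \<theta>_0)

lemma cellular_ident: "cellular B BA ident"
  unfolding cellular_def
proof (intro allI ballI)
  fix k t assume t: "t \<in> cells (B k)"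
  obtain m u where u: "u \<in> cells (stage (Suc k) m)" "cdim (stage (Suc k) m) u = cdim (B k) t"
      "\<And>d. d \<in> disc_of (B k) t \<Longrightarrow> \<theta> (Suc k) (char_map (B k) t d) = cx_char (stage (Suc k)) m u d"
    using \<theta>_char_map[OF t] by blast
  have "ident (cx_char B k t d) = cx_char BA m (cm_cells (\<iota> (Suc k)) m u) d" if d: "d \<in> disc_of (B k) t" for d
  proof -
    have "char_map (B k) t d \<in> pts (B (Suc k))"
      using char_map_in_body[OF cellcx_stratum[OF B] t d] by (simp add: cellcx_sbd_Suc[OF B])
    then have "ident (cx_char B k t d) = cx_map (\<iota> (Suc k)) (cx_char (stage (Suc k)) m u d)"
      by (simp add: cx_char_def[of B] ident_stage_incl u(3)[OF d])
    then show ?thesis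
      using cx_map_cx_char[OF BA.\<iota>_mor, of u "Suc k" m d] u d by simp
  qed
  moreover have "cm_cells (\<iota> (Suc k)) m u \<in> cells (BA m)" "cdim (BA m) (cm_cells (\<iota> (Suc k)) m u) = cdim (B k) t"
    using cellmor_cells[OF BA.\<iota>_mor, of u "Suc k" m] u by simp_all
  ultimately show "\<exists>m. \<exists>u \<in> cells (BA m). cdim (BA m) u = cdim (B k) t \<and>
      (\<forall>d \<in> disc_of (B k) t. ident (cx_char B k t d) = cx_char BA m u d)"
    by (intro exI[of _ m] bexI[of _ "cm_cells (\<iota> (Suc k)) m u"]) simp_all
qed

end


section \<open>Factorisation systems with cellular maps\<close>

lemma cat_functor_cmp:
  assumes F: "cat_functor C D F" and G: "cat_functor D E G"
  shows "cat_functor C E (cmp_functr G F)"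
proof -
  interpret F: cat_functor C D F by (rule F)
  interpret G: cat_functor D E G by (rule G)
  show ?thesis
  proof
    fix f g a b c
    assume f: "f \<in> hom C a b"
    then show "Fmo (cmp_functr G F) f \<in> hom E (Fob (cmp_functr G F) a) (Fob (cmp_functr G F) b)"
      by (simp add: cmp_functr_def F.functor_hom G.functor_hom)
    assume g: "g \<in> hom C b c"
    show "Fmo (cmp_functr G F) (Cmp C g f) = Cmp E (Fmo (cmp_functr G F) g) (Fmo (cmp_functr G F) f)"
      using G.functor_cmp[OF F.functor_hom[OF f] F.functor_hom[OF g]] by (simp add: cmp_functr_def F.functor_cmp[OF f g])
  qed (simp_all add: cmp_functr_def F.functor_ob G.functor_ob F.functor_id G.functor_id)
qed

context category
begin

abbreviation comp (infixr "\<cdot>" 65) where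
  "g \<cdot> f \<equiv> Cmp C g f"

abbreviation "AC \<equiv> arrow_cat C"

lemma hom_iff: "f \<in> hom C a b \<longleftrightarrow> f \<in> Mor C \<and> Dom C f = a \<and> Cod C f = b"
  by (simp add: hom_def)

lemma Idm_simps [simp]:
  assumes "a \<in> Obj C"
  shows "Idm C a \<in> Mor C" "Dom C (Idm C a) = a" "Cod C (Idm C a) = a"
  using id_hom[OF assms] by (simp_all add: hom_iff)

lemma Cmp_simps [simp]:
  assumes "f \<in> Mor C" "g \<in> Mor C" "Cod C f = Dom C g"
  shows "g \<cdot> f \<in> Mor C" "Dom C (g \<cdot> f) = Dom C f" "Cod C (g \<cdot> f) = Cod C g"
  using cmp_hom[of f "Dom C f" "Dom C g" g "Cod C g"] assms by (simp_all add: hom_iff)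

lemma Cmp_Idm [simp]: "f \<in> Mor C \<Longrightarrow> a = Dom C f \<Longrightarrow> f \<cdot> Idm C a = f"
  by (rule cmp_id_right) (simp add: hom_iff)

lemma Idm_Cmp [simp]: "f \<in> Mor C \<Longrightarrow> a = Cod C f \<Longrightarrow> Idm C a \<cdot> f = f"
  by (rule cmp_id_left) (simp add: hom_iff)

lemma Cmp_assoc [simp]:
  assumes "f \<in> Mor C" "g \<in> Mor C" "h \<in> Mor C" "Cod C f = Dom C g" "Cod C g = Dom C h"
  shows "(h \<cdot> g) \<cdot> f = h \<cdot> (g \<cdot> f)"
  using assms by (intro cmp_assoc[symmetric]) (auto simp: hom_iff)

declare dom_obj [simp] cod_obj [simp]

lemma Sq_Mor_iff:
  "Sq f a b g \<in> Mor AC \<longleftrightarrow> f \<in> Mor C \<and> g \<in> Mor C \<and> a \<in> Mor C \<and> b \<in> Mor C \<and>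
     Dom C a = Dom C f \<and> Cod C a = Dom C g \<and> Dom C b = Cod C f \<and> Cod C b = Cod C g \<and> g \<cdot> a = b \<cdot> f"
  by (auto simp: arrow_cat_def hom_iff)

lemma hom_AC_iff: "\<sigma> \<in> hom AC f g \<longleftrightarrow> \<sigma> \<in> Mor AC \<and> sq_src \<sigma> = f \<and> sq_tgt \<sigma> = g"
  by (simp add: hom_def)

lemma square_simps [simp]:
  assumes "\<sigma> \<in> Mor AC"
  shows "sq_src \<sigma> \<in> Mor C" "sq_tgt \<sigma> \<in> Mor C" "sq_top \<sigma> \<in> Mor C" "sq_bot \<sigma> \<in> Mor C"
    "Dom C (sq_top \<sigma>) = Dom C (sq_src \<sigma>)" "Cod C (sq_top \<sigma>) = Dom C (sq_tgt \<sigma>)"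
    "Dom C (sq_bot \<sigma>) = Cod C (sq_src \<sigma>)" "Cod C (sq_bot \<sigma>) = Cod C (sq_tgt \<sigma>)"
  using assms by (cases \<sigma>; simp add: Sq_Mor_iff)+

lemma square_commutes: "\<sigma> \<in> Mor AC \<Longrightarrow> sq_tgt \<sigma> \<cdot> sq_top \<sigma> = sq_bot \<sigma> \<cdot> sq_src \<sigma>"
  by (cases \<sigma>) (simp add: Sq_Mor_iff)

lemma category_arrow_cat: "category AC"
proof
  fix \<sigma> \<tau> \<rho> f g h k
  assume s: "\<sigma> \<in> hom AC f g"
  show "Cmp AC \<sigma> (Idm AC f) = \<sigma>" "Cmp AC (Idm AC g) \<sigma> = \<sigma>"
    using s by (cases \<sigma>; simp add: hom_AC_iff Sq_Mor_iff)+
  assume t: "\<tau> \<in> hom AC g h"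
  show "Cmp AC \<tau> \<sigma> \<in> hom AC f h"
  proof -
    obtain a b where \<sigma>: "\<sigma> = Sq f a b g" "Sq f a b g \<in> Mor AC"
      using s by (cases \<sigma>) (auto simp: hom_AC_iff)
    obtain a' b' where \<tau>: "\<tau> = Sq g a' b' h" "Sq g a' b' h \<in> Mor AC"
      using t by (cases \<tau>) (auto simp: hom_AC_iff)
    have "h \<cdot> a' \<cdot> a = (h \<cdot> a') \<cdot> a"
      using \<sigma>(2) \<tau>(2) by (intro Cmp_assoc[symmetric]) (simp_all add: Sq_Mor_iff)
    also have "\<dots> = (b' \<cdot> g) \<cdot> a"
      using \<tau>(2) by (simp only: Sq_Mor_iff)
    also have "\<dots> = (b' \<cdot> b) \<cdot> f"
      using \<sigma>(2) \<tau>(2) by (simp add: Sq_Mor_iff)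
    finally show ?thesis
      using \<sigma> \<tau> by (simp add: hom_AC_iff Sq_Mor_iff)
  qed
  assume u: "\<rho> \<in> hom AC h k"
  show "Cmp AC \<rho> (Cmp AC \<tau> \<sigma>) = Cmp AC (Cmp AC \<rho> \<tau>) \<sigma>"
    using s t u by (simp add: hom_AC_iff)
qed (simp_all add: hom_AC_iff Sq_Mor_iff)

end

text \<open>A functorial factorisation through objects \<open>M f = Cod (lam f)\<close>, where \<open>mid \<sigma>\<close> is the map
  \<open>M f \<rightarrow> M g\<close> induced by a square \<open>\<sigma> : f \<rightarrow> g\<close>, together with a class of cellular
  maps between these objects that is closed under composition. A cellular map \<open>M f \<rightarrow> M g\<close> is determined
  by its composites with \<open>lam f\<close> and with \<open>rho g\<close>; so two composites of structure maps with the same source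
  and target are equal as soon as these composites are, and those can be computed by rewriting.\<close>

locale cellular_factorisation = category C
  for C :: "('o, 'm) cat" +
  fixes L :: "('m, 'm square, 'm, 'm square) functr" and \<epsilon> :: "'m \<Rightarrow> 'm square" and \<delta> :: "'m \<Rightarrow> 'm square"
    and R :: "('m, 'm square, 'm, 'm square) functr" and \<eta> :: "'m \<Rightarrow> 'm square" and \<mu> :: "'m \<Rightarrow> 'm square"
    and lam rho del mu :: "'m \<Rightarrow> 'm" and mid :: "'m square \<Rightarrow> 'm"
    and cell :: "'m \<Rightarrow> 'm \<Rightarrow> 'm \<Rightarrow> bool"
  assumes L_ob: "f \<in> Mor C \<Longrightarrow> Fob L f = lam f"
    and L_mor: "\<sigma> \<in> Mor AC \<Longrightarrow> Fmo L \<sigma> = Sq (lam (sq_src \<sigma>)) (sq_top \<sigma>) (mid \<sigma>) (lam (sq_tgt \<sigma>))"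
    and \<epsilon>: "f \<in> Mor C \<Longrightarrow> \<epsilon> f = Sq (lam f) (Idm C (Dom C f)) (rho f) f"
    and \<delta>: "f \<in> Mor C \<Longrightarrow> \<delta> f = Sq (lam f) (Idm C (Dom C f)) (del f) (lam (lam f))"
    and R_ob: "f \<in> Mor C \<Longrightarrow> Fob R f = rho f"
    and R_mor: "\<sigma> \<in> Mor AC \<Longrightarrow> Fmo R \<sigma> = Sq (rho (sq_src \<sigma>)) (mid \<sigma>) (sq_bot \<sigma>) (rho (sq_tgt \<sigma>))"
    and \<eta>: "f \<in> Mor C \<Longrightarrow> \<eta> f = Sq f (lam f) (Idm C (Cod C f)) (rho f)"
    and \<mu>: "f \<in> Mor C \<Longrightarrow> \<mu> f = Sq (rho (rho f)) (mu f) (Idm C (Cod C f)) (rho f)"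
    and lam: "f \<in> Mor C \<Longrightarrow> lam f \<in> Mor C \<and> Dom C (lam f) = Dom C f"
    and rho: "f \<in> Mor C \<Longrightarrow> rho f \<in> hom C (Cod C (lam f)) (Cod C f)"
    and rho_lam: "f \<in> Mor C \<Longrightarrow> rho f \<cdot> lam f = f"
    and mid: "\<sigma> \<in> Mor AC \<Longrightarrow> mid \<sigma> \<in> hom C (Cod C (lam (sq_src \<sigma>))) (Cod C (lam (sq_tgt \<sigma>)))"
    and mid_lam: "\<sigma> \<in> Mor AC \<Longrightarrow> mid \<sigma> \<cdot> lam (sq_src \<sigma>) = lam (sq_tgt \<sigma>) \<cdot> sq_top \<sigma>"
    and rho_mid: "\<sigma> \<in> Mor AC \<Longrightarrow> rho (sq_tgt \<sigma>) \<cdot> mid \<sigma> = sq_bot \<sigma> \<cdot> rho (sq_src \<sigma>)"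
    and del: "f \<in> Mor C \<Longrightarrow> del f \<in> hom C (Cod C (lam f)) (Cod C (lam (lam f)))"
    and del_lam: "f \<in> Mor C \<Longrightarrow> del f \<cdot> lam f = lam (lam f)"
    and rho_del: "f \<in> Mor C \<Longrightarrow> rho (lam f) \<cdot> del f = Idm C (Cod C (lam f))"
    and mu: "f \<in> Mor C \<Longrightarrow> mu f \<in> hom C (Cod C (lam (rho f))) (Cod C (lam f))"
    and mu_lam: "f \<in> Mor C \<Longrightarrow> mu f \<cdot> lam (rho f) = Idm C (Cod C (lam f))"
    and rho_mu: "f \<in> Mor C \<Longrightarrow> rho f \<cdot> mu f = rho (rho f)"
    and cell_mid: "\<sigma> \<in> Mor AC \<Longrightarrow> cell (sq_src \<sigma>) (sq_tgt \<sigma>) (mid \<sigma>)"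
    and cell_del: "f \<in> Mor C \<Longrightarrow> cell f (lam f) (del f)"
    and cell_mu: "f \<in> Mor C \<Longrightarrow> cell (rho f) f (mu f)"
    and cell_Idm: "f \<in> Mor C \<Longrightarrow> cell f f (Idm C (Cod C (lam f)))"
    and cell_Cmp: "f \<in> Mor C \<Longrightarrow> g \<in> Mor C \<Longrightarrow> h \<in> Mor C \<Longrightarrow>
      c \<in> hom C (Cod C (lam f)) (Cod C (lam g)) \<Longrightarrow> c' \<in> hom C (Cod C (lam g)) (Cod C (lam h)) \<Longrightarrow>
      cell f g c \<Longrightarrow> cell g h c' \<Longrightarrow> cell f h (c' \<cdot> c)"
    and cell_unique: "f \<in> Mor C \<Longrightarrow> g \<in> Mor C \<Longrightarrow>
      c \<in> hom C (Cod C (lam f)) (Cod C (lam g)) \<Longrightarrow> c' \<in> hom C (Cod C (lam f)) (Cod C (lam g)) \<Longrightarrow>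
      cell f g c \<Longrightarrow> cell f g c' \<Longrightarrow> c \<cdot> lam f = c' \<cdot> lam f \<Longrightarrow> rho g \<cdot> c = rho g \<cdot> c' \<Longrightarrow> c = c'"
begin

lemma lam_simps [simp]: "f \<in> Mor C \<Longrightarrow> lam f \<in> Mor C" "f \<in> Mor C \<Longrightarrow> Dom C (lam f) = Dom C f"
  using lam by auto

lemma rho_simps [simp]:
  "f \<in> Mor C \<Longrightarrow> rho f \<in> Mor C" "f \<in> Mor C \<Longrightarrow> Dom C (rho f) = Cod C (lam f)" "f \<in> Mor C \<Longrightarrow> Cod C (rho f) = Cod C f"
  using rho by (auto simp: hom_iff)

lemma mid_simps [simp]:
  "\<sigma> \<in> Mor AC \<Longrightarrow> mid \<sigma> \<in> Mor C" "\<sigma> \<in> Mor AC \<Longrightarrow> Dom C (mid \<sigma>) = Cod C (lam (sq_src \<sigma>))"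
  "\<sigma> \<in> Mor AC \<Longrightarrow> Cod C (mid \<sigma>) = Cod C (lam (sq_tgt \<sigma>))"
  using mid by (auto simp: hom_iff)

lemma del_simps [simp]:
  "f \<in> Mor C \<Longrightarrow> del f \<in> Mor C" "f \<in> Mor C \<Longrightarrow> Dom C (del f) = Cod C (lam f)"
  "f \<in> Mor C \<Longrightarrow> Cod C (del f) = Cod C (lam (lam f))"
  using del by (auto simp: hom_iff)

lemma mu_simps [simp]:
  "f \<in> Mor C \<Longrightarrow> mu f \<in> Mor C" "f \<in> Mor C \<Longrightarrow> Dom C (mu f) = Cod C (lam (rho f))"
  "f \<in> Mor C \<Longrightarrow> Cod C (mu f) = Cod C (lam f)"
  using mu by (auto simp: hom_iff)

text \<open>Composites are kept nested to the right. As a relation may have to be applied in front of a further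
  factor \<open>x\<close>, each is needed in two forms.\<close>

lemma Cmp_eq_assoc:
  assumes "h \<cdot> g = k" "x \<in> Mor C" "g \<in> Mor C" "h \<in> Mor C" "Cod C x = Dom C g" "Cod C g = Dom C h"
  shows "h \<cdot> (g \<cdot> x) = k \<cdot> x"
  using assms by (metis Cmp_assoc)

lemma relations [simp]:
  "f \<in> Mor C \<Longrightarrow> rho f \<cdot> lam f = f"
  "\<sigma> \<in> Mor AC \<Longrightarrow> f = sq_src \<sigma> \<Longrightarrow> mid \<sigma> \<cdot> lam f = lam (sq_tgt \<sigma>) \<cdot> sq_top \<sigma>"
  "\<sigma> \<in> Mor AC \<Longrightarrow> f = sq_tgt \<sigma> \<Longrightarrow> rho f \<cdot> mid \<sigma> = sq_bot \<sigma> \<cdot> rho (sq_src \<sigma>)"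
  "f \<in> Mor C \<Longrightarrow> del f \<cdot> lam f = lam (lam f)"
  "f \<in> Mor C \<Longrightarrow> rho (lam f) \<cdot> del f = Idm C (Cod C (lam f))"
  "f \<in> Mor C \<Longrightarrow> mu f \<cdot> lam (rho f) = Idm C (Cod C (lam f))"
  "f \<in> Mor C \<Longrightarrow> rho f \<cdot> mu f = rho (rho f)"
  by (simp_all add: rho_lam mid_lam rho_mid del_lam rho_del mu_lam rho_mu)

lemma relations_assoc [simp]:
  "f \<in> Mor C \<Longrightarrow> x \<in> Mor C \<Longrightarrow> Cod C x = Dom C f \<Longrightarrow> rho f \<cdot> (lam f \<cdot> x) = f \<cdot> x"
  "\<sigma> \<in> Mor AC \<Longrightarrow> f = sq_src \<sigma> \<Longrightarrow> x \<in> Mor C \<Longrightarrow> Cod C x = Dom C f \<Longrightarrow>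
    mid \<sigma> \<cdot> (lam f \<cdot> x) = lam (sq_tgt \<sigma>) \<cdot> (sq_top \<sigma> \<cdot> x)"
  "\<sigma> \<in> Mor AC \<Longrightarrow> f = sq_tgt \<sigma> \<Longrightarrow> x \<in> Mor C \<Longrightarrow> Cod C x = Cod C (lam (sq_src \<sigma>)) \<Longrightarrow>
    rho f \<cdot> (mid \<sigma> \<cdot> x) = sq_bot \<sigma> \<cdot> (rho (sq_src \<sigma>) \<cdot> x)"
  "f \<in> Mor C \<Longrightarrow> x \<in> Mor C \<Longrightarrow> Cod C x = Dom C f \<Longrightarrow> del f \<cdot> (lam f \<cdot> x) = lam (lam f) \<cdot> x"
  "f \<in> Mor C \<Longrightarrow> x \<in> Mor C \<Longrightarrow> Cod C x = Cod C (lam f) \<Longrightarrow> rho (lam f) \<cdot> (del f \<cdot> x) = x"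
  "f \<in> Mor C \<Longrightarrow> x \<in> Mor C \<Longrightarrow> Cod C x = Cod C (lam f) \<Longrightarrow> mu f \<cdot> (lam (rho f) \<cdot> x) = x"
  "f \<in> Mor C \<Longrightarrow> x \<in> Mor C \<Longrightarrow> Cod C x = Cod C (lam (rho f)) \<Longrightarrow> rho f \<cdot> (mu f \<cdot> x) = rho (rho f) \<cdot> x"
  by (subst Cmp_eq_assoc[OF relations(1)] Cmp_eq_assoc[OF relations(2)] Cmp_eq_assoc[OF relations(3)]
      Cmp_eq_assoc[OF relations(4)] Cmp_eq_assoc[OF relations(5)] Cmp_eq_assoc[OF relations(6)] Cmp_eq_assoc[OF relations(7)];
      simp)+

lemma cell_mid': "\<sigma> \<in> Mor AC \<Longrightarrow> sq_src \<sigma> = f \<Longrightarrow> sq_tgt \<sigma> = g \<Longrightarrow> cell f g (mid \<sigma>)"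
  using cell_mid by blast

lemma mid_Idm: "f \<in> Mor C \<Longrightarrow> mid (Idm AC f) = Idm C (Cod C (lam f))"
  by (rule cell_unique[of f f]) (simp_all add: hom_iff Sq_Mor_iff cell_Idm cell_mid')

lemma mid_Cmp:
  assumes s: "\<sigma> \<in> hom AC f g" and t: "\<tau> \<in> hom AC g h"
  shows "mid (Cmp AC \<tau> \<sigma>) = mid \<tau> \<cdot> mid \<sigma>"
proof -
  have ts: "Cmp AC \<tau> \<sigma> \<in> Mor AC"
    using category.cmp_hom[OF category_arrow_cat s t] unfolding hom_AC_iff by blast
  have st: "\<sigma> \<in> Mor AC" "\<tau> \<in> Mor AC" "f = sq_src \<sigma>" "sq_src \<tau> = sq_tgt \<sigma>" "h = sq_tgt \<tau>"
    using s t by (auto simp: hom_AC_iff)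
  show ?thesis
    by (rule cell_unique[of f h])
      (use ts st in \<open>simp_all add: hom_iff cell_mid' cell_Cmp[of "sq_src \<sigma>" "sq_tgt \<sigma>" "sq_tgt \<tau>"]\<close>)
qed

lemma del_natural: "\<sigma> \<in> Mor AC \<Longrightarrow> del (sq_tgt \<sigma>) \<cdot> mid \<sigma> = mid (Fmo L \<sigma>) \<cdot> del (sq_src \<sigma>)"
  by (rule cell_unique[of "sq_src \<sigma>" "lam (sq_tgt \<sigma>)"])
    (simp_all add: L_mor hom_iff Sq_Mor_iff cell_mid' cell_del
      cell_Cmp[of "sq_src \<sigma>" "sq_tgt \<sigma>" "lam (sq_tgt \<sigma>)"] cell_Cmp[of "sq_src \<sigma>" "lam (sq_src \<sigma>)" "lam (sq_tgt \<sigma>)"])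

lemma mu_natural: "\<sigma> \<in> Mor AC \<Longrightarrow> mu (sq_tgt \<sigma>) \<cdot> mid (Fmo R \<sigma>) = mid \<sigma> \<cdot> mu (sq_src \<sigma>)"
  by (rule cell_unique[of "rho (sq_src \<sigma>)" "sq_tgt \<sigma>"])
    (simp_all add: R_mor hom_iff Sq_Mor_iff cell_mid' cell_mu
      cell_Cmp[of "rho (sq_src \<sigma>)" "rho (sq_tgt \<sigma>)" "sq_tgt \<sigma>"] cell_Cmp[of "rho (sq_src \<sigma>)" "sq_src \<sigma>" "sq_tgt \<sigma>"])

lemma mid_counit_del: "f \<in> Mor C \<Longrightarrow> mid (\<epsilon> f) \<cdot> del f = Idm C (Cod C (lam f))"
  by (rule cell_unique[of f f])
    (simp_all add: \<epsilon> hom_iff Sq_Mor_iff cell_mid' cell_del cell_Idm cell_Cmp[of f "lam f" f])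

lemma del_del: "f \<in> Mor C \<Longrightarrow> del (lam f) \<cdot> del f = mid (\<delta> f) \<cdot> del f"
  by (rule cell_unique[of f "lam (lam f)"])
    (simp_all add: \<delta> hom_iff Sq_Mor_iff cell_mid' cell_del cell_Cmp[of f "lam f" "lam (lam f)"])

lemma mu_mid_unit: "f \<in> Mor C \<Longrightarrow> mu f \<cdot> mid (\<eta> f) = Idm C (Cod C (lam f))"
  by (rule cell_unique[of f f])
    (simp_all add: \<eta> hom_iff Sq_Mor_iff cell_mid' cell_mu cell_Idm cell_Cmp[of f "rho f" f])

lemma mu_mu: "f \<in> Mor C \<Longrightarrow> mu f \<cdot> mu (rho f) = mu f \<cdot> mid (\<mu> f)"
  by (rule cell_unique[of "rho (rho f)" f])
    (simp_all add: \<mu> hom_iff Sq_Mor_iff cell_mid' cell_mu cell_Cmp[of "rho (rho f)" "rho f" f])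

abbreviation "\<Delta> \<equiv> awfs_law L \<delta> R \<mu>"

lemma \<Delta>: "f \<in> Mor C \<Longrightarrow> \<Delta> f = Sq (lam (rho f)) (del f) (mu f) (rho (lam f))"
  by (simp add: awfs_law_def L_ob R_ob \<delta> \<mu>)

text \<open>The part of distributivity that is not already a law of the monad or of the comonad. Both sides have
  composite \<open>del f\<close> with \<open>lam (rho f)\<close>, and composite \<open>mu f\<close> with \<open>rho (lam f)\<close>.\<close>

lemma del_mu: "f \<in> Mor C \<Longrightarrow> del f \<cdot> mu f = mu (lam f) \<cdot> mid (\<Delta> f) \<cdot> del (rho f)"
  by (rule cell_unique[of "rho f" "lam f"])
    (simp_all add: \<Delta> hom_iff Sq_Mor_iff cell_mid' cell_mu cell_del cell_Cmp[of "rho f" f "lam f"]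
      cell_Cmp[of "rho f" "rho (lam f)" "lam f"] cell_Cmp[of "rho f" "lam (rho f)" "rho (lam f)"])

lemma functor_L: "cat_functor AC AC L"
proof (intro cat_functor.intro category_arrow_cat cat_functor_axioms.intro)
  fix \<sigma> \<tau> f g h
  assume s: "\<sigma> \<in> hom AC f g"
  then show "Fmo L \<sigma> \<in> hom AC (Fob L f) (Fob L g)"
    by (auto simp: L_mor L_ob hom_AC_iff Sq_Mor_iff)
  assume t: "\<tau> \<in> hom AC g h"
  then have "Cmp AC \<tau> \<sigma> \<in> Mor AC"
    using category.cmp_hom[OF category_arrow_cat s t] unfolding hom_AC_iff by blast
  then show "Fmo L (Cmp AC \<tau> \<sigma>) = Cmp AC (Fmo L \<tau>) (Fmo L \<sigma>)"
    using s t mid_Cmp[OF s t] by (simp add: L_mor hom_AC_iff)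
next
  fix f assume "f \<in> Obj AC"
  then show "Fob L f \<in> Obj AC" "Fmo L (Idm AC f) = Idm AC (Fob L f)"
    using mid_Idm[of f] by (simp_all add: L_ob L_mor Sq_Mor_iff)
qed

lemma functor_R: "cat_functor AC AC R"
proof (intro cat_functor.intro category_arrow_cat cat_functor_axioms.intro)
  fix \<sigma> \<tau> f g h
  assume s: "\<sigma> \<in> hom AC f g"
  then show "Fmo R \<sigma> \<in> hom AC (Fob R f) (Fob R g)"
    by (auto simp: R_mor R_ob hom_AC_iff Sq_Mor_iff)
  assume t: "\<tau> \<in> hom AC g h"
  then have "Cmp AC \<tau> \<sigma> \<in> Mor AC"
    using category.cmp_hom[OF category_arrow_cat s t] unfolding hom_AC_iff by blast
  then show "Fmo R (Cmp AC \<tau> \<sigma>) = Cmp AC (Fmo R \<tau>) (Fmo R \<sigma>)"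
    using s t mid_Cmp[OF s t] by (simp add: R_mor hom_AC_iff)
next
  fix f assume "f \<in> Obj AC"
  then show "Fob R f \<in> Obj AC" "Fmo R (Idm AC f) = Idm AC (Fob R f)"
    using mid_Idm[of f] by (simp_all add: R_ob R_mor Sq_Mor_iff)
qed

lemma functor_id: "cat_functor AC AC id_functr"
  by (intro cat_functor.intro category_arrow_cat cat_functor_axioms.intro) (simp_all add: id_functr_def)

lemma cmp_functr_sel [simp]: "Fob (cmp_functr G F) a = Fob G (Fob F a)" "Fmo (cmp_functr G F) \<sigma> = Fmo G (Fmo F \<sigma>)"
  by (simp_all add: cmp_functr_def)

lemma id_functr_sel [simp]: "Fob id_functr a = a" "Fmo id_functr \<sigma> = \<sigma>"
  by (simp_all add: id_functr_def)

lemma L_square: "\<sigma> \<in> Mor AC \<Longrightarrow> Fmo L \<sigma> \<in> Mor AC"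
  by (simp add: L_mor Sq_Mor_iff)

lemma R_square: "\<sigma> \<in> Mor AC \<Longrightarrow> Fmo R \<sigma> \<in> Mor AC"
  by (simp add: R_mor Sq_Mor_iff)

lemma squares:
  assumes "f \<in> Mor C"
  shows "\<epsilon> f \<in> Mor AC" "\<delta> f \<in> Mor AC" "\<eta> f \<in> Mor AC" "\<mu> f \<in> Mor AC" "\<Delta> f \<in> Mor AC"
  using assms by (simp_all add: \<epsilon> \<delta> \<eta> \<mu> \<Delta> Sq_Mor_iff)

lemma comonad_L: "comonad AC L \<epsilon> \<delta>"
proof (intro comonad.intro nat_transf.intro functor_L functor_id cat_functor_cmp[OF functor_L functor_L]
    nat_transf_axioms.intro comonad_axioms.intro)
  fix \<sigma> f g assume s: "\<sigma> \<in> hom AC f g"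
  then show "Cmp AC (\<epsilon> g) (Fmo L \<sigma>) = Cmp AC (Fmo id_functr \<sigma>) (\<epsilon> f)"
    by (cases \<sigma>) (auto simp: hom_AC_iff L_mor \<epsilon> Sq_Mor_iff)
  show "Cmp AC (\<delta> g) (Fmo L \<sigma>) = Cmp AC (Fmo (cmp_functr L L) \<sigma>) (\<delta> f)"
    using s del_natural[of \<sigma>] L_square[of \<sigma>] by (auto simp: hom_AC_iff L_mor \<delta>)
qed (use squares mid_counit_del del_del in \<open>auto simp: hom_AC_iff L_ob L_mor \<epsilon> \<delta>\<close>)

lemma monad_R: "monad AC R \<eta> \<mu>"
proof (intro monad.intro nat_transf.intro functor_R functor_id cat_functor_cmp[OF functor_R functor_R]
    nat_transf_axioms.intro monad_axioms.intro)
  fix \<sigma> f g assume s: "\<sigma> \<in> hom AC f g"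
  then show "Cmp AC (\<eta> g) (Fmo id_functr \<sigma>) = Cmp AC (Fmo R \<sigma>) (\<eta> f)"
    by (auto simp: hom_AC_iff R_mor \<eta>)
  show "Cmp AC (\<mu> g) (Fmo (cmp_functr R R) \<sigma>) = Cmp AC (Fmo R \<sigma>) (\<mu> f)"
    using s mu_natural[of \<sigma>] R_square[of \<sigma>] by (auto simp: hom_AC_iff R_mor \<mu>)
qed (use squares mu_mid_unit mu_mu in \<open>auto simp: hom_AC_iff R_ob R_mor \<eta> \<mu>\<close>)

lemma law_natural: "nat_transf AC AC (cmp_functr L R) (cmp_functr R L) \<Delta>"
proof (intro nat_transf.intro cat_functor_cmp[OF functor_R functor_L] cat_functor_cmp[OF functor_L functor_R]
    nat_transf_axioms.intro)
  fix \<sigma> f g assume "\<sigma> \<in> hom AC f g"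
  then show "Cmp AC (\<Delta> g) (Fmo (cmp_functr L R) \<sigma>) = Cmp AC (Fmo (cmp_functr R L) \<sigma>) (\<Delta> f)"
    using del_natural[of \<sigma>] mu_natural[of \<sigma>] L_square[of \<sigma>] R_square[of \<sigma>]
    by (auto simp: hom_AC_iff L_mor R_mor \<Delta>)
qed (use squares in \<open>auto simp: hom_AC_iff L_ob R_ob \<Delta>\<close>)

theorem is_awfs: "awfs C L \<epsilon> \<delta> R \<eta> \<mu>"
proof (intro awfs.intro distributive_law.intro distributive_law_axioms.intro awfs_axioms.intro
    category_axioms comonad_L monad_R law_natural)
  fix f assume "f \<in> Obj AC"
  then have f: "f \<in> Mor C"
    by simp
  note sq = squares[OF f] and simps = L_ob R_ob L_mor R_mor \<epsilon> \<delta> \<eta> \<mu> \<Delta> f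
  show "Cmp AC (\<Delta> f) (Fmo L (\<eta> f)) = \<eta> (Fob L f)"
    using sq mu_mid_unit[OF f] by (simp add: simps)
  show "Cmp AC (Fmo R (\<epsilon> f)) (\<Delta> f) = \<epsilon> (Fob R f)"
    using sq mid_counit_del[OF f] by (simp add: simps)
  show "Cmp AC (\<Delta> f) (Fmo L (\<mu> f)) = Cmp AC (\<mu> (Fob L f)) (Cmp AC (Fmo R (\<Delta> f)) (\<Delta> (Fob R f)))"
    using sq mu_mu[OF f] del_mu[OF f] by (simp add: simps)
  show "Cmp AC (Fmo R (\<delta> f)) (\<Delta> f) = Cmp AC (\<Delta> (Fob L f)) (Cmp AC (Fmo L (\<Delta> f)) (\<delta> (Fob R f)))"
    using sq del_del[OF f] del_mu[OF f] by (simp add: simps)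
qed (use L_ob R_ob \<epsilon> \<eta> rho_lam in \<open>simp_all add: L_mor R_mor\<close>)

end


section \<open>The algebraic weak factorisation system of cell complexes\<close>

lemma Mor_TOP2_iff:
  "Sq f a b g \<in> Mor TOP2 \<longleftrightarrow> f \<in> Mor TOP \<and> g \<in> Mor TOP \<and> a \<in> hom TOP (cdom f) (cdom g) \<and>
     b \<in> hom TOP (ccod f) (ccod g) \<and> Cmp TOP g a = Cmp TOP b f"
  using Sq_hom_arrow_cat[of f a b g TOP f g] by (simp add: hom_def)

lemma Cmap_eq: "a \<in> hom TOP X Y \<Longrightarrow> Cmap X (cfun a) Y = a"
  by (cases a) (simp add: hom_TOP)

lemma U_hom: "U_ob (K_ob f) \<in> hom TOP (cdom f) (cx_body (K_ob f))"
  by (simp add: hom_TOP U_ob_Mor is_cellcx_K_ob)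

lemma E_hom: "f \<in> Mor TOP \<Longrightarrow> E_ob f \<in> hom TOP (cx_body (K_ob f)) (ccod f)"
  by (simp add: hom_TOP E_ob_Mor)

lemma E_U:
  assumes f: "f \<in> Mor TOP"
  shows "Cmp TOP (E_ob f) (U_ob (K_ob f)) = f"
proof (rule TOP_hom_eqI[OF Cmp_TOP_hom[OF U_hom E_hom[OF f]]])
  show "f \<in> hom TOP (cdom f) (ccod f)"
    using f by (simp add: hom_TOP)
  fix x assume "x \<in> topspace (cdom f)"
  then show "cfun (Cmp TOP (E_ob f) (U_ob (K_ob f))) x = cfun f x"
    using E_ob_stage_incl[OF f, of x 0] by (simp add: compose_eq K_map_0)
qed

text \<open>The consequences of the universal property of \<open>K\<close> for the underlying maps of spaces.\<close>

lemma transpose: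
  assumes A: "is_cellcx A" and s: "Sq (U_ob A) a b f \<in> Mor TOP2"
  defines "\<phi> \<equiv> K_transpose A f (Sq (U_ob A) a b f)"
    and "m \<equiv> Cmap (cx_body A) (cx_map (K_transpose A f (Sq (U_ob A) a b f))) (cx_body (K_ob f))"
  shows "is_cellmor \<phi>" "cm_src \<phi> = A" "cm_tgt \<phi> = K_ob f" "Fmo U_functr \<phi> = Sq (U_ob A) a m (U_ob (K_ob f))"
    and "m \<in> hom TOP (cx_body A) (cx_body (K_ob f))" "cellular A (K_ob f) (cfun m)"
    and "Cmp TOP m (U_ob A) = Cmp TOP (U_ob (K_ob f)) a" "Cmp TOP (E_ob f) m = b"
proof -
  have f: "f \<in> Mor TOP" and ha: "a \<in> hom TOP (sbd (A 0)) (cdom f)" and hb: "b \<in> hom TOP (cx_body A) (ccod f)"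
    using s by (simp_all add: Mor_TOP2_iff)
  have s': "Sq (U_ob A) a b f \<in> hom TOP2 (U_ob A) f"
    using s by (simp add: hom_def)
  note lift = transpose_eq_lift[OF A f s']
  interpret square_from_U A f "cfun a" "cfun b"
    by (rule lift(1))
  have \<phi>: "\<phi> = lift A f (cfun a) (cfun b)"
    unfolding \<phi>_def by (rule lift(2))
  have m: "m = Cmap (cx_body A) (cx_map \<phi>) (cx_body (K_ob f))"
    unfolding m_def \<phi>_def ..
  show mor: "is_cellmor \<phi>" and src: "cm_src \<phi> = A" and tgt: "cm_tgt \<phi> = K_ob f"
    using is_cellmor_lift by (simp_all add: \<phi> lift_def)
  have 0: "cm_map \<phi> 0 = cfun a"
    by (simp add: \<phi> lift_def)
  show "Fmo U_functr \<phi> = Sq (U_ob A) a m (U_ob (K_ob f))"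
    using Cmap_eq[OF ha] by (simp add: U_functr_def src tgt 0 m)
  show hom: "m \<in> hom TOP (cx_body A) (cx_body (K_ob f))"
    using continuous_map_cx_map[OF mor] cx_map_extensional[of \<phi>] by (simp add: m hom_TOP Mor_TOP src tgt)
  show "cellular A (K_ob f) (cfun m)"
    using cellular_cx_map[OF mor] by (simp add: m src tgt)
  have U: "U_ob A \<in> hom TOP (sbd (A 0)) (cx_body A)"
    by (simp add: hom_TOP U_ob_Mor A)
  show "Cmp TOP m (U_ob A) = Cmp TOP (U_ob (K_ob f)) a"
  proof (rule TOP_hom_eqI[OF Cmp_TOP_hom[OF U hom] Cmp_TOP_hom[OF ha U_hom]])
    fix x assume x: "x \<in> pts (A 0)"
    then have "cfun a x \<in> topspace (cdom f)"
      using cfun_in[of a x] ha by (simp add: hom_TOP)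
    with x show "cfun (Cmp TOP m (U_ob A)) x = cfun (Cmp TOP (U_ob (K_ob f)) a) x"
      using ha cx_map_stage_incl[OF mor, of x] by (simp add: compose_eq hom_TOP m src 0)
  qed
  show "Cmp TOP (E_ob f) m = b"
    by (rule TOP_hom_eqI[OF Cmp_TOP_hom[OF hom E_hom[OF f]] hb]) (simp add: compose_eq m \<phi> E_ob_cx_map_lift)
qed

definition E_mult_body :: "'u::universe cmap \<Rightarrow> 'u cmap" where
  "E_mult_body f = sq_top (E_mult f)"

text \<open>Up to the identification of bodies, \<open>\<mu>\<close> is a transpose of \<open>E (E f)\<close>; this makes it a cellular map
  over \<open>E (E f)\<close>. Its restriction to the body of \<open>K f\<close> is a cellular map over \<open>E f\<close> which is the identity
  on the boundary, so it is the identity.\<close>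

lemma E_mult_body:
  assumes f: "f \<in> Mor TOP"
  shows "E_mult f = Sq (E_ob (E_ob f)) (E_mult_body f) (Idm TOP (ccod f)) (E_ob f)"
    and "E_mult_body f \<in> hom TOP (cx_body (K_ob (E_ob f))) (cx_body (K_ob f))"
    and "Cmp TOP (E_mult_body f) (U_ob (K_ob (E_ob f))) = Idm TOP (cx_body (K_ob f))"
    and "Cmp TOP (E_ob f) (E_mult_body f) = E_ob (E_ob f)"
    and "cellular (K_ob (E_ob f)) (K_ob f) (cfun (E_mult_body f))"
proof -
  let ?A = "K_ob f" and ?B = "K_ob (E_ob f)"
  interpret composing ?A ?B
    by standard (simp_all add: is_cellcx_K_ob)
  note Ef = E_ob_Mor[OF f] and EEf = E_ob_Mor[OF E_ob_Mor[OF f]]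
  obtain \<psi> where \<psi>: "homeomorphic_maps (cx_body ?B) (cx_body BA) ident \<psi>"
    using homeomorphic_ident by blast
  have inj: "inj_on ident (body_pts ?B)" and im: "ident ` body_pts ?B = body_pts BA"
    using \<psi> homeomorphic_maps_map[of "cx_body ?B" "cx_body BA" ident \<psi>]
    by (auto simp: homeomorphic_map_def homeomorphic_imp_surjective_map)
  have inv: "inv_into (body_pts ?B) ident z = \<psi> z" if z: "z \<in> body_pts BA" for z
    using \<psi> z inj by (intro inv_into_f_eq) (auto simp: homeomorphic_maps_def continuous_map_def)
  define b where "b = Cmap (cx_body BA) (\<lambda>z\<in>body_pts BA.
      cfun (E_ob (E_ob f)) (inv_into (body_pts ?B) ident z)) (ccod f)"
  have "continuous_map (cx_body BA) (ccod f) (cfun (E_ob (E_ob f)) \<circ> \<psi>)"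
    using \<psi> EEf by (intro continuous_map_compose[where X' = "cx_body ?B"]) (simp_all add: homeomorphic_maps_def Mor_TOP)
  then have "continuous_map (cx_body BA) (ccod f) (\<lambda>z\<in>body_pts BA.
      cfun (E_ob (E_ob f)) (inv_into (body_pts ?B) ident z))"
    by (rule continuous_map_eq) (simp add: inv)
  then have b: "b \<in> hom TOP (cx_body BA) (ccod f)"
    by (simp add: b_def hom_TOP Mor_TOP)
  have b_ident: "cfun b (ident y) = cfun (E_ob (E_ob f)) y" if y: "y \<in> body_pts ?B" for y
  proof -
    have "ident y \<in> body_pts BA"
      using im y by blast
    then show ?thesis
      using inv_into_f_f[OF inj y] by (simp add: b_def)
  qed
  have \<iota>_0: "cx_map (\<iota> 0) (stage_incl 0 x) = stage_incl 0 x" if "x \<in> topspace (cdom f)" for x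
    using cx_map_stage_incl[OF BA.\<iota>_mor, of x 0] that by (simp add: cx_comp_colimit(3) stage_0)
  have EE_0: "cfun (E_ob (E_ob f)) (stage_incl 0 z) = cfun (E_ob f) z" if "z \<in> body_pts ?A" for z
    using E_ob_stage_incl[OF Ef, of z 0] that by (simp add: K_map_0)
  have E_0: "cfun (E_ob f) (stage_incl 0 x) = cfun f x" if "x \<in> topspace (cdom f)" for x
    using E_ob_stage_incl[OF f, of x 0] that by (simp add: K_map_0)
  have UBA: "U_ob BA \<in> hom TOP (cdom f) (cx_body BA)"
    by (simp add: hom_TOP U_ob_Mor[OF BA.Q] cx_comp_colimit(2))
  have "Cmp TOP f (Idm TOP (cdom f)) = Cmp TOP b (U_ob BA)"
  proof (rule TOP_hom_eqI[OF Cmp_TOP_hom[OF Idm_TOP_hom] Cmp_TOP_hom[OF UBA b]])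
    show "f \<in> hom TOP (cdom f) (ccod f)"
      using f by (simp add: hom_TOP)
    fix x assume x: "x \<in> topspace (cdom f)"
    then have x0: "stage_incl 0 x \<in> body_pts ?A"
      using stage_incl_in_cx_body[of x ?A 0] by simp
    have "cfun b (stage_incl 0 x) = cfun b (ident (stage_incl 0 (stage_incl 0 x)))"
      by (simp add: ident_stage_0[OF x0] \<iota>_0[OF x])
    also have "\<dots> = cfun f x"
      using b_ident[of "stage_incl 0 (stage_incl 0 x)"] stage_incl_in_cx_body[of "stage_incl 0 x" ?B 0] x0 x
      by (simp add: EE_0 E_0)
    finally show "cfun (Cmp TOP f (Idm TOP (cdom f))) x = cfun (Cmp TOP b (U_ob BA)) x"
      using x by (simp add: compose_eq cx_comp_colimit(2))
  qed
  then have sq: "Sq (U_ob BA) (Idm TOP (cdom f)) b f \<in> Mor TOP2"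
    using b f Idm_TOP_hom[of "cdom f"] U_ob_Mor[OF BA.Q] unfolding Mor_TOP2_iff by (simp add: cx_comp_colimit(2))
  have mor: "E_mult_mor f = K_transpose BA f (Sq (U_ob BA) (Idm TOP (cdom f)) b f)"
    by (simp add: E_mult_mor_def Let_def b_def)
  define m where "m = Cmap (cx_body BA) (cx_map (E_mult_mor f)) (cx_body (K_ob f))"
  note tr = transpose[OF BA.Q sq, folded mor, folded m_def]
  define i where "i = Cmap (cx_body ?B) ident (cx_body BA)"
  have "ident \<in> extensional (body_pts ?B)"
    by (simp add: comp_ident_def)
  then have i: "i \<in> hom TOP (cx_body ?B) (cx_body BA)"
    using continuous_map_ident by (simp add: i_def hom_TOP Mor_TOP)
  have body: "E_mult_body f = Cmp TOP m i"
    by (simp add: E_mult_body_def E_mult_def Let_def m_def i_def TOP_def)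
  show "E_mult f = Sq (E_ob (E_ob f)) (E_mult_body f) (Idm TOP (ccod f)) (E_ob f)"
    by (simp add: E_mult_body_def E_mult_def Let_def)
  show hom: "E_mult_body f \<in> hom TOP (cx_body ?B) (cx_body ?A)"
    unfolding body by (rule Cmp_TOP_hom[OF i tr(5)])
  have mult: "cfun (E_mult_body f) y = cx_map (E_mult_mor f) (ident y)" if "y \<in> body_pts ?B" for y
    using that by (simp add: body compose_eq m_def i_def)
  have "cellular ?B ?A (\<lambda>y. cx_map (E_mult_mor f) (ident y))"
    using cellular_compose[OF cellular_ident tr(6)] by (simp add: m_def)
  then show cell: "cellular ?B ?A (cfun (E_mult_body f))"
    by (rule cellular_cong[OF is_cellcx_K_ob]) (rule mult)
  have E: "cfun (E_ob f) (cfun (E_mult_body f) y) = cfun (E_ob (E_ob f)) y" if y: "y \<in> body_pts ?B" for y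
  proof -
    have "ident y \<in> body_pts BA"
      using im y by blast
    then have "cfun (E_ob f) (cx_map (E_mult_mor f) (ident y)) = cfun b (ident y)"
      using arg_cong[OF tr(8), of "\<lambda>h. cfun h (ident y)"] by (simp add: compose_eq m_def)
    with y show ?thesis
      by (simp add: mult b_ident)
  qed
  show "Cmp TOP (E_ob f) (E_mult_body f) = E_ob (E_ob f)"
  proof (rule TOP_hom_eqI[OF Cmp_TOP_hom[OF hom]])
    show "E_ob f \<in> hom TOP (cx_body ?A) (ccod f)" "E_ob (E_ob f) \<in> hom TOP (cx_body ?B) (ccod f)"
      using Ef EEf by (simp_all add: hom_TOP)
    fix y assume "y \<in> body_pts ?B"
    then show "cfun (Cmp TOP (E_ob f) (E_mult_body f)) y = cfun (E_ob (E_ob f)) y"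
      using E hom by (simp add: compose_eq hom_TOP)
  qed
  have U: "U_ob ?B \<in> hom TOP (cx_body ?A) (cx_body ?B)"
    using U_hom[of "E_ob f"] by simp
  show "Cmp TOP (E_mult_body f) (U_ob ?B) = Idm TOP (cx_body ?A)"
  proof (rule TOP_hom_eqI[OF Cmp_TOP_hom[OF U hom] Idm_TOP_hom])
    fix z assume z: "z \<in> body_pts ?A"
    have in_B: "stage_incl 0 z \<in> body_pts ?B" if "z \<in> body_pts ?A" for z
      using stage_incl_in_cx_body[of z ?B 0] that by simp
    have "cx_map (E_mult_mor f) (cx_map (\<iota> 0) z) = z"
    proof (rule cellular_unique[where c = "\<lambda>z. cx_map (E_mult_mor f) (cx_map (\<iota> 0) z)" and c' = "\<lambda>z. z",
          OF is_cellcx_K_ob f _ _ _ _ z])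
      have "cellular ?A BA (cx_map (\<iota> 0))"
        using cellular_cx_map[OF BA.\<iota>_mor, of 0] by (simp add: stage_0)
      then show "cellular ?A ?A (\<lambda>z. cx_map (E_mult_mor f) (cx_map (\<iota> 0) z))"
        using cellular_compose tr(6) by (simp add: m_def)
      show "cellular ?A ?A (\<lambda>z. z)"
        unfolding cellular_def by blast
      fix x assume "x \<in> pts (?A 0)"
      then have x: "x \<in> topspace (cdom f)"
        by simp
      have "cx_map (E_mult_mor f) (stage_incl 0 x) = stage_incl 0 x"
        using arg_cong[OF tr(7), of "\<lambda>h. cfun h x"] x by (simp add: compose_eq m_def cx_comp_colimit(2))
      then show "cx_map (E_mult_mor f) (cx_map (\<iota> 0) (stage_incl 0 x)) = stage_incl 0 x"
        by (simp add: \<iota>_0[OF x])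
    next
      fix z assume z: "z \<in> body_pts ?A"
      then show "cfun (E_ob f) (cx_map (E_mult_mor f) (cx_map (\<iota> 0) z)) = cfun (E_ob f) z"
        using E[OF in_B[OF z]] by (simp add: mult in_B ident_stage_0 EE_0)
    qed
    then show "cfun (Cmp TOP (E_mult_body f) (U_ob ?B)) z = cfun (Idm TOP (cx_body ?A)) z"
      using z by (simp add: compose_eq mult in_B ident_stage_0)
  qed
qed



definition K_square :: "'u::universe cmap square \<Rightarrow> 'u cmap" where
  "K_square \<sigma> = Cmap (cx_body (K_ob (sq_src \<sigma>))) (cx_map (Fmo K_functr \<sigma>)) (cx_body (K_ob (sq_tgt \<sigma>)))"

lemma K_square:
  assumes s: "\<sigma> \<in> Mor TOP2"
  shows "Fmo UK \<sigma> = Sq (U_ob (K_ob (sq_src \<sigma>))) (sq_top \<sigma>) (K_square \<sigma>) (U_ob (K_ob (sq_tgt \<sigma>)))"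
    and "K_square \<sigma> \<in> hom TOP (cx_body (K_ob (sq_src \<sigma>))) (cx_body (K_ob (sq_tgt \<sigma>)))"
    and "cellular (K_ob (sq_src \<sigma>)) (K_ob (sq_tgt \<sigma>)) (cfun (K_square \<sigma>))"
    and "Cmp TOP (K_square \<sigma>) (U_ob (K_ob (sq_src \<sigma>))) = Cmp TOP (U_ob (K_ob (sq_tgt \<sigma>))) (sq_top \<sigma>)"
    and "Cmp TOP (E_ob (sq_tgt \<sigma>)) (K_square \<sigma>) = Cmp TOP (sq_bot \<sigma>) (E_ob (sq_src \<sigma>))"
proof -
  interpret category TOP
    by (rule category_TOP)
  obtain f a b g where \<sigma>: "\<sigma> = Sq f a b g"
    by (cases \<sigma>)
  let ?A = "K_ob f"
  have mor: "f \<in> Mor TOP" "g \<in> Mor TOP" "a \<in> hom TOP (cdom f) (cdom g)" "b \<in> hom TOP (ccod f) (ccod g)"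
      "Cmp TOP g a = Cmp TOP b f"
    using s by (simp_all add: \<sigma> Mor_TOP2_iff)
  have aI: "Cmp TOP a (Idm TOP (cdom f)) = a"
    by (rule cmp_id_right[OF mor(3)])
  have "Cmp TOP (Cmp TOP b (E_ob f)) (U_ob ?A) = Cmp TOP b f"
    using cmp_assoc[OF U_hom E_hom[OF mor(1)] mor(4)] E_U[OF mor(1)] by simp
  then have sq: "Sq (U_ob ?A) a (Cmp TOP b (E_ob f)) g \<in> Mor TOP2"
    using mor Cmp_TOP_hom[OF E_hom[OF mor(1)] mor(4)] by (simp add: Mor_TOP2_iff U_ob_Mor is_cellcx_K_ob)
  have "Fmo K_functr \<sigma> = K_transpose ?A g (Sq (U_ob ?A) a (Cmp TOP b (E_ob f)) g)"
    using aI by (simp add: K_functr_def right_adjoint_def \<sigma> UK_counit_def)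
  note tr = transpose[OF is_cellcx_K_ob sq, folded this]
  have "K_square \<sigma> = Cmap (cx_body ?A) (cx_map (Fmo K_functr \<sigma>)) (cx_body (K_ob g))"
    by (simp add: K_square_def \<sigma>)
  note tr = tr[folded this]
  show "Fmo UK \<sigma> = Sq (U_ob (K_ob (sq_src \<sigma>))) (sq_top \<sigma>) (K_square \<sigma>) (U_ob (K_ob (sq_tgt \<sigma>)))"
    using tr(4) by (simp add: UK_def cmp_functr_def \<sigma>)
  show "K_square \<sigma> \<in> hom TOP (cx_body (K_ob (sq_src \<sigma>))) (cx_body (K_ob (sq_tgt \<sigma>)))"
    "cellular (K_ob (sq_src \<sigma>)) (K_ob (sq_tgt \<sigma>)) (cfun (K_square \<sigma>))"
    "Cmp TOP (K_square \<sigma>) (U_ob (K_ob (sq_src \<sigma>))) = Cmp TOP (U_ob (K_ob (sq_tgt \<sigma>))) (sq_top \<sigma>)"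
    "Cmp TOP (E_ob (sq_tgt \<sigma>)) (K_square \<sigma>) = Cmp TOP (sq_bot \<sigma>) (E_ob (sq_src \<sigma>))"
    using tr(5-8) by (simp_all add: \<sigma>)
qed

lemma UK_comult:
  assumes f: "f \<in> Mor TOP"
  shows "UK_comult f = Sq (U_ob (K_ob f)) (Idm TOP (cdom f)) (sq_bot (UK_comult f)) (U_ob (K_ob (U_ob (K_ob f))))"
    and "sq_bot (UK_comult f) \<in> hom TOP (cx_body (K_ob f)) (cx_body (K_ob (U_ob (K_ob f))))"
    and "cellular (K_ob f) (K_ob (U_ob (K_ob f))) (cfun (sq_bot (UK_comult f)))"
    and "Cmp TOP (sq_bot (UK_comult f)) (U_ob (K_ob f)) = U_ob (K_ob (U_ob (K_ob f)))"
    and "Cmp TOP (E_ob (U_ob (K_ob f))) (sq_bot (UK_comult f)) = Idm TOP (cx_body (K_ob f))"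
proof -
  interpret category TOP
    by (rule category_TOP)
  let ?A = "K_ob f" and ?l = "U_ob (K_ob f)"
  have l: "?l \<in> hom TOP (cdom f) (cx_body ?A)" and ll: "U_ob (K_ob ?l) \<in> hom TOP (cdom f) (cx_body (K_ob ?l))"
    using U_hom[of ?l] by (simp_all add: U_hom)
  have sq: "Sq ?l (Idm TOP (cdom f)) (Idm TOP (cx_body ?A)) ?l \<in> Mor TOP2"
    using l Idm_TOP_hom[of "cdom f"] Idm_TOP_hom[of "cx_body ?A"] cmp_id_right[OF l] cmp_id_left[OF l] unfolding Mor_TOP2_iff by (simp add: hom_TOP)
  note tr = transpose[OF is_cellcx_K_ob sq]
  have "UK_comult f = Fmo U_functr (K_transpose ?A ?l
      (Sq ?l (Idm TOP (cdom f)) (Idm TOP (cx_body ?A)) ?l))"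
    by (simp add: UK_comult_def adjunction_comult_def U_functr_def)
  then have eq: "UK_comult f = Sq ?l (Idm TOP (cdom f)) (Cmap (cx_body ?A) (cx_map (K_transpose ?A ?l
      (Sq ?l (Idm TOP (cdom f)) (Idm TOP (cx_body ?A)) ?l))) (cx_body (K_ob ?l))) (U_ob (K_ob ?l))"
    by (simp only: tr(4))
  note tr = tr(5-8)[folded arg_cong[OF eq, of sq_bot, unfolded square.sel]]
  show "UK_comult f = Sq ?l (Idm TOP (cdom f)) (sq_bot (UK_comult f)) (U_ob (K_ob ?l))"
    by (subst (1) eq) (simp only: arg_cong[OF eq, of sq_bot, unfolded square.sel])
  show "sq_bot (UK_comult f) \<in> hom TOP (cx_body ?A) (cx_body (K_ob ?l))"
    "cellular ?A (K_ob ?l) (cfun (sq_bot (UK_comult f)))"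
    "Cmp TOP (E_ob ?l) (sq_bot (UK_comult f)) = Idm TOP (cx_body ?A)"
    by (fact tr(1) tr(2) tr(4))+
  show "Cmp TOP (sq_bot (UK_comult f)) ?l = U_ob (K_ob ?l)"
    using tr(3) cmp_id_right[OF ll] by simp
qed

theorem proposition7p2:
  shows "awfs (TOP :: ('u::universe topology, 'u cmap) cat) UK UK_counit UK_comult E_functr E_unit E_mult"
proof -
  interpret T: category "TOP :: ('u topology, 'u cmap) cat"
    by (rule category_TOP)
  interpret cellular_factorisation "TOP :: ('u topology, 'u cmap) cat" UK UK_counit UK_comult E_functr E_unit E_mult
    "\<lambda>f. U_ob (K_ob f)" E_ob "\<lambda>f. sq_bot (UK_comult f)" E_mult_body K_square
    "\<lambda>f g c. cellular (K_ob f) (K_ob g) (cfun c)"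
  proof
    fix f g h c c' :: "'u cmap" and \<sigma> :: "'u cmap square"
    assume f: "f \<in> Mor TOP"
    show "cellular (K_ob f) (K_ob f) (cfun (Idm TOP (Cod TOP (U_ob (K_ob f)))))"
      by (rule cellular_cong[of _ _ "\<lambda>z. z", OF is_cellcx_K_ob]) (auto simp: cellular_def)
    assume g: "g \<in> Mor TOP" and c: "c \<in> hom TOP (Cod TOP (U_ob (K_ob f))) (Cod TOP (U_ob (K_ob g)))"
      and cc: "cellular (K_ob f) (K_ob g) (cfun c)"
    {
      assume h: "h \<in> Mor TOP" and c': "c' \<in> hom TOP (Cod TOP (U_ob (K_ob g))) (Cod TOP (U_ob (K_ob h)))"
        and cc': "cellular (K_ob g) (K_ob h) (cfun c')"
      show "cellular (K_ob f) (K_ob h) (cfun (Cmp TOP c' c))"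
        by (rule cellular_cong[OF is_cellcx_K_ob cellular_compose[OF cc cc']]) (use c in \<open>simp add: compose_eq hom_TOP\<close>)
    }
    {
      assume c': "c' \<in> hom TOP (Cod TOP (U_ob (K_ob f))) (Cod TOP (U_ob (K_ob g)))"
        and cc': "cellular (K_ob f) (K_ob g) (cfun c')"
        and bd: "Cmp TOP c (U_ob (K_ob f)) = Cmp TOP c' (U_ob (K_ob f))"
        and E: "Cmp TOP (E_ob g) c = Cmp TOP (E_ob g) c'"
      show "c = c'"
      proof (rule TOP_hom_eqI[OF c c'])
        fix z assume "z \<in> topspace (Cod TOP (U_ob (K_ob f)))"
        then have z: "z \<in> body_pts (K_ob f)"
          by simp
        show "cfun c z = cfun c' z"
        proof (rule cellular_unique[OF is_cellcx_K_ob g cc cc' _ _ z])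
          fix x assume "x \<in> pts (K_ob f 0)"
          then show "cfun c (stage_incl 0 x) = cfun c' (stage_incl 0 x)"
            using arg_cong[OF bd, of "\<lambda>h. cfun h x"] by (simp add: compose_eq)
        next
          fix z assume "z \<in> body_pts (K_ob f)"
          then show "cfun (E_ob g) (cfun c z) = cfun (E_ob g) (cfun c' z)"
            using arg_cong[OF E, of "\<lambda>h. cfun h z"] c c' by (simp add: compose_eq hom_TOP)
        qed
      qed
    }
  qed (use U_hom E_hom in \<open>simp_all add: hom_TOP[of "U_ob _"] UK_comult(2-5) E_mult_body(2-5) K_square E_U
      UK_comult(1)[symmetric, simplified] E_mult_body(1)[symmetric, simplified] UK_counit_def E_unit_def\<close>,
    simp_all add: UK_def cmp_functr_def U_functr_def K_functr_def right_adjoint_def E_functr_def K_square_def)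
  show ?thesis
    by (rule is_awfs)
qed

end
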